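(* Let $k\in\mathbb{N}_0$ and let $h\in C^{k,k}(\overline\Theta\times\overline\Theta)$ be positive definite. Then, as Hilbert spaces of functions, $$(\mathcal{H}_{h,k},\langle\cdot,\cdot\rangle_{\mathcal{H}_{h,k}})=(H_h,\langle\cdot,\cdot\rangle_{H_h}),$$ where $H_h$ is the reproducing kernel Hilbert space associated with $h$ and $\mathcal{H}_{h,k}$ is the spectrally defined space $$\mathcal{H}_{h,k}=\Big\{f\in H^k(\Theta)\ \Big|\ f=\sum_j a_j\,e_{j,k}\ \text{ with }\ (\lambda_{j,k}^{-1/2}a_j)_j\in\ell^2\Big\},\qquad \langle f,g\rangle_{\mathcal{H}_{h,k}}=\sum_j\lambda_{j,k}^{-1}\,a_j\,b_j$$ for $f=\sum_ja_je_{j,k}$, $g=\sum_jb_je_{j,k}$, where $\{(\lambda_{j,k},e_{j,k})\}_j$ is the eigensystem of the kernel operator $T_{h,k}$.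
   Context: $d\in\mathbb{N}$ and $\Theta\subset\mathbb{R}^d$ is a bounded domain, meaning a bounded open subset. All functions are real-valued; $\alpha,\beta\in\mathbb{N}_0^d$ are multi-indices. $f^{(\alpha)}$ is the weak derivative. $\partial^{[\alpha,\beta]}h$ is the classical mixed derivative of a kernel $h$ on $\Theta\times\Theta$, of order $\alpha$ in the first variable and $\beta$ in the second. $C^{k,k}(\overline\Theta\times\overline\Theta)$ is the class of uniformly continuous kernels $h\colon\Theta\times\Theta\to\mathbb{R}$ whose mixed partial derivatives $\partial^{[\alpha,\beta]}h$ exist and are uniformly continuous on $\Theta\times\Theta$ for $|\alpha|,|\beta|\le k$. Uniformly continuous functions are identified with their continuous extensions to the closure. A kernel $h$ is positive definite if it is symmetric and $\sum_{i,j\le n}c_i\,h(x_i,x_j)\,c_j\ge0$ for all $n\in\mathbb{N}$, $c_i\in\mathbb{R}$, $x_i\in\Theta$. $H^k(\Theta)$ is the $L^2$-based Sobolev space with inner product $\langle f,g\rangle_{H^k}=\sum_{|\alpha|\le k}\langle f^{(\alpha)},g^{(\alpha)}\rangle_{L^2}$. The kernel operator of order $k$ associated with $h$ is the non-negative self-adjoint compact operator $T_{h,k}\colon H^k(\Theta)\to H^k(\Theta)$, $$[T_{h,k}f](y)=\int_\Theta\sum_{|\alpha|\le k}\partial^{[\alpha,0]}h(x,y)\,f^{(\alpha)}(x)\,dx .$$ Its eigensystem consists of the non-zero (hence positive) eigenvalues $\lambda_{j,k}$, counted with multiplicity and in descending order, with corresponding $H^k$-orthonormal eigenfunctions $e_{j,k}$.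 The index $j$ runs over $\mathbb{N}$, or over $\{1,\dots,N\}$ if $N=\mathrm{rank}(T_{h,k})<\infty$; sums and sequences over $j$ are over this index set. In the expansion $f=\sum_ja_je_{j,k}$ (convergent in $H^k(\Theta)$) one has $a_j=\langle f,e_{j,k}\rangle_{H^k}$. Elements of $\mathcal{H}_{h,k}$ are identified with their continuous representatives. $H_h$ is the unique Hilbert space of functions on $\Theta$ which contains $h(x,\cdot)$ for all $x\in\Theta$ and satisfies $\langle f,h(x,\cdot)\rangle_{H_h}=f(x)$ for all $f\in H_h$, $x\in\Theta$. *)

theory Defs
  imports "HOL-Analysis.Analysis"
begin

section \<open>Classical partial derivatives\<close>

text \<open>
  \<open>partials v ds f\<close> is the iterated partial derivative of \<open>f\<close> along the directions
  \<open>v d\<close>, \<open>d\<close> in \<open>ds\<close>, the last entry of \<open>ds\<close> being applied first. It is meaningful at the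
  points of an open set \<open>S\<close> if \<open>partials_exist v S ds f\<close> holds; only values of \<open>f\<close> on \<open>S\<close> matter.
\<close>

definition partial :: "'a::real_normed_vector \<Rightarrow> ('a \<Rightarrow> real) \<Rightarrow> 'a \<Rightarrow> real" where
  "partial u f x = deriv (\<lambda>t. f (x + t *\<^sub>R u)) 0"

primrec partials ::
    "('i \<Rightarrow> 'a::real_normed_vector) \<Rightarrow> 'i list \<Rightarrow> ('a \<Rightarrow> real) \<Rightarrow> 'a \<Rightarrow> real" where
  "partials v [] f = f"
| "partials v (d # ds) f = partial (v d) (partials v ds f)"

primrec partials_exist ::
    "('i \<Rightarrow> 'a::real_normed_vector) \<Rightarrow> 'a set \<Rightarrow> 'i list \<Rightarrow> ('a \<Rightarrow> real) \<Rightarrow> bool" where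
  "partials_exist v S [] f \<longleftrightarrow> True"
| "partials_exist v S (d # ds) f \<longleftrightarrow> partials_exist v S ds f \<and>
     (\<forall>x\<in>S. (\<lambda>t. partials v ds f (x + t *\<^sub>R v d)) differentiable (at 0))"

text \<open>
  The derivative belonging to a multi-index. The order of differentiation is left to choice; it is
  irrelevant for the functions considered below, all of whose partial derivatives of the orders
  in question exist in every order of differentiation and are continuous.
\<close>

definition mi_partial ::
    "('i \<Rightarrow> 'a::real_normed_vector) \<Rightarrow> ('i \<Rightarrow> nat) \<Rightarrow> ('a \<Rightarrow> real) \<Rightarrow> 'a \<Rightarrow> real" where
  "mi_partial v \<alpha> f = partials v (SOME ds. \<forall>i. count_list ds i = \<alpha> i) f"

definition mi_order :: "('n::finite \<Rightarrow> nat) \<Rightarrow> nat" where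
  "mi_order \<alpha> = (\<Sum>i\<in>UNIV. \<alpha> i)"

definition dir :: "'n \<Rightarrow> real ^ 'n" where
  "dir i = axis i 1"

text \<open>Directions in the first (\<open>Inl\<close>) and in the second (\<open>Inr\<close>) variable of a kernel.\<close>

definition kernel_dir :: "'n + 'n \<Rightarrow> (real ^ 'n) \<times> (real ^ 'n)" where
  "kernel_dir = case_sum (\<lambda>i. (dir i, 0)) (\<lambda>i. (0, dir i))"

definition mixed_partial :: "('n \<Rightarrow> nat) \<Rightarrow> ('n \<Rightarrow> nat) \<Rightarrow>
    (real ^ 'n \<Rightarrow> real ^ 'n \<Rightarrow> real) \<Rightarrow> real ^ 'n \<Rightarrow> real ^ 'n \<Rightarrow> real" where
  "mixed_partial \<alpha> \<beta> h x y = mi_partial kernel_dir (case_sum \<alpha> \<beta>) (\<lambda>(x, y). h x y) (x, y)"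


section \<open>Kernels\<close>

text \<open>
  The class \<open>C\<^sup>k\<^sup>,\<^sup>k\<close>: all mixed partial derivatives (in any order of differentiation) of order at most
  \<open>k\<close> in each of the two variables exist and are uniformly continuous on \<open>\<Theta> \<times> \<Theta>\<close>.
  The empty list of directions accounts for the uniform continuity of the kernel itself.
\<close>

definition C_kk ::
    "nat \<Rightarrow> (real ^ 'n::finite) set \<Rightarrow> (real ^ 'n \<Rightarrow> real ^ 'n \<Rightarrow> real) set" where
  "C_kk k \<Theta> = {h. \<forall>ds :: ('n + 'n) list.
     length (filter isl ds) \<le> k \<and> length (filter (\<lambda>d. \<not> isl d) ds) \<le> k \<longrightarrow>
       partials_exist kernel_dir (\<Theta> \<times> \<Theta>) ds (\<lambda>(x, y). h x y) \<and>
       uniformly_continuous_on (\<Theta> \<times> \<Theta>) (partials kernel_dir ds (\<lambda>(x, y). h x y))}"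

definition positive_definite_kernel :: "'a set \<Rightarrow> ('a \<Rightarrow> 'a \<Rightarrow> real) \<Rightarrow> bool" where
  "positive_definite_kernel \<Theta> h \<longleftrightarrow>
     (\<forall>x\<in>\<Theta>. \<forall>y\<in>\<Theta>. h x y = h y x) \<and>
     (\<forall>(n::nat) (c :: nat \<Rightarrow> real) x. (\<forall>i<n. x i \<in> \<Theta>) \<longrightarrow>
        0 \<le> (\<Sum>i<n. \<Sum>j<n. c i * h (x i) (x j) * c j))"


section \<open>The Sobolev space\<close>

text \<open>
  Elements of \<open>L\<^sup>2\<close> and of the Sobolev spaces are represented by functions; two functions
  represent the same element iff they agree almost everywhere on \<open>\<Theta>\<close>.
\<close>

definition L2 :: "(real ^ 'n::finite) set \<Rightarrow> (real ^ 'n \<Rightarrow> real) set" where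
  "L2 \<Theta> = {f. f \<in> borel_measurable (lebesgue_on \<Theta>) \<and>
              integrable (lebesgue_on \<Theta>) (\<lambda>x. (f x)\<^sup>2)}"

definition L2_inner :: "(real ^ 'n::finite) set \<Rightarrow>
    (real ^ 'n \<Rightarrow> real) \<Rightarrow> (real ^ 'n \<Rightarrow> real) \<Rightarrow> real" where
  "L2_inner \<Theta> f g = (\<integral>x. f x * g x \<partial>lebesgue_on \<Theta>)"

definition locally_integrable :: "(real ^ 'n::finite) set \<Rightarrow> (real ^ 'n \<Rightarrow> real) \<Rightarrow> bool" where
  "locally_integrable \<Theta> f \<longleftrightarrow> (\<forall>K. compact K \<and> K \<subseteq> \<Theta> \<longrightarrow> f absolutely_integrable_on K)"

definition test_function :: "(real ^ 'n::finite) set \<Rightarrow> (real ^ 'n \<Rightarrow> real) \<Rightarrow> bool" where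
  "test_function \<Theta> \<phi> \<longleftrightarrow>
     (\<forall>ds. partials_exist dir UNIV ds \<phi> \<and> continuous_on UNIV (partials dir ds \<phi>)) \<and>
     compact (closure {x. \<phi> x \<noteq> 0}) \<and> closure {x. \<phi> x \<noteq> 0} \<subseteq> \<Theta>"

definition has_weak_deriv :: "(real ^ 'n::finite) set \<Rightarrow> ('n \<Rightarrow> nat) \<Rightarrow>
    (real ^ 'n \<Rightarrow> real) \<Rightarrow> (real ^ 'n \<Rightarrow> real) \<Rightarrow> bool" where
  "has_weak_deriv \<Theta> \<alpha> f g \<longleftrightarrow> locally_integrable \<Theta> f \<and> locally_integrable \<Theta> g \<and>
     (\<forall>\<phi>. test_function \<Theta> \<phi> \<longrightarrow>
        (\<integral>x. f x * mi_partial dir \<alpha> \<phi> x \<partial>lebesgue_on \<Theta>) =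
        (- 1) ^ mi_order \<alpha> * (\<integral>x. g x * \<phi> x \<partial>lebesgue_on \<Theta>))"

text \<open>Well defined up to null sets.\<close>

definition weak_deriv :: "(real ^ 'n::finite) set \<Rightarrow> ('n \<Rightarrow> nat) \<Rightarrow>
    (real ^ 'n \<Rightarrow> real) \<Rightarrow> real ^ 'n \<Rightarrow> real" where
  "weak_deriv \<Theta> \<alpha> f = (SOME g. has_weak_deriv \<Theta> \<alpha> f g)"

definition Hk :: "nat \<Rightarrow> (real ^ 'n::finite) set \<Rightarrow> (real ^ 'n \<Rightarrow> real) set" where
  "Hk k \<Theta> = {f \<in> L2 \<Theta>. \<forall>\<alpha>. mi_order \<alpha> \<le> k \<longrightarrow> (\<exists>g\<in>L2 \<Theta>. has_weak_deriv \<Theta> \<alpha> f g)}"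

definition Hk_inner :: "nat \<Rightarrow> (real ^ 'n::finite) set \<Rightarrow>
    (real ^ 'n \<Rightarrow> real) \<Rightarrow> (real ^ 'n \<Rightarrow> real) \<Rightarrow> real" where
  "Hk_inner k \<Theta> f g =
     (\<Sum>\<alpha> | mi_order \<alpha> \<le> k. L2_inner \<Theta> (weak_deriv \<Theta> \<alpha> f) (weak_deriv \<Theta> \<alpha> g))"

definition Hk_norm :: "nat \<Rightarrow> (real ^ 'n::finite) set \<Rightarrow> (real ^ 'n \<Rightarrow> real) \<Rightarrow> real" where
  "Hk_norm k \<Theta> f = sqrt (Hk_inner k \<Theta> f f)"


section \<open>The kernel operator and its eigensystem\<close>

definition kernel_op :: "nat \<Rightarrow> (real ^ 'n::finite) set \<Rightarrow>
    (real ^ 'n \<Rightarrow> real ^ 'n \<Rightarrow> real) \<Rightarrow> (real ^ 'n \<Rightarrow> real) \<Rightarrow> real ^ 'n \<Rightarrow> real" where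
  "kernel_op k \<Theta> h f y =
     (\<integral>x. (\<Sum>\<alpha> | mi_order \<alpha> \<le> k. mixed_partial \<alpha> (\<lambda>_. 0) h x y * weak_deriv \<Theta> \<alpha> f x)
        \<partial>lebesgue_on \<Theta>)"

definition eigenspace :: "nat \<Rightarrow> (real ^ 'n::finite) set \<Rightarrow>
    (real ^ 'n \<Rightarrow> real ^ 'n \<Rightarrow> real) \<Rightarrow> real \<Rightarrow> (real ^ 'n \<Rightarrow> real) set" where
  "eigenspace k \<Theta> h \<mu> =
     {f \<in> Hk k \<Theta>. AE x in lebesgue_on \<Theta>. kernel_op k \<Theta> h f x = \<mu> * f x}"

text \<open>
  The final clause says that the \<open>e j\<close> with \<open>lam j = \<mu>\<close> span the eigenspace of \<open>\<mu>\<close> (up to null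
  sets). Together with orthonormality this expresses that every non-zero eigenvalue is listed,
  according to its multiplicity; in particular, \<open>J\<close> is finite iff the operator has finite rank,
  and then \<open>card J\<close> is its rank.
\<close>

definition eigensystem :: "nat \<Rightarrow> (real ^ 'n::finite) set \<Rightarrow> (real ^ 'n \<Rightarrow> real ^ 'n \<Rightarrow> real) \<Rightarrow>
    nat set \<Rightarrow> (nat \<Rightarrow> real) \<Rightarrow> (nat \<Rightarrow> real ^ 'n \<Rightarrow> real) \<Rightarrow> bool" where
  "eigensystem k \<Theta> h J lam e \<longleftrightarrow>
     (J = {1..} \<or> (\<exists>N. J = {1..N})) \<and>
     (\<forall>j\<in>J. lam j \<noteq> 0 \<and> e j \<in> eigenspace k \<Theta> h (lam j)) \<and>
     (\<forall>i\<in>J. \<forall>j\<in>J. i \<le> j \<longrightarrow> lam j \<le> lam i) \<and>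
     (\<forall>i\<in>J. \<forall>j\<in>J. Hk_inner k \<Theta> (e i) (e j) = (if i = j then 1 else 0)) \<and>
     (\<forall>\<mu> f. \<mu> \<noteq> 0 \<and> f \<in> eigenspace k \<Theta> h \<mu> \<longrightarrow>
        (\<exists>F c. finite F \<and> F \<subseteq> {j\<in>J. lam j = \<mu>} \<and>
           (AE x in lebesgue_on \<Theta>. f x = (\<Sum>j\<in>F. c j * e j x))))"


section \<open>The spectrally defined space\<close>

text \<open>\<open>f = (\<Sum>j\<in>J. a j * e j)\<close> with convergence of the partial sums in the Sobolev space.\<close>

definition has_expansion :: "nat \<Rightarrow> (real ^ 'n::finite) set \<Rightarrow> nat set \<Rightarrow>
    (nat \<Rightarrow> real ^ 'n \<Rightarrow> real) \<Rightarrow> (real ^ 'n \<Rightarrow> real) \<Rightarrow> (nat \<Rightarrow> real) \<Rightarrow> bool" where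
  "has_expansion k \<Theta> J e f a \<longleftrightarrow>
     (\<lambda>n. Hk_norm k \<Theta> (\<lambda>x. f x - (\<Sum>j\<in>J \<inter> {..n}. a j * e j x))) \<longlonglongrightarrow> 0"

definition spectral_class :: "nat \<Rightarrow> (real ^ 'n::finite) set \<Rightarrow> nat set \<Rightarrow> (nat \<Rightarrow> real) \<Rightarrow>
    (nat \<Rightarrow> real ^ 'n \<Rightarrow> real) \<Rightarrow> (real ^ 'n \<Rightarrow> real) set" where
  "spectral_class k \<Theta> J lam e =
     {f \<in> Hk k \<Theta>. \<exists>a. has_expansion k \<Theta> J e f a \<and>
                      (\<lambda>j. (a j / sqrt (lam j))\<^sup>2) summable_on J}"

definition spectral_inner :: "nat \<Rightarrow> (real ^ 'n::finite) set \<Rightarrow> nat set \<Rightarrow> (nat \<Rightarrow> real) \<Rightarrow>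
    (nat \<Rightarrow> real ^ 'n \<Rightarrow> real) \<Rightarrow> (real ^ 'n \<Rightarrow> real) \<Rightarrow> (real ^ 'n \<Rightarrow> real) \<Rightarrow> real" where
  "spectral_inner k \<Theta> J lam e f g =
     (\<Sum>\<^sub>\<infinity>j\<in>J. Hk_inner k \<Theta> f (e j) * Hk_inner k \<Theta> g (e j) / lam j)"

text \<open>
  Honest functions on \<open>\<Theta>\<close> are represented by their extensions by \<open>0\<close>. A Hilbert space of
  functions on \<open>\<Theta>\<close> is a pair of a carrier and an inner product. In order that equality of pairs
  is equality of Hilbert spaces, the inner product is required to vanish off the carrier.
\<close>

type_synonym 'a function_space = "('a \<Rightarrow> real) set \<times> (('a \<Rightarrow> real) \<Rightarrow> ('a \<Rightarrow> real) \<Rightarrow> real)"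

definition continuous_rep ::
    "(real ^ 'n::finite) set \<Rightarrow> (real ^ 'n \<Rightarrow> real) \<Rightarrow> real ^ 'n \<Rightarrow> real" where
  "continuous_rep \<Theta> f =
     (THE g. continuous_on \<Theta> g \<and> (\<forall>x. x \<notin> \<Theta> \<longrightarrow> g x = 0) \<and>
             (AE x in lebesgue_on \<Theta>. g x = f x))"

definition spectral_space :: "nat \<Rightarrow> (real ^ 'n::finite) set \<Rightarrow> nat set \<Rightarrow> (nat \<Rightarrow> real) \<Rightarrow>
    (nat \<Rightarrow> real ^ 'n \<Rightarrow> real) \<Rightarrow> (real ^ 'n) function_space" where
  "spectral_space k \<Theta> J lam e =
     (let H = continuous_rep \<Theta> ` spectral_class k \<Theta> J lam e
      in (H, \<lambda>f g. if f \<in> H \<and> g \<in> H then spectral_inner k \<Theta> J lam e f g else 0))"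


section \<open>Reproducing kernel Hilbert spaces\<close>

definition hilbert_function_space :: "'a set \<Rightarrow> 'a function_space \<Rightarrow> bool" where
  "hilbert_function_space \<Theta> HS \<longleftrightarrow> (case HS of (H, ip) \<Rightarrow>
     (\<forall>f\<in>H. \<forall>x. x \<notin> \<Theta> \<longrightarrow> f x = 0) \<and>
     (\<lambda>x. 0) \<in> H \<and>
     (\<forall>f\<in>H. \<forall>g\<in>H. (\<lambda>x. f x + g x) \<in> H) \<and>
     (\<forall>c. \<forall>f\<in>H. (\<lambda>x. c * f x) \<in> H) \<and>
     (\<forall>f g. f \<notin> H \<or> g \<notin> H \<longrightarrow> ip f g = 0) \<and>
     (\<forall>f\<in>H. \<forall>g\<in>H. ip f g = ip g f) \<and>
     (\<forall>f\<in>H. \<forall>g\<in>H. \<forall>u\<in>H. ip (\<lambda>x. f x + g x) u = ip f u + ip g u) \<and>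
     (\<forall>c. \<forall>f\<in>H. \<forall>g\<in>H. ip (\<lambda>x. c * f x) g = c * ip f g) \<and>
     (\<forall>f\<in>H. 0 \<le> ip f f \<and> (ip f f = 0 \<longrightarrow> f = (\<lambda>x. 0))) \<and>
     Metric_space.mcomplete H (\<lambda>f g. sqrt (ip (\<lambda>x. f x - g x) (\<lambda>x. f x - g x))))"

definition kernel_section :: "'a set \<Rightarrow> ('a \<Rightarrow> 'a \<Rightarrow> real) \<Rightarrow> 'a \<Rightarrow> 'a \<Rightarrow> real" where
  "kernel_section \<Theta> h x = (\<lambda>y. if y \<in> \<Theta> then h x y else 0)"

text \<open>The unique Hilbert space of functions on \<open>\<Theta>\<close> with reproducing kernel \<open>h\<close>.\<close>

definition RKHS :: "'a set \<Rightarrow> ('a \<Rightarrow> 'a \<Rightarrow> real) \<Rightarrow> 'a function_space" where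
  "RKHS \<Theta> h = (THE HS. hilbert_function_space \<Theta> HS \<and> (case HS of (H, ip) \<Rightarrow>
     (\<forall>x\<in>\<Theta>. kernel_section \<Theta> h x \<in> H \<and> (\<forall>f\<in>H. ip f (kernel_section \<Theta> h x) = f x))))"

end

theory Submission
  imports Defs "HOL-Complex_Analysis.Great_Picard"
begin

text \<open>
  A Hilbert space of functions is determined by its reproducing kernel, so it suffices to see that the
  spectral space is one with kernel \<open>h\<close>. Write \<open>K\<^sub>x = h(\<cdot>, x)\<close>; then \<open>T f(x) = \<langle>f, K\<^sub>x\<rangle>\<close> in \<open>H\<^sup>k\<close>. Positivity of
  \<open>h\<close> passes through difference quotients to the matrix kernel \<open>\<partial>\<^sup>[\<^sup>\<alpha>\<^sup>,\<^sup>\<beta>\<^sup>]h\<close> and through Riemann sums to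
  densities combined with one point evaluation. Testing it on combinations of the eigenfunctions yields the
  Bessel inequality \<open>\<Sum>\<^sub>j \<lambda>\<^sub>j (\<partial>\<^sup>\<alpha>e\<^sub>j(x))\<^sup>2 \<le> \<partial>\<^sup>[\<^sup>\<alpha>\<^sup>,\<^sup>\<alpha>\<^sup>]h(x, x)\<close>, by which all series \<open>\<Sum>\<^sub>j c\<^sub>j \<surd>\<lambda>\<^sub>j e\<^sub>j\<close> with
  square summable \<open>c\<close> converge uniformly together with their derivatives. The remainder of the expansion of
  \<open>K\<^sub>x\<close> is orthogonal to all eigenfunctions, hence in the kernel of the compact operator \<open>T\<close>, and therefore \<open>0\<close>;
  so \<open>h(x, y) = \<Sum>\<^sub>j \<lambda>\<^sub>j e\<^sub>j(x) e\<^sub>j(y)\<close>, and \<open>x \<mapsto> (\<surd>\<lambda>\<^sub>j e\<^sub>j(x))\<^sub>j\<close> is a feature map for \<open>h\<close>.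
\<close>

section \<open>Semi-inner products and eigenvectors\<close>

text \<open>Elements of L^2 and of the Sobolev space are represented by functions, so their inner
  products are only positive semidefinite, and so is the form \<open>ip (T f) g\<close>. All of them
  are instances of one locale of semi-inner products on a set of functions, and the Cauchy-Schwarz
  inequality of the last form does real work: it gives the eigenvector estimate and turns
  \<open>ip (T f) f = 0\<close> into orthogonality of \<open>T f\<close> to everything. The obstacle
  is that the eigensystem lists eigenvectors but says nothing directly about the orthogonal
  complement of all \<open>e j\<close>. If the form were nonzero somewhere on that complement, the
  Rayleigh quotient would have a maximiser there. Such a maximiser is an eigenvector for a positive
  eigenvalue, hence a finite combination of the \<open>e j\<close>, and being orthogonal to each of
  them it has length 0, a contradiction. Compactness of \<open>T\<close> itself comes from the
  theorem of Arzela and Ascoli, applied to every derivative of the images, whose equicontinuity is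
  the uniform continuity of the derivatives of \<open>h\<close>.\<close>

locale function_semi_inner =
  fixes V :: "('a \<Rightarrow> real) set" and ip :: "('a \<Rightarrow> real) \<Rightarrow> ('a \<Rightarrow> real) \<Rightarrow> real"
  assumes zero_in: "(\<lambda>x. 0) \<in> V"
    and add_in: "\<lbrakk>f \<in> V; g \<in> V\<rbrakk> \<Longrightarrow> (\<lambda>x. f x + g x) \<in> V"
    and scale_in: "f \<in> V \<Longrightarrow> (\<lambda>x. c * f x) \<in> V"
    and sym: "\<lbrakk>f \<in> V; g \<in> V\<rbrakk> \<Longrightarrow> ip f g = ip g f"
    and add_left: "\<lbrakk>f \<in> V; g \<in> V; u \<in> V\<rbrakk> \<Longrightarrow> ip (\<lambda>x. f x + g x) u = ip f u + ip g u"
    and scale_left: "\<lbrakk>f \<in> V; g \<in> V\<rbrakk> \<Longrightarrow> ip (\<lambda>x. c * f x) g = c * ip f g"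
    and nonneg: "f \<in> V \<Longrightarrow> 0 \<le> ip f f"
begin

definition nrm :: "('a \<Rightarrow> real) \<Rightarrow> real" where "nrm f = sqrt (ip f f)"

lemma diff_in: "\<lbrakk>f \<in> V; g \<in> V\<rbrakk> \<Longrightarrow> (\<lambda>x. f x - g x) \<in> V"
  using add_in[of f "\<lambda>x. (-1) * g x"] scale_in[of g "-1"] by simp

lemma sum_in: "(\<And>i. i \<in> F \<Longrightarrow> f i \<in> V) \<Longrightarrow> (\<lambda>x. \<Sum>i\<in>F. c i * f i x) \<in> V"
proof (induction F rule: infinite_finite_induct)
  case (insert i F)
  then show ?case using add_in[of "\<lambda>x. c i * f i x"] scale_in by simp
qed (use zero_in in auto)

lemma diff_left: "\<lbrakk>f \<in> V; g \<in> V; u \<in> V\<rbrakk> \<Longrightarrow> ip (\<lambda>x. f x - g x) u = ip f u - ip g u"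
  using add_left[of f "\<lambda>x. (-1) * g x" u] scale_left[of g u "-1"] scale_in[of g "-1"] by simp

lemma zero_left [simp]: "u \<in> V \<Longrightarrow> ip (\<lambda>x. 0) u = 0"
  using scale_left[of u u 0] by simp

lemma sum_left:
  assumes "\<And>i. i \<in> F \<Longrightarrow> f i \<in> V" "u \<in> V"
  shows "ip (\<lambda>x. \<Sum>i\<in>F. c i * f i x) u = (\<Sum>i\<in>F. c i * ip (f i) u)"
  using assms(1)
proof (induction F rule: infinite_finite_induct)
  case (insert i F)
  then show ?case
    using add_left[of "\<lambda>x. c i * f i x" "\<lambda>x. \<Sum>i\<in>F. c i * f i x" u] scale_in sum_in[of F f c]
      scale_left[of "f i" u "c i"] assms(2) by simp
qed (use assms in auto)

lemma add_right: "\<lbrakk>f \<in> V; g \<in> V; u \<in> V\<rbrakk> \<Longrightarrow> ip u (\<lambda>x. f x + g x) = ip u f + ip u g"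
  using add_left[of f g u] sym[OF add_in, of f g u] sym[of f u] sym[of g u] by simp

lemma scale_right: "\<lbrakk>f \<in> V; g \<in> V\<rbrakk> \<Longrightarrow> ip g (\<lambda>x. c * f x) = c * ip g f"
  using scale_left[of f g c] sym[OF scale_in, of f g c] sym[of f g] by simp

lemma diff_right: "\<lbrakk>f \<in> V; g \<in> V; u \<in> V\<rbrakk> \<Longrightarrow> ip u (\<lambda>x. f x - g x) = ip u f - ip u g"
  using diff_left[of f g u] sym[OF diff_in, of f g u] sym[of f u] sym[of g u] by simp

lemma sum_right:
  assumes "\<And>i. i \<in> F \<Longrightarrow> f i \<in> V" "u \<in> V"
  shows "ip u (\<lambda>x. \<Sum>i\<in>F. c i * f i x) = (\<Sum>i\<in>F. c i * ip u (f i))"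
proof -
  have "ip u (\<lambda>x. \<Sum>i\<in>F. c i * f i x) = ip (\<lambda>x. \<Sum>i\<in>F. c i * f i x) u"
    using assms sum_in[of F f c] sym by simp
  also have "\<dots> = (\<Sum>i\<in>F. c i * ip u (f i))"
    using assms sym by (simp add: sum_left cong: sum.cong)
  finally show ?thesis .
qed

lemma Cauchy_Schwarz_sq:
  assumes "f \<in> V" "g \<in> V"
  shows "(ip f g)\<^sup>2 \<le> ip f f * ip g g"
proof -
  have q: "0 \<le> ip f f + 2 * t * ip f g + t\<^sup>2 * ip g g" for t
  proof -
    have "0 \<le> ip (\<lambda>x. f x + t * g x) (\<lambda>x. f x + t * g x)"
      by (intro nonneg add_in scale_in assms)
    also have "\<dots> = ip f f + 2 * t * ip f g + t\<^sup>2 * ip g g"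
      using assms by (simp add: add_left add_right scale_left scale_right add_in scale_in sym[of g f]
          power2_eq_square algebra_simps)
    finally show ?thesis .
  qed
  show ?thesis
  proof (cases "ip g g = 0")
    case True
    have "ip f g = 0"
    proof (rule ccontr)
      assume "ip f g \<noteq> 0"
      \<comment> \<open>With \<open>ip g g = 0\<close> the expression in \<open>q\<close> is affine
        in \<open>t\<close>; at the chosen \<open>t\<close> it equals -1.\<close>
      then show False
        using q[of "- (ip f f + 1) / (2 * ip f g)"] True by (simp add: field_simps)
    qed
    then show ?thesis using True by simp
  next
    case False
    then have p: "ip g g > 0" using nonneg[OF assms(2)] by simp
    \<comment> \<open>The value of the quadratic at its minimiser.\<close>
    have "0 \<le> ip f f - (ip f g)\<^sup>2 / ip g g"
      using q[of "- ip f g / ip g g"] p by (simp add: field_simps power2_eq_square)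
    then show ?thesis using p by (simp add: field_simps)
  qed
qed

lemma nrm_nonneg [simp]: "f \<in> V \<Longrightarrow> 0 \<le> nrm f"
  by (simp add: nrm_def nonneg)

lemma nrm_sq: "f \<in> V \<Longrightarrow> (nrm f)\<^sup>2 = ip f f"
  by (simp add: nrm_def nonneg)

lemma Cauchy_Schwarz:
  assumes "f \<in> V" "g \<in> V"
  shows "\<bar>ip f g\<bar> \<le> nrm f * nrm g"
proof -
  have "(ip f g)\<^sup>2 \<le> (nrm f * nrm g)\<^sup>2"
    using Cauchy_Schwarz_sq[OF assms] assms by (simp add: power_mult_distrib nrm_sq)
  then show ?thesis using assms by (simp add: abs_le_square_iff[symmetric])
qed

lemma nrm_scale: "f \<in> V \<Longrightarrow> nrm (\<lambda>x. c * f x) = \<bar>c\<bar> * nrm f"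
  by (simp add: nrm_def scale_left scale_right scale_in mult.assoc[symmetric] real_sqrt_mult)

lemma nrm_add:
  assumes "f \<in> V" "g \<in> V"
  shows "nrm (\<lambda>x. f x + g x) \<le> nrm f + nrm g"
proof -
  have "(nrm (\<lambda>x. f x + g x))\<^sup>2 = (nrm f)\<^sup>2 + 2 * ip f g + (nrm g)\<^sup>2"
    using assms by (simp add: nrm_sq add_left add_right add_in sym[of g f])
  also have "\<dots> \<le> (nrm f + nrm g)\<^sup>2"
    using Cauchy_Schwarz[OF assms] by (simp add: power2_sum)
  finally show ?thesis using assms by (meson add_nonneg_nonneg nrm_nonneg power2_le_imp_le)
qed

lemma nrm_diff_commute: "\<lbrakk>f \<in> V; g \<in> V\<rbrakk> \<Longrightarrow> nrm (\<lambda>x. f x - g x) = nrm (\<lambda>x. g x - f x)"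
  using nrm_scale[OF diff_in, of f g "-1"] by simp

lemma nrm_diff_triangle:
  assumes "f \<in> V" "g \<in> V" "u \<in> V"
  shows "nrm (\<lambda>x. f x - u x) \<le> nrm (\<lambda>x. f x - g x) + nrm (\<lambda>x. g x - u x)"
  using nrm_add[OF diff_in diff_in, of f g g u] assms by simp

lemma nrm_diff_ineq:
  assumes "f \<in> V" "g \<in> V"
  shows "\<bar>nrm f - nrm g\<bar> \<le> nrm (\<lambda>x. f x - g x)"
  using nrm_add[OF diff_in, of f g g] nrm_add[OF diff_in, of g f f] nrm_diff_commute[of f g] assms by simp

text \<open>The degenerate case of Cauchy-Schwarz, which replaces definiteness. For the form
  \<open>ip (T f) g\<close> it says that \<open>ip (T f) f = 0\<close> makes \<open>T f\<close>
  orthogonal to the whole carrier.\<close>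

lemma nrm_eq_0D: "\<lbrakk>f \<in> V; g \<in> V; ip f f = 0\<rbrakk> \<Longrightarrow> ip f g = 0"
  using Cauchy_Schwarz_sq[of f g] by simp

lemma ip_limit_left:
  assumes "\<And>n. f n \<in> V" "g \<in> V" "u \<in> V" "(\<lambda>n. nrm (\<lambda>x. f n x - g x)) \<longlonglongrightarrow> 0"
  shows "(\<lambda>n. ip (f n) u) \<longlonglongrightarrow> ip g u"
proof -
  have "(\<lambda>n. ip (f n) u - ip g u) \<longlonglongrightarrow> 0"
  proof (rule Lim_null_comparison)
    show "\<forall>\<^sub>F n in sequentially. norm (ip (f n) u - ip g u) \<le> nrm (\<lambda>x. f n x - g x) * nrm u"
      using Cauchy_Schwarz[OF diff_in, of "f _" g u] assms by (simp add: diff_left)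
    show "(\<lambda>n. nrm (\<lambda>x. f n x - g x) * nrm u) \<longlonglongrightarrow> 0"
      using tendsto_mult_left_zero[OF assms(4)] .
  qed
  then show ?thesis by (simp add: LIM_zero_iff)
qed

lemma nrm_limit:
  assumes "\<And>n. f n \<in> V" "g \<in> V" "(\<lambda>n. nrm (\<lambda>x. f n x - g x)) \<longlonglongrightarrow> 0"
  shows "(\<lambda>n. nrm (f n)) \<longlonglongrightarrow> nrm g"
proof -
  have "(\<lambda>n. nrm (f n) - nrm g) \<longlonglongrightarrow> 0"
    by (rule Lim_null_comparison[OF _ assms(3)]) (use nrm_diff_ineq assms in simp)
  then show ?thesis by (simp add: LIM_zero_iff)
qed

text \<open>Uniqueness of limits as far as a semi-inner product can express it; in the Sobolev space
  distance 0 will mean equality almost everywhere.\<close>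

lemma nrm_diff_le_limit:
  assumes "\<And>n. f n \<in> V" "g \<in> V" "u \<in> V"
    "(\<lambda>n. nrm (\<lambda>x. f n x - g x)) \<longlonglongrightarrow> 0" "(\<lambda>n. nrm (\<lambda>x. f n x - u x)) \<longlonglongrightarrow> 0"
  shows "nrm (\<lambda>x. g x - u x) = 0"
proof -
  have "nrm (\<lambda>x. g x - u x) \<le> nrm (\<lambda>x. f n x - g x) + nrm (\<lambda>x. f n x - u x)" for n
    using nrm_diff_triangle[of g "f n" u] nrm_diff_commute[of g "f n"] assms by simp
  then have "nrm (\<lambda>x. g x - u x) \<le> 0 + 0"
    by (intro tendsto_lowerbound[OF tendsto_add[OF assms(4,5)]]) auto
  then show ?thesis using nrm_nonneg[OF diff_in, of g u] assms by simp
qed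

end

text \<open>The variational proof: a maximising sequence of the Rayleigh quotient on the annihilator of
  \<open>U\<close> is asymptotically an eigenvector, and compactness makes it converge.\<close>

lemma Rayleigh_eigenvector:
  assumes "function_semi_inner V ip" and B: "function_semi_inner V (\<lambda>f g. ip (T f) g)"
    and T_in: "\<And>f. f \<in> V \<Longrightarrow> T f \<in> V"
    and bound: "\<And>f. f \<in> V \<Longrightarrow> function_semi_inner.nrm ip (T f) \<le> C * function_semi_inner.nrm ip f"
    and cmpt: "\<And>w :: nat \<Rightarrow> 'a \<Rightarrow> real. (\<And>n. w n \<in> V \<and> function_semi_inner.nrm ip (w n) \<le> 1) \<Longrightarrow>
       \<exists>r g. strict_mono r \<and> g \<in> V \<and>
             (\<lambda>n::nat. function_semi_inner.nrm ip (\<lambda>x. T (w (r n)) x - g x)) \<longlonglongrightarrow> 0"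
    and U: "U \<subseteq> V" and TU: "\<And>f u. \<lbrakk>f \<in> V; u \<in> U; \<forall>u\<in>U. ip f u = 0\<rbrakk> \<Longrightarrow> ip (T f) u = 0"
    and w0: "w0 \<in> V" "\<forall>u\<in>U. ip w0 u = 0" "ip (T w0) w0 \<noteq> 0"
  shows "\<exists>\<Lambda> w. \<Lambda> > 0 \<and> w \<in> V \<and> (\<forall>u\<in>U. ip w u = 0) \<and> ip w w > 0 \<and>
           ip (\<lambda>x. T w x - \<Lambda> * w x) (\<lambda>x. T w x - \<Lambda> * w x) = 0"
proof -
  interpret function_semi_inner V ip by fact
  interpret B: function_semi_inner V "\<lambda>f g. ip (T f) g" by fact
  define W where "W = {w \<in> V. \<forall>u\<in>U. ip w u = 0}"
  have WV: "w \<in> V" if "w \<in> W" for w using that by (simp add: W_def)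
  have TW: "T w \<in> W" if "w \<in> W" for w using that TU T_in by (auto simp: W_def)
  have Wscale: "(\<lambda>x. c * w x) \<in> W" if "w \<in> W" for w c
    using that U by (auto simp: W_def scale_in scale_left subset_iff)
  \<comment> \<open>Keeps the set \<open>S\<close> below bounded and settles the vectors of length 0
    in \<open>ray\<close>.\<close>
  have Bbound: "ip (T w) w \<le> \<bar>C\<bar> * ip w w" if "w \<in> V" for w
  proof -
    have "ip (T w) w \<le> nrm (T w) * nrm w" using Cauchy_Schwarz[OF T_in, of w w] that by simp
    also have "\<dots> \<le> (\<bar>C\<bar> * nrm w) * nrm w"
      using bound[OF that] nrm_nonneg[OF that]
      by (intro mult_right_mono order.trans[OF bound[OF that]]) auto
    also have "\<dots> = \<bar>C\<bar> * ip w w" using nrm_sq[OF that] by (simp add: power2_eq_square mult.assoc)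
    finally show ?thesis .
  qed
  define S where "S = {ip (T w) w | w. w \<in> W \<and> ip w w \<le> 1}"
  define \<Lambda> where "\<Lambda> = Sup S"
  have bdd: "bdd_above S"
  proof
    fix x assume "x \<in> S"
    then obtain w where "w \<in> W" "ip w w \<le> 1" "x = ip (T w) w" by (auto simp: S_def)
    then show "x \<le> \<bar>C\<bar>" using Bbound[of w] WV[of w] mult_left_mono[of "ip w w" 1 "\<bar>C\<bar>"] by simp
  qed
  have ray: "ip (T w) w \<le> \<Lambda> * ip w w" if w: "w \<in> W" for w
  proof (cases "ip w w = 0")
    case True
    then show ?thesis using Bbound[OF WV[OF w]] by simp
  next
    case False
    then have p: "ip w w > 0" using nonneg[OF WV[OF w]] by simp
    let ?v = "\<lambda>x. (1 / nrm w) * w x"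
    have n: "nrm w > 0" using p by (simp add: nrm_def)
    have "ip ?v ?v = (1 / nrm w)\<^sup>2 * ip w w"
      using WV[OF w] by (simp add: scale_left[of w "\<lambda>x. (1 / nrm w) * w x" "1 / nrm w", simplified]
        scale_right[of w w "1 / nrm w", simplified] scale_in[of w "1 / nrm w", simplified] power2_eq_square)
    then have 1: "ip ?v ?v = 1" using n nrm_sq[OF WV[OF w]] p by (simp add: power_divide)
    have 2: "ip (T ?v) ?v = (1 / nrm w)\<^sup>2 * ip (T w) w"
      using B.scale_left[of w ?v "1 / nrm w"] B.scale_right[of w w "1 / nrm w"] WV[OF w] scale_in[of w "1 / nrm w"]
      by (simp add: power2_eq_square)
    have "ip (T ?v) ?v \<in> S" unfolding S_def using Wscale[OF w, of "1 / nrm w"] 1 by auto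
    then have "ip (T ?v) ?v \<le> \<Lambda>" unfolding \<Lambda>_def by (rule cSup_upper[OF _ bdd])
    then show ?thesis using 2 n p nrm_sq[OF WV[OF w]] by (simp add: power_divide pos_divide_le_eq)
  qed
  have w0W: "w0 \<in> W" using w0 by (simp add: W_def)
  have "ip (T w0) w0 > 0" using B.nonneg[OF w0(1)] w0(3) by simp
  then have L: "\<Lambda> > 0" using ray[OF w0W] nonneg[OF w0(1)]
    by (metis less_le_trans linorder_not_le mult_nonpos_nonneg)
  have Sne: "S \<noteq> {}" unfolding S_def using zero_in U
    by (auto simp: W_def subset_iff intro!: exI[of _ "\<lambda>x. 0"])
  have "\<exists>w. w \<in> W \<and> ip w w \<le> 1 \<and> ip (T w) w > \<Lambda> - 1 / real (Suc n)" for n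
  proof -
    have "\<Lambda> - 1 / real (Suc n) < Sup S" by (simp add: \<Lambda>_def)
    then obtain x where "x \<in> S" "x > \<Lambda> - 1 / real (Suc n)" using less_cSupD[OF Sne] by blast
    then show ?thesis by (auto simp: S_def)
  qed
  then obtain w where w: "\<And>n. w n \<in> W" "\<And>n. ip (w n) (w n) \<le> 1"
    "\<And>n. ip (T (w n)) (w n) > \<Lambda> - 1 / real (Suc n)" by metis
  have wV: "w n \<in> V" for n using w(1) WV by blast
  have "w n \<in> V \<and> nrm (w n) \<le> 1" for n using wV w(2) by (simp add: nrm_def)
  then obtain r g where r: "strict_mono r" and g: "g \<in> V"
    and conv: "(\<lambda>n. nrm (\<lambda>x. T (w (r n)) x - g x)) \<longlonglongrightarrow> 0" using cmpt[of w] by blast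
  \<comment> \<open>Cauchy-Schwarz for the form \<open>ip (T f) g\<close> at \<open>v\<close> and
    \<open>T v\<close>, followed by the bound \<open>ray\<close> at \<open>T v\<close>; one factor
    \<open>ip (T v) (T v)\<close> cancels.\<close>
  have Tsq: "ip (T v) (T v) \<le> \<Lambda> * ip (T v) v" if v: "v \<in> W" for v
  proof -
    have "(ip (T v) (T v))\<^sup>2 \<le> ip (T v) v * ip (T (T v)) (T v)"
      using B.Cauchy_Schwarz_sq[of v "T v"] WV[OF v] T_in by simp
    also have "\<dots> \<le> ip (T v) v * (\<Lambda> * ip (T v) (T v))"
      by (intro mult_left_mono ray TW v B.nonneg WV)
    finally have *: "(ip (T v) (T v))\<^sup>2 \<le> \<Lambda> * ip (T v) v * ip (T v) (T v)" by (simp add: ac_simps)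
    have "0 \<le> ip (T v) (T v)" by (intro nonneg T_in WV v)
    moreover have "0 \<le> \<Lambda> * ip (T v) v" using L B.nonneg[OF WV[OF v]] by simp
    ultimately show ?thesis using *
      by (cases "ip (T v) (T v) = 0") (auto simp: power2_eq_square)
  qed
  \<comment> \<open>After expanding the square, \<open>Tsq\<close> leaves \<open>\<Lambda>\<close>
    times the gap between \<open>\<Lambda>\<close> and the Rayleigh value of \<open>w n\<close>, so
    a maximising sequence consists of approximate eigenvectors.\<close>
  have d: "(nrm (\<lambda>x. T (w n) x - \<Lambda> * w n x))\<^sup>2 \<le> \<Lambda> * (1 / real (Suc n))" for n
  proof -
    have "(nrm (\<lambda>x. T (w n) x - \<Lambda> * w n x))\<^sup>2
        = ip (T (w n)) (T (w n)) - 2 * \<Lambda> * ip (T (w n)) (w n) + \<Lambda>\<^sup>2 * ip (w n) (w n)"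
      using T_in[OF wV[of n]] wV[of n]
      by (simp add: nrm_sq diff_in scale_in diff_left diff_right scale_left scale_right
          sym[of "w n" "T (w n)"] power2_eq_square[of \<Lambda>] algebra_simps)
    also have "\<dots> \<le> \<Lambda> * ip (T (w n)) (w n) - 2 * \<Lambda> * ip (T (w n)) (w n) + \<Lambda>\<^sup>2 * 1"
      using Tsq[OF w(1)] w(2)[of n] L by (intro add_mono diff_mono mult_left_mono) auto
    also have "\<dots> = \<Lambda> * (\<Lambda> - ip (T (w n)) (w n))" by (simp add: algebra_simps power2_eq_square)
    also have "\<dots> \<le> \<Lambda> * (1 / real (Suc n))" using w(3)[of n] L by (intro mult_left_mono) auto
    finally show ?thesis .
  qed
  have "(\<lambda>n. (nrm (\<lambda>x. T (w n) x - \<Lambda> * w n x))\<^sup>2) \<longlonglongrightarrow> 0"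
  proof (rule Lim_null_comparison)
    show "(\<lambda>n. \<Lambda> * (1 / real (Suc n))) \<longlonglongrightarrow> 0"
      using tendsto_mult_right_zero[OF LIMSEQ_inverse_real_of_nat, of \<Lambda>] by (simp add: inverse_eq_divide)
  qed (use d in simp)
  then have "(\<lambda>n. nrm (\<lambda>x. T (w n) x - \<Lambda> * w n x)) \<longlonglongrightarrow> 0"
    by simp
  then have d0: "(\<lambda>n. nrm (\<lambda>x. T (w (r n)) x - \<Lambda> * w (r n) x)) \<longlonglongrightarrow> 0"
    using LIMSEQ_subseq_LIMSEQ[OF _ r] by (simp add: o_def)
  \<comment> \<open>Along the subsequence \<open>T w\<close> tends to \<open>g\<close> and
    \<open>T w - \<Lambda> w\<close> to 0, so the vectors \<open>w (r n)\<close> converge too, and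
    their limit must be \<open>g / \<Lambda>\<close>.\<close>
  define v where "v = (\<lambda>x. (1 / \<Lambda>) * g x)"
  have v: "v \<in> V" unfolding v_def by (rule scale_in[OF g])
  have gv: "g x = \<Lambda> * v x" for x using L by (simp add: v_def)
  have "(\<lambda>n. nrm (\<lambda>x. w (r n) x - v x)) \<longlonglongrightarrow> 0"
  proof (rule Lim_null_comparison)
    have "\<Lambda> * nrm (\<lambda>x. w (r n) x - v x)
        \<le> nrm (\<lambda>x. T (w (r n)) x - \<Lambda> * w (r n) x) + nrm (\<lambda>x. T (w (r n)) x - g x)" for n
    proof -
      have "\<Lambda> * nrm (\<lambda>x. w (r n) x - v x) = nrm (\<lambda>x. \<Lambda> * w (r n) x - g x)"
        using nrm_scale[OF diff_in[OF wV v], of \<Lambda> "r n"] L by (simp add: gv algebra_simps)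
      also have "\<dots> \<le> nrm (\<lambda>x. \<Lambda> * w (r n) x - T (w (r n)) x) + nrm (\<lambda>x. T (w (r n)) x - g x)"
        by (intro nrm_diff_triangle scale_in T_in wV g)
      finally show ?thesis using nrm_diff_commute[OF scale_in[OF wV] T_in[OF wV], of \<Lambda> "r n" "r n"] by simp
    qed
    then show "\<forall>\<^sub>F n in sequentially. norm (nrm (\<lambda>x. w (r n) x - v x)) \<le>
       1 / \<Lambda> * (nrm (\<lambda>x. T (w (r n)) x - \<Lambda> * w (r n) x) + nrm (\<lambda>x. T (w (r n)) x - g x))"
      using L wV v by (simp add: diff_in field_simps)
    show "(\<lambda>n. 1 / \<Lambda> * (nrm (\<lambda>x. T (w (r n)) x - \<Lambda> * w (r n) x) + nrm (\<lambda>x. T (w (r n)) x - g x))) \<longlonglongrightarrow> 0"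
      using tendsto_mult_right_zero[OF tendsto_add_zero[OF d0 conv]] .
  qed
  note wv = this
  have vW: "v \<in> W"
  proof -
    have "ip v u = 0" if u: "u \<in> U" for u
    proof -
      have "(\<lambda>n. ip (w (r n)) u) \<longlonglongrightarrow> ip v u"
        using ip_limit_left[OF wV v _ wv] u U by blast
      moreover have "ip (w n) u = 0" for n using w(1)[of n] u by (simp add: W_def)
      ultimately show ?thesis by (simp add: LIMSEQ_const_iff)
    qed
    then show ?thesis using v by (simp add: W_def)
  qed
  \<comment> \<open>\<open>T\<close> is linear only through the form: \<open>T f - T f'\<close> and
    \<open>T (f - f')\<close> have the same inner product with every vector of \<open>V\<close>,
    hence the same length.\<close>
  have Tdiff: "nrm (\<lambda>x. T f x - T f' x) \<le> C * nrm (\<lambda>x. f x - f' x)" if "f \<in> V" "f' \<in> V" for f f'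
  proof -
    have u: "ip (\<lambda>x. T f x - T f' x) u = ip (T (\<lambda>x. f x - f' x)) u" if "u \<in> V" for u
      using B.diff_left[of f f' u] diff_left[of "T f" "T f'" u] T_in \<open>f \<in> V\<close> \<open>f' \<in> V\<close> that by simp
    have i1: "(\<lambda>x. T f x - T f' x) \<in> V" and i2: "T (\<lambda>x. f x - f' x) \<in> V"
      using that T_in diff_in by auto
    have "nrm (\<lambda>x. T f x - T f' x) = nrm (T (\<lambda>x. f x - f' x))"
      unfolding nrm_def using u[OF i1] u[OF i2] sym[OF i1 i2] by simp
    then show ?thesis using bound[OF diff_in[OF that]] by simp
  qed
  have "(\<lambda>n. nrm (\<lambda>x. T (w (r n)) x - T v x)) \<longlonglongrightarrow> 0"
  proof (rule Lim_null_comparison)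
    show "\<forall>\<^sub>F n in sequentially. norm (nrm (\<lambda>x. T (w (r n)) x - T v x)) \<le> C * nrm (\<lambda>x. w (r n) x - v x)"
      using Tdiff[OF wV v] nrm_nonneg[OF diff_in[OF T_in[OF wV] T_in[OF v]]] by simp
  qed (rule tendsto_mult_right_zero[OF wv])
  from nrm_diff_le_limit[OF T_in[OF wV] T_in[OF v] g this conv]
  have eig: "nrm (\<lambda>x. T v x - \<Lambda> * v x) = 0" by (simp add: gv)
  have "(\<lambda>n. nrm (w (r n))) \<longlonglongrightarrow> nrm v" by (rule nrm_limit[OF wV v wv])
  then have sq: "(\<lambda>n. \<Lambda> * (nrm (w (r n)))\<^sup>2) \<longlonglongrightarrow> \<Lambda> * (nrm v)\<^sup>2" by (intro tendsto_intros)
  \<comment> \<open>The limit of \<open>ray\<close> along a sequence whose Rayleigh values tend to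
    \<open>\<Lambda>\<close>: the vector \<open>v\<close> has length at least 1 and is therefore not
    a null vector.\<close>
  have "\<Lambda> \<le> \<Lambda> * (nrm v)\<^sup>2"
  proof (rule LIMSEQ_le[OF _ sq])
    have "(\<lambda>n. \<Lambda> - inverse (real (Suc n))) \<longlonglongrightarrow> \<Lambda> - 0"
      by (intro tendsto_diff tendsto_const LIMSEQ_inverse_real_of_nat)
    then show "(\<lambda>n. \<Lambda> - 1 / real (Suc (r n))) \<longlonglongrightarrow> \<Lambda>"
      using LIMSEQ_subseq_LIMSEQ[OF _ r] by (fastforce simp: o_def inverse_eq_divide)
    show "\<exists>N. \<forall>n\<ge>N. \<Lambda> - 1 / real (Suc (r n)) \<le> \<Lambda> * (nrm (w (r n)))\<^sup>2"
      using less_le_trans[OF w(3) ray[OF w(1)]] nrm_sq[OF wV] by (auto intro: less_imp_le)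
  qed
  then have "ip v v > 0" using L nrm_sq[OF v] nonneg[OF v]
    by (metis mult_zero_right not_le order_le_less)
  moreover have "ip (\<lambda>x. T v x - \<Lambda> * v x) (\<lambda>x. T v x - \<Lambda> * v x) = 0"
    using eig by (simp add: nrm_def)
  ultimately show ?thesis using L vW by (auto simp: W_def)
qed

section \<open>Reproducing kernel Hilbert spaces\<close>

context function_semi_inner
begin

lemma Metric_space:
  assumes def: "\<And>f. \<lbrakk>f \<in> V; ip f f = 0\<rbrakk> \<Longrightarrow> f = (\<lambda>x. 0)"
    and off: "\<And>f g. f \<notin> V \<Longrightarrow> ip f g = 0"
  shows "Metric_space V (\<lambda>f g. nrm (\<lambda>x. f x - g x))"
proof
  \<comment> \<open>Nonnegativity and symmetry of a metric are demanded for arbitrary functions,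
    including pairs outside \<open>V\<close> whose difference may or may not lie in
    \<open>V\<close>; in the latter case \<open>ip\<close> is 0.\<close>
  have flip: "(\<lambda>x. g x - f x) \<in> V \<longleftrightarrow> (\<lambda>x. f x - g x) \<in> V" for f g :: "'a \<Rightarrow> real"
    using scale_in[of "\<lambda>x. g x - f x" "-1"] scale_in[of "\<lambda>x. f x - g x" "-1"] by auto
  fix f g :: "'a \<Rightarrow> real"
  show "0 \<le> nrm (\<lambda>x. f x - g x)"
    by (cases "(\<lambda>x. f x - g x) \<in> V") (auto simp: nrm_def nonneg off)
  show "nrm (\<lambda>x. f x - g x) = nrm (\<lambda>x. g x - f x)"
  proof (cases "(\<lambda>x. f x - g x) \<in> V")
    case True
    then show ?thesis using nrm_scale[OF True, of "-1"] by simp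
  next
    case False
    then have "(\<lambda>x. g x - f x) \<notin> V" using flip by blast
    then show ?thesis using False by (simp add: nrm_def off)
  qed
next
  fix f g assume fg: "f \<in> V" "g \<in> V"
  have "f = g" if "nrm (\<lambda>x. f x - g x) = 0"
  proof -
    have "(\<lambda>x. f x - g x) = (\<lambda>x. 0)" using that by (intro def diff_in fg) (simp add: nrm_def)
    then show ?thesis by (simp add: fun_eq_iff)
  qed
  then show "(nrm (\<lambda>x. f x - g x) = 0) = (f = g)" by (auto simp: nrm_def zero_in)
next
  fix f g u assume "f \<in> V" "g \<in> V" "u \<in> V"
  then show "nrm (\<lambda>x. f x - u x) \<le> nrm (\<lambda>x. f x - g x) + nrm (\<lambda>x. g x - u x)"
    by (rule nrm_diff_triangle)
qed

definition Cauchy_seq :: "(nat \<Rightarrow> 'a \<Rightarrow> real) \<Rightarrow> bool" where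
  "Cauchy_seq \<sigma> \<longleftrightarrow> (\<forall>n. \<sigma> n \<in> V) \<and> (\<forall>\<epsilon>>0. \<exists>N. \<forall>m\<ge>N. \<forall>n\<ge>N. nrm (\<lambda>x. \<sigma> m x - \<sigma> n x) < \<epsilon>)"

definition conv_to :: "(nat \<Rightarrow> 'a \<Rightarrow> real) \<Rightarrow> ('a \<Rightarrow> real) \<Rightarrow> bool" where
  "conv_to \<sigma> g \<longleftrightarrow> g \<in> V \<and> (\<lambda>n. nrm (\<lambda>x. \<sigma> n x - g x)) \<longlonglongrightarrow> 0"

text \<open>Puts completeness into a form that involves only norms of differences and can be carried
  from one space to another by an isometry.\<close>

lemma mcomplete_iff:
  assumes def: "\<And>f. \<lbrakk>f \<in> V; ip f f = 0\<rbrakk> \<Longrightarrow> f = (\<lambda>x. 0)"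
    and off: "\<And>f g. f \<notin> V \<Longrightarrow> ip f g = 0"
  shows "Metric_space.mcomplete V (\<lambda>f g. nrm (\<lambda>x. f x - g x)) \<longleftrightarrow>
           (\<forall>\<sigma>. Cauchy_seq \<sigma> \<longrightarrow> (\<exists>g. conv_to \<sigma> g))"
proof -
  interpret Metric_space V "\<lambda>f g. nrm (\<lambda>x. f x - g x)" by (rule Metric_space[OF assms])
  have C: "MCauchy \<sigma> = Cauchy_seq \<sigma>" for \<sigma>
    unfolding MCauchy_def Cauchy_seq_def by (auto simp: image_subset_iff)
  have L: "limitin mtopology \<sigma> g sequentially \<longleftrightarrow> conv_to \<sigma> g" if "\<And>n. \<sigma> n \<in> V" for \<sigma> g
    using that
    by (auto simp: limit_metric_sequentially conv_to_def LIMSEQ_iff diff_in)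
  show ?thesis unfolding mcomplete_def C using L by (metis (no_types, lifting) Cauchy_seq_def)
qed

end

text \<open>Separates the axioms that the locale provides from definiteness, completeness and the
  conventions about values off the domain and off the carrier.\<close>

lemma hilbert_function_space_iff:
  "hilbert_function_space \<Theta> (H, ip) \<longleftrightarrow> function_semi_inner H ip \<and>
     (\<forall>f\<in>H. \<forall>x. x \<notin> \<Theta> \<longrightarrow> f x = 0) \<and> (\<forall>f g. f \<notin> H \<or> g \<notin> H \<longrightarrow> ip f g = 0) \<and>
     (\<forall>f\<in>H. ip f f = 0 \<longrightarrow> f = (\<lambda>x. 0)) \<and>
     (\<forall>\<sigma>. function_semi_inner.Cauchy_seq H ip \<sigma> \<longrightarrow> (\<exists>g. function_semi_inner.conv_to H ip \<sigma> g))"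
  (is "?L \<longleftrightarrow> ?R")
proof
  assume L: ?L
  then have 1: "function_semi_inner H ip"
    unfolding hilbert_function_space_def function_semi_inner_def by blast
  interpret function_semi_inner H ip by fact
  have d: "\<And>f. \<lbrakk>f \<in> H; ip f f = 0\<rbrakk> \<Longrightarrow> f = (\<lambda>x. 0)" and o: "\<And>f g. f \<notin> H \<Longrightarrow> ip f g = 0"
    using L unfolding hilbert_function_space_def by blast+
  show ?R using L mcomplete_iff[OF d o] 1 unfolding hilbert_function_space_def nrm_def by simp
next
  assume R: ?R
  then interpret function_semi_inner H ip by blast
  have d: "\<And>f. \<lbrakk>f \<in> H; ip f f = 0\<rbrakk> \<Longrightarrow> f = (\<lambda>x. 0)" and o: "\<And>f g. f \<notin> H \<Longrightarrow> ip f g = 0"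
    using R by blast+
  have mc: "Metric_space.mcomplete H (\<lambda>f g. sqrt (ip (\<lambda>x. f x - g x) (\<lambda>x. f x - g x)))"
    using R mcomplete_iff[OF d o] by (simp add: nrm_def)
  show ?L
    unfolding hilbert_function_space_def prod.case
    by (intro conjI allI ballI impI;
        (rule mc | (rule zero_in add_in scale_in sym add_left scale_left nonneg; assumption) | use R in blast))
qed

text \<open>Built by adding one multiple of a section at a time, so that inner products of its
  elements can be computed by induction with the reproducing property.\<close>

inductive_set kernel_span :: "'a set \<Rightarrow> ('a \<Rightarrow> 'a \<Rightarrow> real) \<Rightarrow> ('a \<Rightarrow> real) set" for \<Theta> h where
  zero: "(\<lambda>y. 0) \<in> kernel_span \<Theta> h"
| step: "\<lbrakk>v \<in> kernel_span \<Theta> h; x \<in> \<Theta>\<rbrakk> \<Longrightarrow> (\<lambda>y. v y + c * kernel_section \<Theta> h x y) \<in> kernel_span \<Theta> h"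

lemma kernel_span_scale: "v \<in> kernel_span \<Theta> h \<Longrightarrow> (\<lambda>y. a * v y) \<in> kernel_span \<Theta> h"
proof (induction rule: kernel_span.induct)
  case (step v x c)
  then show ?case using kernel_span.step[of "\<lambda>y. a * v y" \<Theta> h x "a * c"] by (simp add: algebra_simps)
qed (use kernel_span.zero in simp)

lemma kernel_span_add:
  assumes "v \<in> kernel_span \<Theta> h" "w \<in> kernel_span \<Theta> h"
  shows "(\<lambda>y. v y + w y) \<in> kernel_span \<Theta> h"
  using assms(2)
proof (induction rule: kernel_span.induct)
  case (step w x c)
  then show ?case using kernel_span.step[of "\<lambda>y. v y + w y" \<Theta> h x c] by (simp add: algebra_simps)
qed (use assms in simp)

section \<open>Uniqueness of the Hilbert space with a given reproducing kernel\<close>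

definition reproducing :: "'a set \<Rightarrow> ('a \<Rightarrow> 'a \<Rightarrow> real) \<Rightarrow> ('a \<Rightarrow> real) set \<Rightarrow>
    (('a \<Rightarrow> real) \<Rightarrow> ('a \<Rightarrow> real) \<Rightarrow> real) \<Rightarrow> bool" where
  "reproducing \<Theta> h H ip \<longleftrightarrow> hilbert_function_space \<Theta> (H, ip) \<and>
     (\<forall>x\<in>\<Theta>. kernel_section \<Theta> h x \<in> H \<and> (\<forall>f\<in>H. ip f (kernel_section \<Theta> h x) = f x))"

context
  fixes \<Theta> :: "'a set" and h H ip
  assumes rep: "reproducing \<Theta> h H ip"
begin

interpretation function_semi_inner H ip
  using rep by (simp add: reproducing_def hilbert_function_space_iff)

lemma kernel_span_subset: "v \<in> kernel_span \<Theta> h \<Longrightarrow> v \<in> H"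
proof (induction rule: kernel_span.induct)
  case (step v x c)
  then show ?case using rep by (intro add_in scale_in) (auto simp: reproducing_def)
qed (rule zero_in)

text \<open>The nearest point in the closed span exists by the parallelogram law; the difference is
  orthogonal to all kernel sections and hence vanishes at every point.\<close>

lemma kernel_span_dense:
  assumes f: "f \<in> H"
  shows "\<exists>v. (\<forall>n::nat. v n \<in> kernel_span \<Theta> h) \<and> (\<lambda>n. nrm (\<lambda>x. v n x - f x)) \<longlonglongrightarrow> 0"
proof -
  define S where "S = (\<lambda>v. nrm (\<lambda>x. v x - f x)) ` kernel_span \<Theta> h"
  define d where "d = Inf S"
  have Sne: "S \<noteq> {}" unfolding S_def using kernel_span.zero by blast
  have S0: "0 \<le> s" if "s \<in> S" for s
    using that kernel_span_subset f by (auto simp: S_def diff_in)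
  have bdd: "bdd_below S" using S0 by (rule bdd_belowI)
  have d0: "0 \<le> d" unfolding d_def by (rule cInf_greatest[OF Sne S0])
  have dle: "d \<le> nrm (\<lambda>x. v x - f x)" if "v \<in> kernel_span \<Theta> h" for v
    unfolding d_def by (rule cInf_lower[OF _ bdd]) (use that in \<open>simp add: S_def\<close>)
  have "\<exists>v. v \<in> kernel_span \<Theta> h \<and> nrm (\<lambda>x. v x - f x) < d + inverse (real (Suc n))" for n
  proof -
    have "Inf S < d + inverse (real (Suc n))" unfolding d_def by simp
    then show ?thesis using cInf_lessD[OF Sne] unfolding S_def by auto
  qed
  then obtain v where v: "\<And>n. v n \<in> kernel_span \<Theta> h"
    "\<And>n. nrm (\<lambda>x. v n x - f x) < d + inverse (real (Suc n))" by metis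
  have vH: "v n \<in> H" for n using kernel_span_subset v(1) .
  \<comment> \<open>Parallelogram law: the midpoint lies in the span, hence at distance at least
    \<open>d\<close> from \<open>f\<close>, while both ends are almost at distance \<open>d\<close>.
    The factor \<open>2 * d + 1\<close> bounds the excess of the square of
    \<open>d + 1 / (n + 1)\<close> over the square of \<open>d\<close>, relative to
    \<open>1 / (n + 1)\<close>.\<close>
  have close: "(nrm (\<lambda>x. v m x - v n x))\<^sup>2
      \<le> 2 * (2 * d + 1) * (inverse (real (Suc m)) + inverse (real (Suc n)))" for m n
  proof -
    let ?a = "\<lambda>x. v m x - f x" and ?b = "\<lambda>x. v n x - f x"
    let ?mid = "\<lambda>x. 1/2 * (v m x + v n x)"
    have ab: "?a \<in> H" "?b \<in> H" using vH f diff_in by auto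
    have "(\<lambda>x. ?a x - ?b x) = (\<lambda>x. v m x - v n x)" by auto
    then have 1: "(nrm (\<lambda>x. v m x - v n x))\<^sup>2 = ip ?a ?a - 2 * ip ?a ?b + ip ?b ?b"
      using nrm_sq[OF diff_in[OF ab]] diff_left[OF ab diff_in[OF ab]] diff_right[OF ab ab(1)]
        diff_right[OF ab ab(2)] sym[OF ab] by simp
    have mid: "(\<lambda>x. ?mid x - f x) = (\<lambda>x. 1/2 * (?a x + ?b x))" by (auto simp: field_simps)
    have "nrm (\<lambda>x. ?mid x - f x) = 1/2 * nrm (\<lambda>x. ?a x + ?b x)"
      unfolding mid nrm_scale[OF add_in[OF ab]] by simp
    then have "4 * (nrm (\<lambda>x. ?mid x - f x))\<^sup>2 = (nrm (\<lambda>x. ?a x + ?b x))\<^sup>2"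
      by (simp only: power_mult_distrib) (simp add: power_divide)
    also have "\<dots> = ip ?a ?a + 2 * ip ?a ?b + ip ?b ?b"
      unfolding nrm_sq[OF add_in[OF ab]] add_left[OF ab add_in[OF ab]] add_right[OF ab ab(1)] add_right[OF ab ab(2)]
      using sym[OF ab] by simp
    finally have 2: "4 * (nrm (\<lambda>x. ?mid x - f x))\<^sup>2 = ip ?a ?a + 2 * ip ?a ?b + ip ?b ?b" .
    have "d\<^sup>2 \<le> (nrm (\<lambda>x. ?mid x - f x))\<^sup>2"
      by (intro power_mono dle d0 kernel_span_scale kernel_span_add v)
    then have dd: "4 * d\<^sup>2 \<le> ip ?a ?a + 2 * ip ?a ?b + ip ?b ?b" unfolding 2[symmetric] by simp
    have b: "ip (\<lambda>x. v n x - f x) (\<lambda>x. v n x - f x) \<le> d\<^sup>2 + (2 * d + 1) * inverse (real (Suc n))" for n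
    proof -
      let ?e = "inverse (real (Suc n))"
      have "(nrm (\<lambda>x. v n x - f x))\<^sup>2 \<le> (d + ?e)\<^sup>2"
        using v(2)[of n] vH f by (intro power_mono) (auto simp: diff_in less_imp_le)
      moreover have "?e\<^sup>2 \<le> ?e" using power_decreasing[of 1 2 ?e] by (simp add: inverse_le_1_iff)
      ultimately show ?thesis using nrm_sq[OF diff_in[OF vH f], of n]
        by (simp add: power2_sum algebra_simps)
    qed
    define em en where "em = inverse (real (Suc m))" and "en = inverse (real (Suc n))"
    show ?thesis using dd b[of m] b[of n] unfolding 1 em_def[symmetric] en_def[symmetric]
      by (simp add: algebra_simps)
  qed
  have "Cauchy_seq v"
    unfolding Cauchy_seq_def
  proof (intro conjI allI impI vH)
    fix \<epsilon> :: real assume e: "\<epsilon> > 0"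
    define K where "K = 4 * (2 * d + 1)"
    have K: "K > 0" using d0 by (simp add: K_def)
    have "\<epsilon>\<^sup>2 / K > 0" using e K by simp
    then obtain N where N: "inverse (real (Suc N)) < \<epsilon>\<^sup>2 / K" using reals_Archimedean by blast
    have "nrm (\<lambda>x. v m x - v n x) < \<epsilon>" if "m \<ge> N" "n \<ge> N" for m n
    proof -
      have i: "inverse (real (Suc l)) < \<epsilon>\<^sup>2 / K" if "l \<ge> N" for l
        using N that by (smt (verit) inverse_le_iff_le of_nat_0_less_iff of_nat_le_iff Suc_le_mono zero_less_Suc)
      have "(nrm (\<lambda>x. v m x - v n x))\<^sup>2 \<le> K / 2 * (inverse (real (Suc m)) + inverse (real (Suc n)))"
      proof -
        have "K / 2 = 2 * (2 * d + 1)" by (simp add: K_def)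
        show ?thesis unfolding \<open>K / 2 = 2 * (2 * d + 1)\<close> by (rule close)
      qed
      also have "\<dots> < K / 2 * (\<epsilon>\<^sup>2 / K + \<epsilon>\<^sup>2 / K)"
        using i that K by (intro mult_strict_left_mono add_strict_mono) auto
      also have "\<dots> = \<epsilon>\<^sup>2" using K by simp
      finally show ?thesis using e power2_less_imp_less[of _ \<epsilon>] by simp
    qed
    then show "\<exists>N. \<forall>m\<ge>N. \<forall>n\<ge>N. nrm (\<lambda>x. v m x - v n x) < \<epsilon>" by blast
  qed
  then obtain g where g: "g \<in> H" and vg: "(\<lambda>n. nrm (\<lambda>x. v n x - g x)) \<longlonglongrightarrow> 0"
    using rep unfolding reproducing_def hilbert_function_space_iff conv_to_def by blast
  \<comment> \<open>Distances to \<open>f\<close> pass to the limit even after a fixed vector has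
    been added; below that vector is 0 or a kernel section.\<close>
  have shift: "(\<lambda>n. nrm (\<lambda>x. v n x + t * u x - f x)) \<longlonglongrightarrow> nrm (\<lambda>x. g x + t * u x - f x)" if u: "u \<in> H" for t u
  proof (rule nrm_limit)
    have "(\<lambda>x. (v n x + t * u x - f x) - (g x + t * u x - f x)) = (\<lambda>x. v n x - g x)" for n by auto
    then show "(\<lambda>n. nrm (\<lambda>x. (v n x + t * u x - f x) - (g x + t * u x - f x))) \<longlonglongrightarrow> 0"
      using vg by simp
  qed (use vH u f g in \<open>auto intro!: diff_in add_in scale_in\<close>)
  have "(\<lambda>n. nrm (\<lambda>x. v n x - f x)) \<longlonglongrightarrow> d"
  proof (rule real_tendsto_sandwich)
    show "\<forall>\<^sub>F n in sequentially. d \<le> nrm (\<lambda>x. v n x - f x)" using dle v by auto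
    show "\<forall>\<^sub>F n in sequentially. nrm (\<lambda>x. v n x - f x) \<le> d + inverse (real (Suc n))"
      using v(2) by (intro always_eventually allI less_imp_le)
    show "(\<lambda>n. d + inverse (real (Suc n))) \<longlonglongrightarrow> d" by (rule LIMSEQ_inverse_real_of_nat_add)
  qed simp
  moreover have "(\<lambda>n. nrm (\<lambda>x. v n x - f x)) \<longlonglongrightarrow> nrm (\<lambda>x. g x - f x)"
    using shift[OF zero_in] by simp
  ultimately have gd: "nrm (\<lambda>x. g x - f x) = d" by (rule LIMSEQ_unique[OF _ _, symmetric])
  let ?u = "\<lambda>x. g x - f x"
  have uH: "?u \<in> H" using g f diff_in by blast
  have "?u x = 0" for x
  proof (cases "x \<in> \<Theta>")
    case True
    let ?k = "kernel_section \<Theta> h x"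
    have k: "?k \<in> H" "ip ?u ?k = ?u x" using rep True uH by (auto simp: reproducing_def)
    \<comment> \<open>Moving every \<open>v n\<close> by \<open>t\<close> times the section stays in
      the span, so the distance to \<open>f\<close> cannot fall below \<open>d\<close>; a nonzero
      first order term in \<open>t\<close> would contradict this.\<close>
    have q: "0 \<le> 2 * t * ip ?u ?k + t\<^sup>2 * ip ?k ?k" for t
    proof -
      have "d \<le> nrm (\<lambda>y. v n y + t * ?k y - f y)" for n
        by (intro dle kernel_span.step v True)
      then have "d \<le> nrm (\<lambda>y. g y + t * ?k y - f y)"
        by (intro tendsto_lowerbound[OF shift[OF k(1)]]) auto
      also have "(\<lambda>y. g y + t * ?k y - f y) = (\<lambda>y. ?u y + t * ?k y)" by auto
      finally have "d\<^sup>2 \<le> (nrm (\<lambda>y. ?u y + t * ?k y))\<^sup>2" using d0 by (intro power_mono)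
      also have "\<dots> = ip ?u ?u + 2 * t * ip ?u ?k + t\<^sup>2 * ip ?k ?k"
        using nrm_sq[OF add_in[OF uH scale_in[OF k(1)]]]
          add_left[OF uH scale_in[OF k(1)] add_in[OF uH scale_in[OF k(1)]]]
          add_right[OF uH scale_in[OF k(1)] uH] add_right[OF uH scale_in[OF k(1)] k(1)]
          scale_left[OF k(1) add_in[OF uH scale_in[OF k(1)]]] scale_right[OF k(1) uH]
          scale_right[OF k(1) k(1)] sym[OF uH k(1)] by (simp add: power2_eq_square algebra_simps)
      finally show ?thesis using gd nrm_sq[OF uH] by simp
    qed
    show ?thesis
    proof (cases "ip ?k ?k = 0")
      case True
      then show ?thesis using nrm_eq_0D[OF k(1) uH] sym[OF k(1) uH] k(2) by simp
    next
      case False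
      then have p: "ip ?k ?k > 0" using nonneg[OF k(1)] by simp
      have "0 \<le> - (ip ?u ?k)\<^sup>2 / ip ?k ?k"
        using q[of "- ip ?u ?k / ip ?k ?k"] p by (simp add: field_simps power2_eq_square)
      then have "(ip ?u ?k)\<^sup>2 \<le> 0" using p by (simp add: divide_le_0_iff)
      then show ?thesis using k(2) by simp
    qed
  next
    case False
    moreover have "\<forall>f\<in>H. \<forall>x. x \<notin> \<Theta> \<longrightarrow> f x = 0"
      using rep by (simp add: reproducing_def hilbert_function_space_iff)
    ultimately have "f x = 0" "g x = 0" using f g by blast+
    then show ?thesis by simp
  qed
  then have "g = f" by auto
  then show ?thesis using v(1) vg by blast
qed

text \<open>Evaluation at a point of the domain is the inner product with a section, hence
  continuous in the norm; off the domain all functions of the space are 0.\<close>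

lemma eval_limit:
  assumes "\<And>n. v n \<in> H" "f \<in> H" "(\<lambda>n. nrm (\<lambda>x. v n x - f x)) \<longlonglongrightarrow> 0"
  shows "(\<lambda>n. v n x) \<longlonglongrightarrow> f x"
proof (cases "x \<in> \<Theta>")
  case True
  then show ?thesis using ip_limit_left[OF assms(1,2) _ assms(3), of "kernel_section \<Theta> h x"] rep assms
    by (simp add: reproducing_def)
next
  case False
  have z: "g x = 0" if "g \<in> H" for g
    using False rep that unfolding reproducing_def hilbert_function_space_iff by blast
  show ?thesis by (simp only: z[OF assms(1)] z[OF assms(2)] tendsto_const)
qed

end

text \<open>Pairing with a section is evaluation in either space, so the values of the functions
  alone determine inner products on the span.\<close>

lemma reproducing_ip_eq:
  assumes r: "reproducing \<Theta> h H ip" and r': "reproducing \<Theta> h H' ip'"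
    and v: "v \<in> kernel_span \<Theta> h" and w: "w \<in> kernel_span \<Theta> h"
  shows "ip v w = ip' v w"
  using v
proof (induction rule: kernel_span.induct)
  interpret A: function_semi_inner H ip using r by (simp add: reproducing_def hilbert_function_space_iff)
  interpret B: function_semi_inner H' ip' using r' by (simp add: reproducing_def hilbert_function_space_iff)
  note wA = kernel_span_subset[OF r w] and wB = kernel_span_subset[OF r' w]
  case zero
  show ?case using wA wB by simp
  case (step v x c)
  have k: "kernel_section \<Theta> h x \<in> H" "kernel_section \<Theta> h x \<in> H'"
    "ip w (kernel_section \<Theta> h x) = w x" "ip' w (kernel_section \<Theta> h x) = w x"
    using r r' step wA wB by (auto simp: reproducing_def)
  have "ip (\<lambda>y. v y + c * kernel_section \<Theta> h x y) w = ip v w + c * w x"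
    using A.add_left[OF kernel_span_subset[OF r step(1)] A.scale_in[OF k(1)] wA]
      A.scale_left[OF k(1) wA] A.sym[OF k(1) wA] k by simp
  moreover have "ip' (\<lambda>y. v y + c * kernel_section \<Theta> h x y) w = ip' v w + c * w x"
    using B.add_left[OF kernel_span_subset[OF r' step(1)] B.scale_in[OF k(2)] wB]
      B.scale_left[OF k(2) wB] B.sym[OF k(2) wB] k by simp
  ultimately show ?case using step by simp
qed

text \<open>A sequence in the span that converges to \<open>f\<close> in one space is Cauchy in the
  other, because the norms agree on the span. Both limits are pointwise limits of the same sequence
  and therefore coincide.\<close>

lemma reproducing_subset:
  assumes r: "reproducing \<Theta> h H ip" and r': "reproducing \<Theta> h H' ip'" and f: "f \<in> H"
  shows "f \<in> H' \<and> ip f f = ip' f f"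
proof -
  interpret A: function_semi_inner H ip using r by (simp add: reproducing_def hilbert_function_space_iff)
  interpret B: function_semi_inner H' ip' using r' by (simp add: reproducing_def hilbert_function_space_iff)
  obtain v where v: "\<And>n. v n \<in> kernel_span \<Theta> h" and vf: "(\<lambda>n::nat. A.nrm (\<lambda>x. v n x - f x)) \<longlonglongrightarrow> 0"
    using kernel_span_dense[OF r f] by blast
  note vA = kernel_span_subset[OF r v] and vB = kernel_span_subset[OF r' v]
  have nd: "A.nrm (\<lambda>x. v m x - v n x) = B.nrm (\<lambda>x. v m x - v n x)" for m n
  proof -
    have "(\<lambda>x. v m x + (-1) * v n x) \<in> kernel_span \<Theta> h" by (intro kernel_span_add kernel_span_scale v)
    then have "(\<lambda>x. v m x - v n x) \<in> kernel_span \<Theta> h" by simp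
    then show ?thesis unfolding A.nrm_def B.nrm_def using reproducing_ip_eq[OF r r'] by simp
  qed
  have "B.Cauchy_seq v"
    unfolding B.Cauchy_seq_def
  proof (intro conjI allI impI vB)
    fix \<epsilon> :: real assume "\<epsilon> > 0"
    then obtain N where N: "\<And>n. n \<ge> N \<Longrightarrow> A.nrm (\<lambda>x. v n x - f x) < \<epsilon> / 2"
      using LIMSEQ_D[OF vf, of "\<epsilon> / 2"] A.nrm_nonneg[OF A.diff_in[OF vA f]] by auto
    have "B.nrm (\<lambda>x. v m x - v n x) < \<epsilon>" if "m \<ge> N" "n \<ge> N" for m n
      using A.nrm_diff_triangle[OF vA f vA, of m n] A.nrm_diff_commute[OF f vA, of n] N[OF that(1)] N[OF that(2)]
      unfolding nd[symmetric] by simp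
    then show "\<exists>N. \<forall>m\<ge>N. \<forall>n\<ge>N. B.nrm (\<lambda>x. v m x - v n x) < \<epsilon>" by blast
  qed
  then obtain g where g: "g \<in> H'" and vg: "(\<lambda>n. B.nrm (\<lambda>x. v n x - g x)) \<longlonglongrightarrow> 0"
    using r' unfolding reproducing_def hilbert_function_space_iff B.conv_to_def by blast
  have "f = g"
    using LIMSEQ_unique[OF eval_limit[OF r vA f vf] eval_limit[OF r' vB g vg]] by auto
  moreover have "(\<lambda>n. A.nrm (v n)) \<longlonglongrightarrow> A.nrm f" by (rule A.nrm_limit[OF vA f vf])
  moreover have "(\<lambda>n. B.nrm (v n)) \<longlonglongrightarrow> B.nrm g" by (rule B.nrm_limit[OF vB g vg])
  moreover have "A.nrm (v n) = B.nrm (v n)" for n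
    unfolding A.nrm_def B.nrm_def using reproducing_ip_eq[OF r r' v v] by simp
  ultimately have "A.nrm f = B.nrm f" using LIMSEQ_unique by simp
  then have "ip f f = ip' f f" using A.nrm_sq[OF f] B.nrm_sq[OF g] \<open>f = g\<close> by simp
  then show ?thesis using g \<open>f = g\<close> by simp
qed

lemma RKHS_eqI:
  assumes r: "reproducing \<Theta> h H ip"
  shows "RKHS \<Theta> h = (H, ip)"
  unfolding RKHS_def
proof (rule the_equality)
  show "hilbert_function_space \<Theta> (H, ip) \<and> (case (H, ip) of (H, ip) \<Rightarrow>
     (\<forall>x\<in>\<Theta>. kernel_section \<Theta> h x \<in> H \<and> (\<forall>f\<in>H. ip f (kernel_section \<Theta> h x) = f x)))"
    using r by (simp add: reproducing_def)
next
  fix HS assume "hilbert_function_space \<Theta> HS \<and> (case HS of (H, ip) \<Rightarrow>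
     (\<forall>x\<in>\<Theta>. kernel_section \<Theta> h x \<in> H \<and> (\<forall>f\<in>H. ip f (kernel_section \<Theta> h x) = f x)))"
  then obtain H' ip' where HS: "HS = (H', ip')" and r': "reproducing \<Theta> h H' ip'"
    by (cases HS) (auto simp: reproducing_def)
  interpret A: function_semi_inner H ip using r by (simp add: reproducing_def hilbert_function_space_iff)
  interpret B: function_semi_inner H' ip' using r' by (simp add: reproducing_def hilbert_function_space_iff)
  have HH: "H' = H" using reproducing_subset[OF r r'] reproducing_subset[OF r' r] by blast
  have sq: "ip' f f = ip f f" if "f \<in> H" for f using reproducing_subset[OF r r' that] by simp
  have "ip' f g = ip f g" for f g
  proof (cases "f \<in> H \<and> g \<in> H")
    case True
    then have fg: "f \<in> H" "g \<in> H" "f \<in> H'" "g \<in> H'" by (auto simp: HH)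
    \<comment> \<open>Polarisation, since so far only the squared norms are known to agree.\<close>
    have "2 * ip f g = ip (\<lambda>x. f x + g x) (\<lambda>x. f x + g x) - ip f f - ip g g"
      using fg A.add_left[OF fg(1,2) A.add_in[OF fg(1,2)]] A.add_right[OF fg(1,2) fg(1)]
        A.add_right[OF fg(1,2) fg(2)] A.sym[OF fg(1,2)] by simp
    moreover have "2 * ip' f g = ip' (\<lambda>x. f x + g x) (\<lambda>x. f x + g x) - ip' f f - ip' g g"
      using fg B.add_left[OF fg(3,4) B.add_in[OF fg(3,4)]] B.add_right[OF fg(3,4) fg(3)]
        B.add_right[OF fg(3,4) fg(4)] B.sym[OF fg(3,4)] by simp
    ultimately show ?thesis using sq fg A.add_in[OF fg(1,2)] by simp
  next
    case False
    then show ?thesis using r r' HH unfolding reproducing_def hilbert_function_space_iff by metis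
  qed
  then show "HS = (H, ip)" using HS HH by auto
qed

section \<open>Square summable families and feature maps\<close>

definition ell2 :: "'i set \<Rightarrow> ('i \<Rightarrow> real) set" where
  "ell2 J = {c. (\<lambda>j. (c j)\<^sup>2) summable_on J}"

lemma ell2_mult_summable:
  assumes "c \<in> ell2 J" "d \<in> ell2 J"
  shows "(\<lambda>j. c j * d j) summable_on J"
proof -
  have "(\<lambda>j. (c j)\<^sup>2 + (d j)\<^sup>2) summable_on J" using assms by (auto simp: ell2_def intro: summable_on_add)
  moreover have "norm (c j * d j) \<le> (c j)\<^sup>2 + (d j)\<^sup>2" for j
    using sum_squares_bound[of "\<bar>c j\<bar>" "\<bar>d j\<bar>"] mult_nonneg_nonneg[of "\<bar>c j\<bar>" "\<bar>d j\<bar>"]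
    unfolding real_norm_def abs_mult power2_abs by linarith
  ultimately have "(\<lambda>j. norm (c j * d j)) summable_on J"
    by (rule summable_on_comparison_test) auto
  then show ?thesis by (rule abs_summable_summable)
qed

text \<open>Families are total functions whose values outside \<open>J\<close> are invisible, so
  again only a semi-inner product results.\<close>

interpretation ell2: function_semi_inner "ell2 J" "\<lambda>c d. \<Sum>\<^sub>\<infinity>j\<in>J. c j * d j" for J :: "'i set"
proof
  fix f g u :: "'i \<Rightarrow> real" and c :: real
  show "(\<lambda>x. 0) \<in> ell2 J" by (simp add: ell2_def)
  assume f: "f \<in> ell2 J"
  show sc: "(\<lambda>x. c * f x) \<in> ell2 J"
    using f by (auto simp: ell2_def power_mult_distrib intro: summable_on_cmult_right)
  show "0 \<le> (\<Sum>\<^sub>\<infinity>j\<in>J. f j * f j)" by (intro infsum_nonneg) simp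
  assume g: "g \<in> ell2 J"
  have "(\<lambda>j. (f j)\<^sup>2 + 2 * (f j * g j) + (g j)\<^sup>2) summable_on J"
    using f g ell2_mult_summable[OF f g] by (intro summable_on_add summable_on_cmult_right) (auto simp: ell2_def)
  then show "(\<lambda>x. f x + g x) \<in> ell2 J" by (simp add: ell2_def power2_sum algebra_simps)
  show "(\<Sum>\<^sub>\<infinity>j\<in>J. f j * g j) = (\<Sum>\<^sub>\<infinity>j\<in>J. g j * f j)" by (simp add: mult.commute)
  show "(\<Sum>\<^sub>\<infinity>j\<in>J. c * f j * g j) = c * (\<Sum>\<^sub>\<infinity>j\<in>J. f j * g j)"
    using infsum_cmult_right[OF ell2_mult_summable[OF f g], of c] by (simp add: mult.assoc)
  assume u: "u \<in> ell2 J"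
  show "(\<Sum>\<^sub>\<infinity>j\<in>J. (f j + g j) * u j) = (\<Sum>\<^sub>\<infinity>j\<in>J. f j * u j) + (\<Sum>\<^sub>\<infinity>j\<in>J. g j * u j)"
    using infsum_add[OF ell2_mult_summable[OF f u] ell2_mult_summable[OF g u]] by (simp add: distrib_right)
qed

lemma ell2_coord_le:
  assumes "c \<in> ell2 J" "finite F" "F \<subseteq> J"
  shows "(\<Sum>j\<in>F. (c j)\<^sup>2) \<le> (ell2.nrm J c)\<^sup>2"
  unfolding ell2.nrm_sq[OF assms(1)]
  using finite_sum_le_infsum[of "\<lambda>j. (c j)\<^sup>2" J F] assms by (simp add: power2_eq_square ell2_def)

lemma ell2_complete:
  assumes C: "ell2.Cauchy_seq J \<sigma>"
  shows "\<exists>g. ell2.conv_to J \<sigma> g"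
proof -
  have s: "\<sigma> n \<in> ell2 J" for n using C by (simp add: ell2.Cauchy_seq_def)
  have "convergent (\<lambda>n. \<sigma> n j)" if j: "j \<in> J" for j
  proof -
    have le: "\<bar>\<sigma> m j - \<sigma> n j\<bar> \<le> ell2.nrm J (\<lambda>j. \<sigma> m j - \<sigma> n j)" for m n
    proof -
      have "(\<sigma> m j - \<sigma> n j)\<^sup>2 \<le> (ell2.nrm J (\<lambda>j. \<sigma> m j - \<sigma> n j))\<^sup>2"
        using ell2_coord_le[OF ell2.diff_in[OF s s], of "{j}" m n] j by simp
      then show ?thesis using ell2.diff_in[OF s s] by (simp add: abs_le_square_iff[symmetric])
    qed
    have "Cauchy (\<lambda>n. \<sigma> n j)"
      unfolding Cauchy_def dist_real_def using C le unfolding ell2.Cauchy_seq_def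
      by (meson le_less_trans)
    then show ?thesis by (rule Cauchy_convergent)
  qed
  then obtain g where g: "\<And>j. j \<in> J \<Longrightarrow> (\<lambda>n. \<sigma> n j) \<longlonglongrightarrow> g j"
    unfolding convergent_def by metis
  \<comment> \<open>With \<open>m\<close> fixed, \<open>n\<close> tends to infinity in finite
    partial sums; the bound survives and yields both square summability of the difference and its
    distance to the limit.\<close>
  have key: "(\<lambda>j. \<sigma> m j - g j) \<in> ell2 J \<and> ell2.nrm J (\<lambda>j. \<sigma> m j - g j) \<le> \<epsilon>"
    if e: "\<epsilon> > 0" and N: "\<And>m n. \<lbrakk>m \<ge> N; n \<ge> N\<rbrakk> \<Longrightarrow> ell2.nrm J (\<lambda>j. \<sigma> m j - \<sigma> n j) < \<epsilon>" and m: "m \<ge> N" for \<epsilon> N m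
  proof -
    have fin: "(\<Sum>j\<in>F. (\<sigma> m j - g j)\<^sup>2) \<le> \<epsilon>\<^sup>2" if "finite F" "F \<subseteq> J" for F
    proof (rule LIMSEQ_le_const2)
      show "(\<lambda>n. \<Sum>j\<in>F. (\<sigma> m j - \<sigma> n j)\<^sup>2) \<longlonglongrightarrow> (\<Sum>j\<in>F. (\<sigma> m j - g j)\<^sup>2)"
        using that by (intro tendsto_intros g) auto
      have "(\<Sum>j\<in>F. (\<sigma> m j - \<sigma> n j)\<^sup>2) \<le> \<epsilon>\<^sup>2" if "n \<ge> N" for n
      proof -
        have "(\<Sum>j\<in>F. (\<sigma> m j - \<sigma> n j)\<^sup>2) \<le> (ell2.nrm J (\<lambda>j. \<sigma> m j - \<sigma> n j))\<^sup>2"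
          by (rule ell2_coord_le[OF ell2.diff_in[OF s s] \<open>finite F\<close> \<open>F \<subseteq> J\<close>])
        also have "\<dots> \<le> \<epsilon>\<^sup>2" using N[OF m that] ell2.diff_in[OF s s] by (intro power_mono) auto
        finally show ?thesis .
      qed
      then show "\<exists>N. \<forall>n\<ge>N. (\<Sum>j\<in>F. (\<sigma> m j - \<sigma> n j)\<^sup>2) \<le> \<epsilon>\<^sup>2" by blast
    qed
    have summ: "(\<lambda>j. (\<sigma> m j - g j)\<^sup>2) summable_on J"
      using fin by (intro nonneg_bdd_above_summable_on) (auto intro!: bdd_aboveI[of _ "\<epsilon>\<^sup>2"])
    then have i: "(\<lambda>j. \<sigma> m j - g j) \<in> ell2 J" by (simp add: ell2_def)
    have "(ell2.nrm J (\<lambda>j. \<sigma> m j - g j))\<^sup>2 \<le> \<epsilon>\<^sup>2"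
      unfolding ell2.nrm_sq[OF i] using infsum_le_finite_sums[OF summ fin] by (simp add: power2_eq_square)
    then show ?thesis using i e power2_le_imp_le[of "ell2.nrm J (\<lambda>j. \<sigma> m j - g j)" \<epsilon>] by simp
  qed
  obtain N1 where N1: "\<And>m n. \<lbrakk>m \<ge> N1; n \<ge> N1\<rbrakk> \<Longrightarrow> ell2.nrm J (\<lambda>j. \<sigma> m j - \<sigma> n j) < 1"
    using C unfolding ell2.Cauchy_seq_def by (meson zero_less_one)
  have "(\<lambda>j. \<sigma> N1 j - g j) \<in> ell2 J" using key[of 1 N1 N1] N1 by auto
  from ell2.diff_in[OF s[of N1] this] have gin: "g \<in> ell2 J" by simp
  have "(\<lambda>n. ell2.nrm J (\<lambda>j. \<sigma> n j - g j)) \<longlonglongrightarrow> 0"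
  proof (rule LIMSEQ_I)
    fix r :: real assume r: "0 < r"
    then have "r / 2 > 0" by simp
    then obtain N where N: "\<And>m n. \<lbrakk>m \<ge> N; n \<ge> N\<rbrakk> \<Longrightarrow> ell2.nrm J (\<lambda>j. \<sigma> m j - \<sigma> n j) < r / 2"
      using C unfolding ell2.Cauchy_seq_def by meson
    show "\<exists>no. \<forall>n\<ge>no. norm (ell2.nrm J (\<lambda>j. \<sigma> n j - g j) - 0) < r"
      using key[OF \<open>r / 2 > 0\<close> N] r by (intro exI[of _ N] allI impI) fastforce
  qed
  then show ?thesis using gin by (auto simp: ell2.conv_to_def)
qed

text \<open>\<open>H\<close> is the isometric image of l^2 under pairing with the feature vectors,
  so its completeness is that of l^2. The section at \<open>x\<close> is the image of the feature
  vector of \<open>x\<close>, which makes the reproducing property the definition of the pairing.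
  Different coefficient families may give the same function; the hypothesis on \<open>ip\<close>
  holds for each of them.\<close>

lemma RKHS_feature_map:
  fixes u :: "'i \<Rightarrow> 'a \<Rightarrow> real"
  assumes off: "\<And>j x. x \<notin> \<Theta> \<Longrightarrow> u j x = 0"
    and u: "\<And>x. (\<lambda>j. u j x) \<in> ell2 J"
    and H: "H = (\<lambda>c x. \<Sum>\<^sub>\<infinity>j\<in>J. c j * u j x) ` ell2 J"
    and ip: "\<And>c d. \<lbrakk>c \<in> ell2 J; d \<in> ell2 J\<rbrakk> \<Longrightarrow>
       ip (\<lambda>x. \<Sum>\<^sub>\<infinity>j\<in>J. c j * u j x) (\<lambda>x. \<Sum>\<^sub>\<infinity>j\<in>J. d j * u j x) = (\<Sum>\<^sub>\<infinity>j\<in>J. c j * d j)"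
    and ip_off: "\<And>f g. f \<notin> H \<or> g \<notin> H \<Longrightarrow> ip f g = 0"
    and h: "\<And>x y. \<lbrakk>x \<in> \<Theta>; y \<in> \<Theta>\<rbrakk> \<Longrightarrow> h x y = (\<Sum>\<^sub>\<infinity>j\<in>J. u j x * u j y)"
  shows "RKHS \<Theta> h = (H, ip)"
proof (rule RKHS_eqI)
  define \<Phi> where "\<Phi> = (\<lambda>c x. \<Sum>\<^sub>\<infinity>j\<in>J. c j * u j x)"
  have ip': "ip (\<Phi> c) (\<Phi> d) = (\<Sum>\<^sub>\<infinity>j\<in>J. c j * d j)" if "c \<in> ell2 J" "d \<in> ell2 J" for c d
    using ip[OF that] by (simp add: \<Phi>_def)
  have H': "f \<in> H \<longleftrightarrow> (\<exists>c\<in>ell2 J. f = \<Phi> c)" for f using H by (auto simp: \<Phi>_def)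
  have add: "(\<lambda>x. \<Phi> c x + \<Phi> d x) = \<Phi> (\<lambda>j. c j + d j)" if "c \<in> ell2 J" "d \<in> ell2 J" for c d
    using infsum_add[OF ell2_mult_summable[OF that(1) u] ell2_mult_summable[OF that(2) u]]
    by (simp add: \<Phi>_def fun_eq_iff distrib_right)
  have sc: "(\<lambda>x. a * \<Phi> c x) = \<Phi> (\<lambda>j. a * c j)" if "c \<in> ell2 J" for c a
    using infsum_cmult_right[OF ell2_mult_summable[OF that u], of a]
    by (simp add: \<Phi>_def fun_eq_iff mult.assoc)
  have z: "(\<lambda>x. 0) = \<Phi> (\<lambda>j. 0)" by (simp add: \<Phi>_def)
  have fs: "function_semi_inner H ip"
  proof
    fix f g v :: "'a \<Rightarrow> real" and a :: real
    show "(\<lambda>x. 0) \<in> H" using H' z ell2.zero_in by blast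
    assume "f \<in> H"
    then obtain c where c: "c \<in> ell2 J" "f = \<Phi> c" using H' by blast
    show "(\<lambda>x. a * f x) \<in> H" using H' sc c ell2.scale_in by blast
    show "0 \<le> ip f f" using ip'[OF c(1) c(1)] ell2.nonneg[OF c(1)] c(2) by simp
    assume "g \<in> H"
    then obtain d where d: "d \<in> ell2 J" "g = \<Phi> d" using H' by blast
    show "(\<lambda>x. f x + g x) \<in> H" using H' add c d ell2.add_in by blast
    show "ip f g = ip g f" using ip' c d ell2.sym by auto
    show "ip (\<lambda>x. a * f x) g = a * ip f g"
      using ip' c d ell2.scale_left[OF c(1) d(1), of a] sc[OF c(1)] ell2.scale_in[OF c(1)] by auto
    assume "v \<in> H"
    then obtain b where b: "b \<in> ell2 J" "v = \<Phi> b" using H' by blast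
    show "ip (\<lambda>x. f x + g x) v = ip f v + ip g v"
      using ip' c d b ell2.add_left[OF c(1) d(1) b(1)] add[OF c(1) d(1)] ell2.add_in[OF c(1) d(1)] by auto
  qed
  interpret function_semi_inner H ip by fact
  have diff: "(\<lambda>x. \<Phi> c x - \<Phi> d x) = \<Phi> (\<lambda>j. c j - d j)" if "c \<in> ell2 J" "d \<in> ell2 J" for c d
    using add[OF that(1) ell2.scale_in[OF that(2)], of "-1"] sc[OF that(2), of "-1", symmetric]
    by (simp add: fun_eq_iff)
  have nrm: "nrm (\<lambda>x. \<Phi> c x - \<Phi> d x) = ell2.nrm J (\<lambda>j. c j - d j)" if "c \<in> ell2 J" "d \<in> ell2 J" for c d
    using diff[OF that] ip'[OF ell2.diff_in[OF that] ell2.diff_in[OF that]]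
    by (simp add: nrm_def ell2.nrm_def)
  show "reproducing \<Theta> h H ip"
    unfolding reproducing_def hilbert_function_space_iff
  proof (intro conjI allI ballI impI)
    fix f x assume "f \<in> H" "x \<notin> \<Theta>"
    then show "f x = 0" using off by (auto simp: H' \<Phi>_def)
  next
    fix f assume f: "f \<in> H" "ip f f = 0"
    then obtain c where c: "c \<in> ell2 J" "f = \<Phi> c" using H' by blast
    \<comment> \<open>A family of length 0 is orthogonal to every feature vector.\<close>
    have "f x = 0" for x
      using ell2.nrm_eq_0D[OF c(1) u, of x] ip'[OF c(1) c(1)] c(2) f(2) by (simp add: \<Phi>_def)
    then show "f = (\<lambda>x. 0)" by auto
  next
    fix \<sigma> assume C: "Cauchy_seq \<sigma>"
    then have "\<forall>n. \<exists>c. c \<in> ell2 J \<and> \<sigma> n = \<Phi> c" using H' by (auto simp: Cauchy_seq_def)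
    then obtain c where c: "\<And>n. c n \<in> ell2 J" "\<And>n. \<sigma> n = \<Phi> (c n)" by metis
    have "ell2.Cauchy_seq J c" using C c(1) unfolding Cauchy_seq_def ell2.Cauchy_seq_def
      by (simp add: c(2) nrm)
    then obtain g where "ell2.conv_to J c g" using ell2_complete by blast
    then have "conv_to \<sigma> (\<Phi> g)" using c(1) H' by (auto simp: conv_to_def ell2.conv_to_def c(2) nrm)
    then show "\<exists>g. conv_to \<sigma> g" by blast
  next
    fix x assume x: "x \<in> \<Theta>"
    have k: "kernel_section \<Theta> h x = \<Phi> (\<lambda>j. u j x)"
      using x h off by (auto simp: kernel_section_def \<Phi>_def fun_eq_iff)
    then show "kernel_section \<Theta> h x \<in> H" using u H' by blast
    fix f assume "f \<in> H"
    then obtain c where c: "c \<in> ell2 J" "f = \<Phi> c" using H' by blast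
    then show "ip f (kernel_section \<Theta> h x) = f x" using ip'[OF c(1) u, of x] by (simp add: k \<Phi>_def)
  qed (use fs ip_off in auto)
qed

section \<open>Test functions\<close>

text \<open>Powers of \<open>exp (- 1 / t)\<close>: the parameter \<open>c\<close> lets the bumps increase to the indicator of a box as \<open>c \<rightarrow> 0\<close>,
  and the polynomial factor makes the family closed under differentiation.\<close>

definition exp_bump :: "real \<Rightarrow> real poly \<Rightarrow> real \<Rightarrow> real" where
  "exp_bump c p t = (if t > 0 then poly p (1 / t) * exp (- c / t) else 0)"

text \<open>The behaviour of the bumps as t decreases to 0, in the variable s = 1/t; the exponential
  beats each monomial.\<close>

lemma exp_bump_tendsto_0:
  assumes "c > 0"
  shows "((\<lambda>s::real. poly p s * exp (- c * s)) \<longlongrightarrow> 0) at_top"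
proof -
  have mono: "((\<lambda>s::real. s ^ k * exp (- c * s)) \<longlongrightarrow> 0) at_top" for k
  proof -
    have "filterlim (\<lambda>s::real. c * s) at_top at_top"
      by (rule filterlim_tendsto_pos_mult_at_top[OF tendsto_const assms filterlim_ident])
    then have "((\<lambda>s. (c * s) ^ k / exp (c * s)) \<longlongrightarrow> 0) at_top"
      by (rule filterlim_compose[OF tendsto_power_div_exp_0])
    then have "((\<lambda>s. (1 / c ^ k) * ((c * s) ^ k / exp (c * s))) \<longlongrightarrow> (1 / c ^ k) * 0) at_top"
      by (intro tendsto_mult tendsto_const)
    moreover have "(1 / c ^ k) * ((c * s) ^ k / exp (c * s)) = s ^ k * exp (- c * s)" for s
      using assms by (simp add: power_mult_distrib exp_minus field_simps)
    ultimately show ?thesis by simp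
  qed
  have "((\<lambda>s. \<Sum>i\<le>degree p. coeff p i * (s ^ i * exp (- c * s))) \<longlongrightarrow> (\<Sum>i\<le>degree p. coeff p i * 0)) at_top"
    by (intro tendsto_intros mono)
  then show ?thesis by (simp add: poly_altdef sum_distrib_right mult.assoc)
qed

text \<open>With s = 1/t the chain rule gives s^2 (c p(s) - p'(s)) exp(-c s), a polynomial in s
  times the same exponential. At 0 the difference quotient from the right belongs to the polynomial
  s p(s), written \<open>pCons 0 p\<close>, and tends to 0.\<close>

lemma DERIV_exp_bump:
  assumes c: "c > 0"
  shows "(exp_bump c p has_real_derivative exp_bump c ([:0, 0, 1:] * (smult c p - pderiv p)) t) (at t)"
proof -
  consider "t > 0" | "t < 0" | "t = 0" by linarith
  then show ?thesis
  proof cases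
    case 1
    have "((\<lambda>t. poly p (1 / t) * exp (- c / t)) has_real_derivative
       exp_bump c ([:0, 0, 1:] * (smult c p - pderiv p)) t) (at t)"
      using 1 by (auto intro!: derivative_eq_intros poly_DERIV[THEN DERIV_chain2]
          simp: exp_bump_def field_simps power2_eq_square)
    then show ?thesis
      by (rule has_field_derivative_transform_within_open[of _ _ _ "{0<..}"]) (use 1 in \<open>auto simp: exp_bump_def\<close>)
  next
    case 2
    have "((\<lambda>t. 0) has_real_derivative exp_bump c ([:0, 0, 1:] * (smult c p - pderiv p)) t) (at t)"
      using 2 by (simp add: exp_bump_def)
    then show ?thesis
      by (rule has_field_derivative_transform_within_open[of _ _ _ "{..<0}"]) (use 2 in \<open>auto simp: exp_bump_def\<close>)
  next
    case 3
    have "((\<lambda>h. exp_bump c p h / h) \<longlongrightarrow> 0) (at_right 0)"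
    proof -
      have "((\<lambda>h. poly (pCons 0 p) (inverse h) * exp (- c * inverse h)) \<longlongrightarrow> 0) (at_right 0)"
        by (rule filterlim_compose[OF exp_bump_tendsto_0[OF c] filterlim_inverse_at_top_right])
      then show ?thesis
        by (rule Lim_transform_eventually)
          (auto simp: eventually_at_filter exp_bump_def field_simps)
    qed
    moreover have "((\<lambda>h. exp_bump c p h / h) \<longlongrightarrow> 0) (at_left 0)"
      by (rule Lim_transform_eventually[OF tendsto_const]) (auto simp: eventually_at_filter exp_bump_def)
    ultimately have "((\<lambda>h. exp_bump c p h / h) \<longlongrightarrow> 0) (at 0)"
      using filterlim_at_split by blast
    then show ?thesis using 3 by (simp add: DERIV_def exp_bump_def)
  qed
qed

text \<open>Smoothness of finite order with an arbitrary continuous witness for each derivative.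
  Sums and products can then be treated by induction on the order, where the product rule supplies
  the next witness.\<close>

primrec Cn :: "nat \<Rightarrow> (real ^ 'n::finite \<Rightarrow> real) \<Rightarrow> bool" where
  "Cn 0 f \<longleftrightarrow> continuous_on UNIV f"
| "Cn (Suc m) f \<longleftrightarrow> continuous_on UNIV f \<and>
     (\<forall>i. \<exists>g. (\<forall>x. ((\<lambda>t. f (x + t *\<^sub>R dir i)) has_real_derivative g x) (at 0)) \<and> Cn m g)"

lemma Cn_continuous: "Cn m f \<Longrightarrow> continuous_on UNIV f"
  by (cases m) auto

lemma Cn_Suc_imp: "Cn (Suc m) f \<Longrightarrow> Cn m f"
proof (induction m arbitrary: f)
  case (Suc m)
  then show ?case by (metis Cn.simps(2))
qed simp

lemma Cn_add: "\<lbrakk>Cn m f; Cn m g\<rbrakk> \<Longrightarrow> Cn m (\<lambda>x. f x + g x)"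
proof (induction m arbitrary: f g)
  case (Suc m)
  show ?case unfolding Cn.simps
  proof (intro conjI allI)
    show "continuous_on UNIV (\<lambda>x. f x + g x)" using Suc.prems by (auto intro: continuous_intros)
    fix i
    obtain f' g' where "\<And>x. ((\<lambda>t. f (x + t *\<^sub>R dir i)) has_real_derivative f' x) (at 0)" "Cn m f'"
      "\<And>x. ((\<lambda>t. g (x + t *\<^sub>R dir i)) has_real_derivative g' x) (at 0)" "Cn m g'"
      using Suc.prems by (metis Cn.simps(2))
    then show "\<exists>d. (\<forall>x. ((\<lambda>t. f (x + t *\<^sub>R dir i) + g (x + t *\<^sub>R dir i)) has_real_derivative d x) (at 0)) \<and> Cn m d"
      using Suc.IH by (intro exI[of _ "\<lambda>x. f' x + g' x"]) (auto intro: DERIV_add)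
  qed
qed (auto intro: continuous_intros)

lemma Cn_mult: "\<lbrakk>Cn m f; Cn m g\<rbrakk> \<Longrightarrow> Cn m (\<lambda>x. f x * g x)"
proof (induction m arbitrary: f g)
  case (Suc m)
  show ?case unfolding Cn.simps
  proof (intro conjI allI)
    show "continuous_on UNIV (\<lambda>x. f x * g x)" using Suc.prems by (auto intro: continuous_intros)
    fix i
    obtain f' g' where f': "\<And>x. ((\<lambda>t. f (x + t *\<^sub>R dir i)) has_real_derivative f' x) (at 0)" "Cn m f'"
      and g': "\<And>x. ((\<lambda>t. g (x + t *\<^sub>R dir i)) has_real_derivative g' x) (at 0)" "Cn m g'"
      using Suc.prems by (metis Cn.simps(2))
    have "((\<lambda>t. f (x + t *\<^sub>R dir i) * g (x + t *\<^sub>R dir i)) has_real_derivative f' x * g x + g' x * f x) (at 0)" for x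
      using DERIV_mult[OF f'(1)[of x] g'(1)[of x]] by simp
    moreover have "Cn m (\<lambda>x. f' x * g x + g' x * f x)"
      using Suc.prems f' g' by (intro Cn_add Suc.IH) (auto intro: Cn_Suc_imp)
    ultimately show "\<exists>d. (\<forall>x. ((\<lambda>t. f (x + t *\<^sub>R dir i) * g (x + t *\<^sub>R dir i)) has_real_derivative d x) (at 0)) \<and> Cn m d"
      by (intro exI[of _ "\<lambda>x. f' x * g x + g' x * f x"] conjI allI)
  qed
qed (auto intro: continuous_intros)

lemma Cn_const: "Cn m (\<lambda>x. a)"
proof (induction m arbitrary: a)
  case (Suc m)
  then show ?case by (auto intro!: exI[of _ "\<lambda>x. 0"])
qed (auto intro: continuous_intros)

lemma Cn_prod: "(\<And>i. i \<in> F \<Longrightarrow> Cn m (f i)) \<Longrightarrow> Cn m (\<lambda>x. \<Prod>i\<in>F. f i x)"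
  by (induction F rule: infinite_finite_induct) (auto intro: Cn_const Cn_mult)

text \<open>The induction lets the polynomial vary, since differentiation changes it. The affine
  argument covers both factors of a box bump, with slopes 1 and -1.\<close>

lemma Cn_exp_bump:
  fixes j :: "'n::finite"
  assumes c: "c > 0"
  shows "Cn m (\<lambda>x::real ^ 'n. exp_bump c p (r * x $ j + a))"
proof (induction m arbitrary: p)
  case 0
  have "continuous_on UNIV (exp_bump c p)"
    by (rule DERIV_continuous_on) (rule DERIV_subset[OF DERIV_exp_bump[OF c]], simp)
  then have "continuous_on UNIV (\<lambda>x::real ^ 'n. exp_bump c p (r * x $ j + a))"
    by (rule continuous_on_compose2) (auto intro!: continuous_intros)
  then show ?case by simp
next
  case (Suc m)
  let ?q = "[:0, 0, 1:] * (smult c p - pderiv p)"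
  show ?case unfolding Cn.simps
  proof (intro conjI allI)
    show "continuous_on UNIV (\<lambda>x::real ^ 'n. exp_bump c p (r * x $ j + a))"
      by (rule Cn_continuous[OF Suc.IH])
    fix i :: 'n
    have "((\<lambda>t. exp_bump c p (r * (x + t *\<^sub>R dir i) $ j + a)) has_real_derivative
       exp_bump c ?q (r * x $ j + a) * (r * dir i $ j)) (at 0)" for x :: "real ^ 'n"
      by (rule DERIV_chain2[where f = "exp_bump c p"])
         (auto intro!: derivative_eq_intros DERIV_exp_bump[OF c, THEN DERIV_cong])
    moreover have "Cn m (\<lambda>x::real ^ 'n. exp_bump c ?q (r * x $ j + a) * (r * dir i $ j))"
      by (intro Cn_mult Suc.IH Cn_const)
    ultimately show "\<exists>d. (\<forall>x. ((\<lambda>t. exp_bump c p (r * (x + t *\<^sub>R dir i) $ j + a)) has_real_derivative d x) (at 0)) \<and> Cn m d"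
      by (intro exI[of _ "\<lambda>x. exp_bump c ?q (r * x $ j + a) * (r * dir i $ j)"]) blast
  qed
qed

text \<open>The surplus order \<open>m\<close> lets the induction differentiate once more; the
  application to test functions takes \<open>m = 0\<close>.\<close>

lemma Cn_partials:
  "Cn (m + length ds) f \<Longrightarrow> partials_exist dir UNIV ds f \<and> Cn m (partials dir ds f)"
proof (induction ds arbitrary: m)
  case (Cons d ds)
  then have IH: "partials_exist dir UNIV ds f" "Cn (Suc m) (partials dir ds f)" by (metis add_Suc add_Suc_right length_Cons)+
  then obtain g where g: "\<And>x. ((\<lambda>t. partials dir ds f (x + t *\<^sub>R dir d)) has_real_derivative g x) (at 0)" "Cn m g"
    by (metis Cn.simps(2))
  have "partial (dir d) (partials dir ds f) = g"
    using DERIV_imp_deriv[OF g(1)] by (auto simp: partial_def)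
  then show ?case using IH g by (auto simp: real_differentiable_def)
qed simp

definition box_bump :: "real \<Rightarrow> real ^ 'n::finite \<Rightarrow> real ^ 'n \<Rightarrow> real ^ 'n \<Rightarrow> real" where
  "box_bump c a b x = (\<Prod>j\<in>UNIV. exp_bump c 1 (x $ j - a $ j) * exp_bump c 1 (b $ j - x $ j))"

lemma box_bump_outside:
  assumes "x \<notin> box a b"
  shows "box_bump c a b x = 0"
proof -
  obtain j where "\<not> (a $ j < x $ j \<and> x $ j < b $ j)" using assms by (auto simp: mem_box_cart)
  then show ?thesis unfolding box_bump_def by (auto intro!: prod_zero bexI[of _ j] simp: exp_bump_def)
qed

lemma box_bump_bounds:
  assumes "c > 0"
  shows "0 \<le> box_bump c a b x" "box_bump c a b x \<le> 1"
  using assms unfolding box_bump_def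
  by (auto intro!: prod_nonneg prod_le_1 mult_le_one simp: exp_bump_def)

lemma test_function_box_bump:
  assumes c: "c > 0" and sub: "cbox a b \<subseteq> \<Theta>"
  shows "test_function \<Theta> (box_bump c a b)"
proof -
  have C: "Cn m (box_bump c a b)" for m
  proof -
    have "Cn m (\<lambda>x. \<Prod>j\<in>UNIV. exp_bump c 1 (1 * x $ j + - a $ j) * exp_bump c 1 (-1 * x $ j + b $ j))"
      by (intro Cn_prod Cn_mult Cn_exp_bump c)
    then show ?thesis by (simp add: box_bump_def[abs_def])
  qed
  have "{x. box_bump c a b x \<noteq> 0} \<subseteq> cbox a b"
    using box_bump_outside box_subset_cbox by blast
  then have "closure {x. box_bump c a b x \<noteq> 0} \<subseteq> cbox a b"
    by (rule closure_minimal) (rule closed_cbox)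
  moreover from this have "compact (closure {x. box_bump c a b x \<noteq> 0})"
    by (metis closed_closure compact_Int_closed compact_cbox inf.absorb_iff2)
  ultimately show ?thesis
    using sub C Cn_partials[of 0 _ "box_bump c a b"] Cn_continuous unfolding test_function_def by fastforce
qed

lemma box_bump_tendsto:
  assumes "x \<in> box a b"
  shows "(\<lambda>m. box_bump (inverse (real (Suc m))) a b x) \<longlonglongrightarrow> 1"
proof -
  have e: "(\<lambda>m. exp_bump (inverse (real (Suc m))) 1 t) \<longlonglongrightarrow> 1" if "t > 0" for t
  proof -
    have "(\<lambda>m. exp (- inverse (real (Suc m)) / t)) \<longlonglongrightarrow> exp (- 0 / t)"
      by (intro tendsto_intros LIMSEQ_inverse_real_of_nat) (use that in auto)
    then show ?thesis using that by (simp add: exp_bump_def)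
  qed
  have "(\<lambda>m. box_bump (inverse (real (Suc m))) a b x) \<longlonglongrightarrow> (\<Prod>j\<in>(UNIV::'a set). 1 * 1)"
    unfolding box_bump_def using assms by (intro tendsto_intros e) (auto simp: mem_box_cart)
  then show ?thesis by simp
qed

section \<open>The fundamental lemma of the calculus of variations\<close>

lemma AE_lebesgue_on_iff:
  assumes "S \<in> sets lebesgue"
  shows "(AE x in lebesgue_on S. P x) \<longleftrightarrow> negligible {x \<in> S. \<not> P x}"
proof -
  have "(AE x in lebesgue_on S. P x) \<longleftrightarrow> (AE x in lebesgue. x \<in> S \<longrightarrow> P x)"
    using assms by (simp add: AE_restrict_space_iff)
  also have "\<dots> \<longleftrightarrow> negligible {x \<in> S. \<not> P x}"
    unfolding eventually_ae_filter_negligible by (auto intro: negligible_subset exI[of _ "{x \<in> S. \<not> P x}"])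
  finally show ?thesis .
qed

lemma absolutely_integrable_on_iff_lebesgue_on:
  fixes f :: "real ^ 'n::finite \<Rightarrow> real"
  assumes "S \<in> sets lebesgue"
  shows "f absolutely_integrable_on S \<longleftrightarrow> integrable (lebesgue_on S) f"
  using assms by (simp add: set_integrable_def integrable_restrict_space)

text \<open>Bumps tending to the indicator of a box show, by dominated convergence, that
  \<open>u\<close> has integral 0 over every closed box in the domain. Differentiation of integrals
  over shrinking cubes then gives \<open>u = 0\<close> almost everywhere on each such box, and
  countably many of them cover the domain.\<close>

lemma fundamental_lemma:
  fixes u :: "real ^ 'n::finite \<Rightarrow> real"
  assumes op: "open \<Theta>" and loc: "locally_integrable \<Theta> u"
    and test: "\<And>\<phi>. test_function \<Theta> \<phi> \<Longrightarrow> (\<integral>x. u x * \<phi> x \<partial>lebesgue_on \<Theta>) = 0"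
  shows "AE x in lebesgue_on \<Theta>. u x = 0"
proof -
  have meas: "\<Theta> \<in> sets lebesgue" using op by (simp add: borel_open)
  have box0: "integral (cbox a b) u = 0" if sub: "cbox a b \<subseteq> \<Theta>" for a b
  proof -
    let ?M = "lebesgue_on (cbox a b)"
    let ?\<phi> = "\<lambda>m. box_bump (inverse (real (Suc m))) a b"
    have int: "integrable ?M u"
      using loc sub absolutely_integrable_on_iff_lebesgue_on[of "cbox a b" u]
      unfolding locally_integrable_def by (metis compact_cbox lmeasurable_cbox fmeasurableD)
    have cont: "continuous_on UNIV (?\<phi> m)" for m
      using test_function_box_bump[OF _ sub, of "inverse (real (Suc m))"]
      unfolding test_function_def by (metis inverse_positive_iff_positive of_nat_0_less_iff partials.simps(1) zero_less_Suc)
    have m: "?\<phi> m \<in> borel_measurable ?M" for m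
      using borel_measurable_continuous_onI[OF cont] by (auto intro!: measurable_restrict_space1 measurable_completion)
    have 0: "(\<integral>x. u x * ?\<phi> m x \<partial>?M) = 0" for m
    proof -
      have "(\<integral>x. u x * ?\<phi> m x \<partial>?M) = (\<integral>x. (if x \<in> cbox a b then u x * ?\<phi> m x else 0) \<partial>lebesgue_on \<Theta>)"
        by (rule integral_restrict[symmetric]) (use sub meas in auto)
      also have "\<dots> = (\<integral>x. u x * ?\<phi> m x \<partial>lebesgue_on \<Theta>)"
      proof (intro Bochner_Integration.integral_cong refl)
        fix x show "(if x \<in> cbox a b then u x * ?\<phi> m x else 0) = u x * ?\<phi> m x"
          using box_bump_outside[of x a b] box_subset_cbox[of a b] by auto
      qed
      also have "\<dots> = 0" by (intro test test_function_box_bump sub) simp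
      finally show ?thesis .
    qed
    have "negligible {x \<in> cbox a b. \<not> x \<in> box a b}"
      using negligible_frontier_interval[of a b] by (simp add: set_diff_eq)
    then have "AE x in ?M. x \<in> box a b" by (simp add: AE_lebesgue_on_iff)
    then have lim: "AE x in ?M. (\<lambda>m. u x * ?\<phi> m x) \<longlonglongrightarrow> u x"
    proof eventually_elim
      case (elim x)
      then show ?case using tendsto_mult[OF tendsto_const box_bump_tendsto[OF elim], of "u x"] by simp
    qed
    have "(\<lambda>m. \<integral>x. u x * ?\<phi> m x \<partial>?M) \<longlonglongrightarrow> (\<integral>x. u x \<partial>?M)"
    proof (rule integral_dominated_convergence[where w = "\<lambda>x. \<bar>u x\<bar>"])
      show "AE x in ?M. norm (u x * ?\<phi> m x) \<le> \<bar>u x\<bar>" for m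
        using box_bump_bounds[of "inverse (real (Suc m))" a b] by (auto simp: abs_mult intro!: AE_I2 mult_left_le)
    qed (use int m lim in auto)
    then have "(\<integral>x. u x \<partial>?M) = 0" unfolding 0 by (simp add: LIMSEQ_const_iff)
    then show ?thesis using lebesgue_integral_eq_integral[OF int] by simp
  qed
  have on_box: "negligible {x \<in> cbox a b. u x \<noteq> 0}" if sub: "cbox a b \<subseteq> \<Theta>" for a b
  proof -
    \<comment> \<open>Cutting off outside the box produces a function integrable on all boxes, to
      which the differentiation theorem applies.\<close>
    define f where "f = (\<lambda>x. if x \<in> cbox a b then u x else 0)"
    have fi: "f integrable_on cbox c d" for c d
    proof -
      have "u absolutely_integrable_on (cbox a b \<inter> cbox c d)"
        using loc sub compact_Int[OF compact_cbox compact_cbox, of a b c d]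
        unfolding locally_integrable_def by blast
      then have "u integrable_on (cbox a b \<inter> cbox c d)" by (rule set_lebesgue_integral_eq_integral)
      then show ?thesis unfolding f_def using integrable_restrict_Int by blast
    qed
    \<comment> \<open>Lebesgue differentiation: off a null set the averages over cubes with lower
      corner \<open>x\<close> tend to \<open>f x\<close>.\<close>
    then obtain N where N: "negligible N"
      "\<And>x e. \<lbrakk>x \<notin> N; 0 < e\<rbrakk> \<Longrightarrow> \<exists>d>0. \<forall>h. 0 < h \<and> h < d \<longrightarrow>
         norm (integral (cbox x (x + h *\<^sub>R One)) f /\<^sub>R h ^ DIM(real ^ 'n) - f x) < e"
      using integrable_ccontinuous_explicit[of f] by blast
    have "u x = 0" if x: "x \<in> box a b" "x \<notin> N" for x
    proof (rule ccontr)
      assume ne: "u x \<noteq> 0"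
      then obtain d where d: "d > 0" "\<And>h. 0 < h \<and> h < d \<Longrightarrow>
        norm (integral (cbox x (x + h *\<^sub>R One)) f /\<^sub>R h ^ DIM(real ^ 'n) - f x) < \<bar>u x\<bar>"
        using N(2)[OF x(2), of "\<bar>u x\<bar>"] by auto
      have "((\<lambda>h. x + h *\<^sub>R One) \<longlongrightarrow> x + 0 *\<^sub>R One) (at_right 0)" by (intro tendsto_intros)
      then have "((\<lambda>h. x + h *\<^sub>R One) \<longlongrightarrow> x) (at_right 0)" by simp
      then have "\<forall>\<^sub>F h in at_right 0. x + h *\<^sub>R One \<in> box a b"
        using x(1) open_box topological_tendstoD by blast
      moreover have "\<forall>\<^sub>F h in at_right (0::real). h < d" using d(1) unfolding eventually_at_right_field by blast
      moreover have "\<forall>\<^sub>F h in at_right (0::real). 0 < h" by (rule eventually_at_right_less)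
      ultimately have "\<forall>\<^sub>F h in at_right 0. x + h *\<^sub>R One \<in> box a b \<and> h < d \<and> 0 < h"
        by eventually_elim auto
      then obtain h where h: "x + h *\<^sub>R One \<in> box a b" "h < d" "0 < h"
        using eventually_happens'[OF trivial_limit_at_right_real] by blast
      have cs: "cbox x (x + h *\<^sub>R One) \<subseteq> cbox a b"
        using x(1) h(1) box_subset_cbox[of a b] by (intro subset_box_imp) (auto simp: mem_box subset_box intro: less_imp_le)
      have "integral (cbox x (x + h *\<^sub>R One)) f = integral (cbox x (x + h *\<^sub>R One)) u"
        using cs by (intro integral_cong) (auto simp: f_def)
      also have "\<dots> = 0" using cs sub by (intro box0) auto
      finally show False using d(2)[of h] h x(1) box_subset_cbox[of a b] by (auto simp: f_def)
    qed
    then have "{x \<in> cbox a b. u x \<noteq> 0} \<subseteq> N \<union> (cbox a b - box a b)" by auto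
    then show ?thesis using N(1) negligible_frontier_interval negligible_Un negligible_subset by blast
  qed
  obtain D where D: "countable D" "D \<subseteq> Pow \<Theta>" "\<And>X. X \<in> D \<Longrightarrow> \<exists>a b. X = cbox a b" "\<Union>D = \<Theta>"
    using open_countable_Union_open_cbox[OF op] by metis
  have "negligible (\<Union>X\<in>D. {x \<in> X. u x \<noteq> 0})"
  proof (rule negligible_countable_Union)
    show "countable ((\<lambda>X. {x \<in> X. u x \<noteq> 0}) ` D)" using D(1) by simp
  qed (use on_box D in blast)
  moreover have "(\<Union>X\<in>D. {x \<in> X. u x \<noteq> 0}) = {x \<in> \<Theta>. u x \<noteq> 0}" using D(4) by blast
  ultimately show ?thesis using meas by (simp add: AE_lebesgue_on_iff)
qed

section \<open>Partial derivatives of kernels\<close>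

lemma partials_append: "partials v (ds @ es) f = partials v ds (partials v es f)"
  by (induction ds) auto

lemma eventually_line_in_open:
  fixes x :: "'a::real_normed_vector"
  assumes "open S" "x \<in> S"
  shows "\<forall>\<^sub>F t in nhds 0. x + t *\<^sub>R u \<in> S"
proof -
  have "open ((\<lambda>t. x + t *\<^sub>R u) -` S)" by (intro open_vimage assms(1) continuous_intros)
  then show ?thesis using assms(2) by (auto simp: eventually_nhds)
qed

lemma partial_cong_open:
  assumes "open S" "\<And>x. x \<in> S \<Longrightarrow> f x = g x" "x \<in> S"
  shows "partial u f x = partial u g x"
    and "(\<lambda>t. f (x + t *\<^sub>R u)) differentiable (at 0) \<longleftrightarrow> (\<lambda>t. g (x + t *\<^sub>R u)) differentiable (at 0)"
proof -
  have ev': "\<forall>\<^sub>F t in nhds 0. f (x + t *\<^sub>R u) = g (x + t *\<^sub>R u)"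
    using eventually_line_in_open[OF assms(1,3)] by eventually_elim (rule assms(2))
  then show "partial u f x = partial u g x" unfolding partial_def by (intro deriv_cong_ev) auto
  show "(\<lambda>t. f (x + t *\<^sub>R u)) differentiable (at 0) \<longleftrightarrow> (\<lambda>t. g (x + t *\<^sub>R u)) differentiable (at 0)"
    unfolding real_differentiable_def using DERIV_cong_ev[OF refl ev' refl] by blast
qed

lemma partials_cong_open:
  assumes "open S" "\<And>x. x \<in> S \<Longrightarrow> f x = g x"
  shows "x \<in> S \<Longrightarrow> partials v ds f x = partials v ds g x"
  by (induction ds arbitrary: x) (auto intro: assms partial_cong_open(1)[OF assms(1)])

lemma DERIV_partial:
  assumes "(\<lambda>t. f ((x + s *\<^sub>R u) + t *\<^sub>R u)) differentiable (at 0)"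
  shows "((\<lambda>t. f (x + t *\<^sub>R u)) has_real_derivative partial u f (x + s *\<^sub>R u)) (at s)"
proof -
  have "((\<lambda>t. f ((x + s *\<^sub>R u) + t *\<^sub>R u)) has_real_derivative partial u f (x + s *\<^sub>R u)) (at 0)"
    using assms unfolding partial_def real_differentiable_def using DERIV_imp_deriv by metis
  then have "((\<lambda>t. f (x + (t + s) *\<^sub>R u)) has_real_derivative partial u f (x + s *\<^sub>R u)) (at 0)"
    by (simp add: algebra_simps)
  then show ?thesis using DERIV_shift[of "\<lambda>t. f (x + t *\<^sub>R u)" _ 0 s] by simp
qed

text \<open>The mean value theorem is applied twice, along \<open>u\<close> to the difference in
  direction \<open>w\<close> and then along \<open>w\<close>; this represents the quotient exactly
  as a value of the mixed derivative at a point near \<open>x\<close>, where continuity finishes the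
  proof.\<close>

lemma second_difference:
  fixes f :: "'a::real_normed_vector \<Rightarrow> real"
  assumes op: "open S" and x: "x \<in> S"
    and du: "\<And>x. x \<in> S \<Longrightarrow> (\<lambda>t. f (x + t *\<^sub>R u)) differentiable (at 0)"
    and dw: "\<And>x. x \<in> S \<Longrightarrow> (\<lambda>t. partial u f (x + t *\<^sub>R w)) differentiable (at 0)"
    and cont: "continuous_on S (partial w (partial u f))"
  shows "((\<lambda>t. (f (x + t *\<^sub>R u + t *\<^sub>R w) - f (x + t *\<^sub>R u) - f (x + t *\<^sub>R w) + f x) / t\<^sup>2)
            \<longlongrightarrow> partial w (partial u f) x) (at_right 0)"
proof (rule tendstoI)
  fix e :: real assume e: "e > 0"
  let ?P = "partial w (partial u f)"
  have "isCont ?P x" using cont op x continuous_on_eq_continuous_at by blast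
  then obtain d where d: "d > 0" "\<And>y. dist y x < d \<Longrightarrow> dist (?P y) (?P x) < e"
    using e unfolding continuous_at_eps_delta by (metis dist_commute)
  obtain r where r: "r > 0" "ball x r \<subseteq> S" using op x openE by blast
  \<comment> \<open>Steps shorter than \<open>m\<close> along both directions stay within
    \<open>min d r\<close> of \<open>x\<close>; the summand 1 excludes a zero denominator.\<close>
  define m where "m = min d r / (norm u + norm w + 1)"
  have m: "m > 0" using d r by (simp add: m_def add_nonneg_pos)
  have near: "dist (x + a *\<^sub>R u + b *\<^sub>R w) x < min d r" if "0 \<le> a" "a \<le> t" "0 \<le> b" "b \<le> t" "t < m" for a b t
  proof -
    have "dist (x + a *\<^sub>R u + b *\<^sub>R w) x = norm (a *\<^sub>R u + b *\<^sub>R w)" by (simp add: dist_norm algebra_simps)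
    also have "\<dots> \<le> a * norm u + b * norm w" using that norm_triangle_ineq[of "a *\<^sub>R u" "b *\<^sub>R w"] by simp
    also have "\<dots> \<le> m * norm u + m * norm w" using that by (intro add_mono mult_right_mono) auto
    also have "\<dots> < m * (norm u + norm w + 1)" using m by (simp add: algebra_simps)
    also have "\<dots> = min d r" by (simp add: m_def) (smt (verit) norm_ge_zero)
    finally show ?thesis .
  qed
  have inS: "x + a *\<^sub>R u + b *\<^sub>R w \<in> S" if "0 \<le> a" "a \<le> t" "0 \<le> b" "b \<le> t" "t < m" for a b t
    using near[OF that] r by (auto simp: dist_commute)
  have "dist ((f (x + t *\<^sub>R u + t *\<^sub>R w) - f (x + t *\<^sub>R u) - f (x + t *\<^sub>R w) + f x) / t\<^sup>2) (?P x) < e"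
    if t: "0 < t" "t < m" for t
  proof -
    let ?\<phi> = "\<lambda>s. f ((x + t *\<^sub>R w) + s *\<^sub>R u) - f (x + s *\<^sub>R u)"
    have "(?\<phi> has_real_derivative partial u f ((x + t *\<^sub>R w) + s *\<^sub>R u) - partial u f (x + s *\<^sub>R u)) (at s)"
      if s: "0 \<le> s" "s \<le> t" for s
    proof (intro DERIV_diff DERIV_partial du)
      show "x + t *\<^sub>R w + s *\<^sub>R u \<in> S" using inS[OF s, of t] t by (simp add: algebra_simps)
      show "x + s *\<^sub>R u \<in> S" using inS[OF s, of 0] t by simp
    qed
    from MVT2[OF t(1) this] obtain \<xi> where \<xi>: "0 < \<xi>" "\<xi> < t"
      "?\<phi> t - ?\<phi> 0 = t * (partial u f ((x + t *\<^sub>R w) + \<xi> *\<^sub>R u) - partial u f (x + \<xi> *\<^sub>R u))" by auto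
    let ?\<psi> = "\<lambda>s. partial u f ((x + \<xi> *\<^sub>R u) + s *\<^sub>R w)"
    have "(?\<psi> has_real_derivative ?P ((x + \<xi> *\<^sub>R u) + s *\<^sub>R w)) (at s)" if "0 \<le> s" "s \<le> t" for s
      using inS[of \<xi> t s] \<xi> t that by (intro DERIV_partial dw) auto
    from MVT2[OF t(1) this] obtain \<eta> where \<eta>: "0 < \<eta>" "\<eta> < t"
      "?\<psi> t - ?\<psi> 0 = t * ?P ((x + \<xi> *\<^sub>R u) + \<eta> *\<^sub>R w)" by auto
    have "f (x + t *\<^sub>R u + t *\<^sub>R w) - f (x + t *\<^sub>R u) - f (x + t *\<^sub>R w) + f x = ?\<phi> t - ?\<phi> 0"
      by (simp add: algebra_simps)
    also have "\<dots> = t * (?\<psi> t - ?\<psi> 0)" unfolding \<xi>(3) by (simp add: algebra_simps)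
    also have "\<dots> = t\<^sup>2 * ?P (x + \<xi> *\<^sub>R u + \<eta> *\<^sub>R w)" unfolding \<eta>(3) by (simp add: power2_eq_square)
    finally have "(f (x + t *\<^sub>R u + t *\<^sub>R w) - f (x + t *\<^sub>R u) - f (x + t *\<^sub>R w) + f x) / t\<^sup>2
       = ?P (x + \<xi> *\<^sub>R u + \<eta> *\<^sub>R w)" using t by simp
    moreover have "dist (?P (x + \<xi> *\<^sub>R u + \<eta> *\<^sub>R w)) (?P x) < e"
      using near[of \<xi> t \<eta>] \<xi> \<eta> t by (intro d(2)) auto
    ultimately show ?thesis by simp
  qed
  then show "\<forall>\<^sub>F t in at_right 0. dist ((f (x + t *\<^sub>R u + t *\<^sub>R w) - f (x + t *\<^sub>R u) - f (x + t *\<^sub>R w) + f x) / t\<^sup>2) (?P x) < e"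
    unfolding eventually_at_right_field using m by (intro exI[of _ m]) auto
qed

text \<open>The second difference is symmetric in \<open>u\<close> and \<open>w\<close>, so both
  mixed derivatives are limits of the same quotient.\<close>

lemma partial_commute:
  fixes f :: "'a::real_normed_vector \<Rightarrow> real"
  assumes "open S" "x \<in> S"
    and "\<And>x. x \<in> S \<Longrightarrow> (\<lambda>t. f (x + t *\<^sub>R u)) differentiable (at 0)"
    and "\<And>x. x \<in> S \<Longrightarrow> (\<lambda>t. f (x + t *\<^sub>R w)) differentiable (at 0)"
    and "\<And>x. x \<in> S \<Longrightarrow> (\<lambda>t. partial u f (x + t *\<^sub>R w)) differentiable (at 0)"
    and "\<And>x. x \<in> S \<Longrightarrow> (\<lambda>t. partial w f (x + t *\<^sub>R u)) differentiable (at 0)"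
    and "continuous_on S (partial w (partial u f))" "continuous_on S (partial u (partial w f))"
  shows "partial w (partial u f) x = partial u (partial w f) x"
proof -
  have "((\<lambda>t. (f (x + t *\<^sub>R u + t *\<^sub>R w) - f (x + t *\<^sub>R u) - f (x + t *\<^sub>R w) + f x) / t\<^sup>2)
            \<longlongrightarrow> partial w (partial u f) x) (at_right 0)"
    by (rule second_difference[OF assms(1,2,3,5,7)])
  moreover have "((\<lambda>t. (f (x + t *\<^sub>R w + t *\<^sub>R u) - f (x + t *\<^sub>R w) - f (x + t *\<^sub>R u) + f x) / t\<^sup>2)
            \<longlongrightarrow> partial u (partial w f) x) (at_right 0)"
    by (rule second_difference[OF assms(1,2,4,6,8)])
  ultimately show ?thesis
    by (intro tendsto_unique[OF trivial_limit_at_right_real]) (simp_all add: algebra_simps)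
qed

text \<open>Induction on the length. If the outermost directions \<open>a\<close> and
  \<open>b\<close> differ, the tails can be rearranged so that the other direction comes next, over
  a common rest \<open>cs\<close>, and then two outer derivatives commute. The regularity hypothesis
  speaks of all sub-multisets in every order and so passes to shorter lists.\<close>

lemma partials_permute:
  fixes f :: "'a::real_normed_vector \<Rightarrow> real"
  assumes op: "open S"
    and ex: "\<And>es. mset es \<subseteq># mset ds \<Longrightarrow> partials_exist v S es f \<and> continuous_on S (partials v es f)"
    and perm: "mset ds' = mset ds" and x: "x \<in> S"
  shows "partials v ds' f x = partials v ds f x"
  using ex perm x
proof (induction "length ds" arbitrary: ds ds' x rule: less_induct)
  case less
  show ?case
  proof (cases ds)
    case Nil
    then show ?thesis using less.prems by simp
  next
    case (Cons a as)
    then obtain b bs where ds': "ds' = b # bs" using less.prems(2) by (cases ds') auto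
    have hyp: "partials v es' f y = partials v es f y"
      if "length es < length ds" "mset es \<subseteq># mset ds" "mset es' = mset es" "y \<in> S" for es es' y
    proof (rule less.hyps[OF that(1) _ that(3,4)])
      fix us assume "mset us \<subseteq># mset es"
      then have "mset us \<subseteq># mset ds" using that(2) by (rule subset_mset.order_trans)
      then show "partials_exist v S us f \<and> continuous_on S (partials v us f)" by (rule less.prems(1))
    qed
    show ?thesis
    proof (cases "a = b")
      case True
      then have "mset bs = mset as" using less.prems(2) Cons ds' by simp
      then have "partials v bs f y = partials v as f y" if "y \<in> S" for y
        using that Cons by (intro hyp) auto
      from partial_cong_open(1)[OF op this less.prems(3)] show ?thesis using Cons ds' True by simp
    next
      case False
      have m: "add_mset b (mset bs) = add_mset a (mset as)" using less.prems(2) Cons ds' by simp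
      then obtain K where K: "mset as = add_mset b K" "mset bs = add_mset a K"
        using False by (auto simp: add_eq_conv_ex)
      obtain cs where cs: "mset cs = K" using ex_mset by blast
      let ?g = "partials v cs f"
      have dsm: "mset ds = add_mset a (add_mset b K)" using Cons K by simp
      have len: "length ds = length cs + 2" using arg_cong[OF dsm, of size] cs by auto
      have sub1: "add_mset b K \<subseteq># add_mset a (add_mset b K)"
        using mset_subset_eq_add_left[of "add_mset b K" "{#a#}"] by simp
      have sub2: "add_mset a K \<subseteq># add_mset a (add_mset b K)"
        using mset_subset_eq_add_left[of "add_mset a K" "{#b#}"] by (simp add: add_mset_commute)
      have exi: "partials_exist v S es f \<and> continuous_on S (partials v es f)"
        if "mset es \<subseteq># add_mset a (add_mset b K)" for es using less.prems(1) that dsm by simp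
      have e1: "partials_exist v S (a # b # cs) f" "continuous_on S (partials v (a # b # cs) f)"
        "partials_exist v S (b # a # cs) f" "continuous_on S (partials v (b # a # cs) f)"
        using exi[of "a # b # cs"] exi[of "b # a # cs"] cs by (auto simp: add_mset_commute)
      have "partials v as f y = partials v (b # cs) f y" if "y \<in> S" for y
        by (intro hyp that) (simp_all add: len dsm sub1 cs K)
      from partial_cong_open(1)[OF op this less.prems(3)]
      have 1: "partials v ds f x = partials v (a # b # cs) f x" using Cons by simp
      have "partials v bs f y = partials v (a # cs) f y" if "y \<in> S" for y
        by (intro hyp that) (simp_all add: len dsm sub2 cs K)
      from partial_cong_open(1)[OF op this less.prems(3)]
      have 2: "partials v ds' f x = partials v (b # a # cs) f x" using ds' by simp
      have "partials v (a # b # cs) f x = partials v (b # a # cs) f x"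
        using partial_commute[of S x ?g "v b" "v a"] op less.prems(3) e1 by simp
      then show ?thesis using 1 2 by simp
    qed
  qed
qed

text \<open>Names the order of differentiation that \<open>mi_partial\<close> leaves to
  choice.\<close>

definition mi_list :: "('i \<Rightarrow> nat) \<Rightarrow> 'i list" where
  "mi_list \<alpha> = (SOME ds. \<forall>i. count_list ds i = \<alpha> i)"

lemma count_list_mi_list:
  fixes \<alpha> :: "'i::finite \<Rightarrow> nat"
  shows "count_list (mi_list \<alpha>) i = \<alpha> i"
proof -
  obtain ds where "mset ds = Abs_multiset \<alpha>" using ex_mset by blast
  then have "\<forall>i. count_list ds i = \<alpha> i" using count_mset[of ds] by (simp add: count_Abs_multiset)
  then show ?thesis unfolding mi_list_def by (rule someI2) auto
qed

lemma length_mi_list: "length (mi_list \<alpha>) = mi_order \<alpha>"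
  using sum_count_set[of "mi_list \<alpha>" UNIV] by (simp add: count_list_mi_list mi_order_def)

lemma mi_partial_eq: "mi_partial v \<alpha> f = partials v (mi_list \<alpha>) f"
  by (simp add: mi_partial_def mi_list_def)

lemma mi_list_0: "mi_list (\<lambda>_::'n::finite. 0) = []"
  using length_mi_list[of "\<lambda>_::'n. 0"] by (simp add: mi_order_def)

text \<open>The order chosen for a joint multi-index may interleave the two variables; comparing
  multisets allows them to be separated by permutation.\<close>

lemma mset_mi_list_case_sum:
  fixes \<alpha> \<beta> :: "'n::finite \<Rightarrow> nat"
  shows "mset (mi_list (case_sum \<alpha> \<beta>)) = mset (map Inl (mi_list \<alpha>) @ map Inr (mi_list \<beta>))"
proof (rule multiset_eqI)
  fix d :: "'n + 'n"
  have z: "count_list (map Inr xs) (Inl i) = 0" "count_list (map Inl xs) (Inr i) = 0" for xs :: "'n list" and i :: 'n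
    by (auto simp: count_list_0_iff)
  have s1: "count_list (map Inl xs) (Inl i :: 'n + 'n) = count_list xs i" for xs :: "'n list" and i :: 'n
    by (induction xs) auto
  have s2: "count_list (map Inr xs) (Inr i :: 'n + 'n) = count_list xs i" for xs :: "'n list" and i :: 'n
    by (induction xs) auto
  show "count (mset (mi_list (case_sum \<alpha> \<beta>))) d = count (mset (map Inl (mi_list \<alpha>) @ map Inr (mi_list \<beta>))) d"
    unfolding count_mset by (cases d) (simp_all add: count_list_mi_list z s1 s2 del: mset_append)
qed

text \<open>Lists instead of multi-indices allow derivatives to be added one at a time. Those in the
  second variable are applied before those in the first.\<close>

definition kpart :: "(real ^ 'n::finite \<Rightarrow> real ^ 'n \<Rightarrow> real) \<Rightarrow> 'n list \<Rightarrow> 'n list \<Rightarrow>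
    real ^ 'n \<Rightarrow> real ^ 'n \<Rightarrow> real" where
  "kpart h p q x y = partials kernel_dir (map Inl p @ map Inr q) (\<lambda>(x, y). h x y) (x, y)"

section \<open>Symmetry and positivity of the mixed derivatives of the kernel\<close>

locale bounded_open =
  fixes \<Theta> :: "(real ^ 'n::finite) set"
  assumes op: "open \<Theta>" and bdd: "bounded \<Theta>"

locale Ckk_kernel = bounded_open \<Theta> for \<Theta> :: "(real ^ 'n::finite) set" +
  fixes k :: nat and h :: "real ^ 'n \<Rightarrow> real ^ 'n \<Rightarrow> real"
  assumes Ckk: "h \<in> C_kk k \<Theta>" and pd: "positive_definite_kernel \<Theta> h"
begin

abbreviation H where "H \<equiv> \<lambda>(x, y). h x y"

lemma op2: "open (\<Theta> \<times> \<Theta>)" by (intro open_Times op)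

definition admissible :: "('n + 'n) list \<Rightarrow> bool" where
  "admissible ds \<longleftrightarrow> length (filter isl ds) \<le> k \<and> length (filter (\<lambda>d. \<not> isl d) ds) \<le> k"

lemma admissible_mono:
  assumes "mset es \<subseteq># mset ds" "admissible ds"
  shows "admissible es"
proof -
  have "length (filter P es) \<le> length (filter P ds)" for P
    using size_mset_mono[OF multiset_filter_mono[OF assms(1), of P]] by (metis mset_filter size_mset)
  then show ?thesis using assms(2) order.trans unfolding admissible_def by blast
qed

lemma admissible_kpart: "\<lbrakk>length p \<le> k; length q \<le> k\<rbrakk> \<Longrightarrow> admissible (map Inl p @ map Inr q)"
  by (simp add: admissible_def filter_map o_def)

lemma Ckk_exist: "admissible ds \<Longrightarrow> partials_exist kernel_dir (\<Theta> \<times> \<Theta>) ds H"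
  and Ckk_uc: "admissible ds \<Longrightarrow> uniformly_continuous_on (\<Theta> \<times> \<Theta>) (partials kernel_dir ds H)"
  using Ckk unfolding C_kk_def admissible_def by auto

lemma Ckk_permute:
  assumes "admissible ds" "mset ds' = mset ds" "z \<in> \<Theta> \<times> \<Theta>"
  shows "partials kernel_dir ds' H z = partials kernel_dir ds H z"
  using admissible_mono[OF _ assms(1)] Ckk_exist Ckk_uc uniformly_continuous_imp_continuous
  by (intro partials_permute[OF op2 _ assms(2,3)]) blast

lemma h_sym: "\<lbrakk>x \<in> \<Theta>; y \<in> \<Theta>\<rbrakk> \<Longrightarrow> h x y = h y x"
  using pd by (auto simp: positive_definite_kernel_def)

text \<open>Symmetry makes \<open>H\<close> invariant under exchange of the variables, and the
  exchange maps the direction \<open>Inl i\<close> to \<open>Inr i\<close> and conversely.\<close>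

lemma partials_swap:
  "z \<in> \<Theta> \<times> \<Theta> \<Longrightarrow> partials kernel_dir ds H z = partials kernel_dir (map (case_sum Inr Inl) ds) H (prod.swap z)"
proof (induction ds arbitrary: z)
  case Nil
  then show ?case using h_sym by auto
next
  case (Cons d ds)
  have d: "prod.swap (kernel_dir d) = kernel_dir (case_sum Inr Inl d)"
    by (cases d) (auto simp: kernel_dir_def)
  have s: "prod.swap (z + t *\<^sub>R kernel_dir d) = prod.swap z + t *\<^sub>R kernel_dir (case_sum Inr Inl d)" for t
    unfolding d[symmetric] by (cases z, cases "kernel_dir d") simp
  have "partial (kernel_dir d) (partials kernel_dir ds H) z =
        partial (kernel_dir d) (\<lambda>z. partials kernel_dir (map (case_sum Inr Inl) ds) H (prod.swap z)) z"
    by (rule partial_cong_open(1)[OF op2 Cons.IH Cons.prems])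
  then show ?case by (simp add: partial_def s)
qed

lemma kpart_sym:
  assumes "length p \<le> k" "length q \<le> k" "x \<in> \<Theta>" "y \<in> \<Theta>"
  shows "kpart h p q x y = kpart h q p y x"
proof -
  have "kpart h p q x y = partials kernel_dir (map Inr p @ map Inl q) H (y, x)"
    using partials_swap[of "(x, y)" "map Inl p @ map Inr q"] assms by (simp add: kpart_def o_def)
  also have "\<dots> = kpart h q p y x"
    unfolding kpart_def using assms by (intro Ckk_permute admissible_kpart) auto
  finally show ?thesis .
qed

lemma mixed_partial_kpart:
  assumes "mi_order \<alpha> \<le> k" "mi_order \<beta> \<le> k" "x \<in> \<Theta>" "y \<in> \<Theta>"
  shows "mixed_partial \<alpha> \<beta> h x y = kpart h (mi_list \<alpha>) (mi_list \<beta>) x y"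
  unfolding mixed_partial_def mi_partial_eq kpart_def using assms
  by (intro Ckk_permute admissible_kpart mset_mi_list_case_sum) (auto simp: length_mi_list)

text \<open>A triple (c, p, x) stands for the functional that sends f to c times its derivative
  along p at x. This is the pairing that the kernel induces on such functionals;
  \<open>kquad\<close> is the quadratic form on a list of them, in which repetitions are
  allowed.\<close>

definition kform :: "real \<times> 'n list \<times> (real ^ 'n) \<Rightarrow> real \<times> 'n list \<times> (real ^ 'n) \<Rightarrow> real" where
  "kform a b = fst a * fst b * kpart h (fst (snd a)) (fst (snd b)) (snd (snd a)) (snd (snd b))"

definition kquad :: "(real \<times> 'n list \<times> (real ^ 'n)) list \<Rightarrow> real" where
  "kquad xs = (\<Sum>a\<leftarrow>xs. \<Sum>b\<leftarrow>xs. kform a b)"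

lemma sum_list_map_mset: "mset xs = mset ys \<Longrightarrow> (\<Sum>a\<leftarrow>xs. f a) = (\<Sum>a\<leftarrow>ys. f a :: 'b::comm_monoid_add)"
  by (metis mset_map sum_mset_sum_list)

lemma kquad_perm:
  assumes "mset xs = mset ys"
  shows "kquad xs = kquad ys"
  unfolding kquad_def sum_list_map_mset[OF assms] ..

lemma kquad_Cons: "kquad (a # ys) = kform a a + (\<Sum>y\<leftarrow>ys. kform a y) + (\<Sum>y\<leftarrow>ys. kform y a) + kquad ys"
  by (simp add: kquad_def sum_list_addf)

lemma kpart_deriv_left:
  assumes "length p < k" "length q \<le> k" "x \<in> \<Theta>" "y \<in> \<Theta>"
  shows "((\<lambda>t. (kpart h p q (x + t *\<^sub>R dir d) y - kpart h p q x y) / t) \<longlongrightarrow> kpart h (d # p) q x y) (at_right 0)"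
proof -
  have "partials_exist kernel_dir (\<Theta> \<times> \<Theta>) (Inl d # map Inl p @ map Inr q) H"
    using Ckk_exist[OF admissible_kpart[of "d # p" q]] assms by simp
  then have "(\<lambda>t. partials kernel_dir (map Inl p @ map Inr q) H (((x, y) + 0 *\<^sub>R kernel_dir (Inl d)) + t *\<^sub>R kernel_dir (Inl d))) differentiable at 0"
    using assms by simp
  from DERIV_partial[OF this]
  have "((\<lambda>t. (kpart h p q (x + t *\<^sub>R dir d) y - kpart h p q x y) / t) \<longlongrightarrow> kpart h (d # p) q x y) (at 0)"
    by (simp add: DERIV_def kpart_def kernel_dir_def)
  then show ?thesis by (rule tendsto_mono[OF at_le, rotated]) simp
qed

text \<open>The new derivative does not stand outermost in \<open>kpart\<close>, so it is moved to
  the first variable by symmetry.\<close>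

lemma kpart_deriv_right:
  assumes "length p \<le> k" "length q < k" "x \<in> \<Theta>" "y \<in> \<Theta>"
  shows "((\<lambda>t. (kpart h p q x (y + t *\<^sub>R dir d) - kpart h p q x y) / t) \<longlongrightarrow> kpart h p (d # q) x y) (at_right 0)"
proof -
  have ev: "\<forall>\<^sub>F t in at_right 0. y + t *\<^sub>R dir d \<in> \<Theta>"
  proof -
    have "((\<lambda>t. y + t *\<^sub>R dir d) \<longlongrightarrow> y + 0 *\<^sub>R dir d) (at_right 0)" by (intro tendsto_intros)
    then show ?thesis using op assms(4) topological_tendstoD[of _ y] by simp
  qed
  have "((\<lambda>t. (kpart h q p (y + t *\<^sub>R dir d) x - kpart h q p y x) / t) \<longlongrightarrow> kpart h p (d # q) x y) (at_right 0)"
    using kpart_deriv_left[of q p y x d] kpart_sym[of p "d # q" x y] assms by simp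
  then show ?thesis
    by (rule Lim_transform_eventually) (use ev assms kpart_sym[of p q x] in \<open>auto elim!: eventually_mono\<close>)
qed

text \<open>Pairing a difference quotient with itself moves both points at once, which the two
  one-sided statements do not cover; on the diagonal it is a second difference along the two kernel
  directions.\<close>

lemma kpart_deriv_both:
  assumes "length p < k" "x \<in> \<Theta>"
  shows "((\<lambda>t. (kpart h p p (x + t *\<^sub>R dir d) (x + t *\<^sub>R dir d) - kpart h p p (x + t *\<^sub>R dir d) x
     - kpart h p p x (x + t *\<^sub>R dir d) + kpart h p p x x) / t\<^sup>2) \<longlongrightarrow> kpart h (d # p) (d # p) x x) (at_right 0)"
proof -
  let ?f = "partials kernel_dir (map Inl p @ map Inr p) H"
  let ?ds = "Inr d # Inl d # map Inl p @ map Inr p"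
  have ad: "admissible (map Inl (d # p) @ map Inr (d # p))" using assms by (intro admissible_kpart) auto
  have m: "mset ?ds = mset (map Inl (d # p) @ map Inr (d # p))" by simp
  have ad': "admissible ?ds" using admissible_mono[OF _ ad, of ?ds] m by simp
  have "((\<lambda>t. (?f ((x, x) + t *\<^sub>R kernel_dir (Inl d) + t *\<^sub>R kernel_dir (Inr d)) - ?f ((x, x) + t *\<^sub>R kernel_dir (Inl d))
      - ?f ((x, x) + t *\<^sub>R kernel_dir (Inr d)) + ?f (x, x)) / t\<^sup>2)
      \<longlongrightarrow> partial (kernel_dir (Inr d)) (partial (kernel_dir (Inl d)) ?f) (x, x)) (at_right 0)"
    using Ckk_exist[OF ad'] uniformly_continuous_imp_continuous[OF Ckk_uc[OF ad']] assms
    by (intro second_difference[OF op2]) auto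
  moreover have "partial (kernel_dir (Inr d)) (partial (kernel_dir (Inl d)) ?f) (x, x) = kpart h (d # p) (d # p) x x"
    using Ckk_permute[OF ad m, of "(x, x)"] assms by (simp add: kpart_def)
  ultimately show ?thesis by (simp add: kpart_def kernel_dir_def)
qed

text \<open>Replacing a derivative by a difference quotient trades one functional of order \<open>m + 1\<close> for
  two of order \<open>m\<close>, so that the sum of the numbers \<open>3 ^ m\<close> decreases.\<close>

lemma kquad_nonneg:
  assumes "\<And>a. a \<in> set xs \<Longrightarrow> length (fst (snd a)) \<le> k \<and> snd (snd a) \<in> \<Theta>"
  shows "0 \<le> kquad xs"
  using assms
proof (induction "\<Sum>a\<leftarrow>xs. 3 ^ length (fst (snd a)) :: nat" arbitrary: xs rule: less_induct)
  case less
  show ?case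
  proof (cases "\<forall>a\<in>set xs. fst (snd a) = []")
    case True
    \<comment> \<open>All functionals are multiples of point evaluations, so \<open>kquad\<close> is
      the double sum from the definition of positive definiteness.\<close>
    let ?n = "length xs" and ?c = "\<lambda>i. fst (xs ! i)" and ?x = "\<lambda>i. snd (snd (xs ! i))"
    have f: "kform (xs ! i) (xs ! j) = ?c i * h (?x i) (?x j) * ?c j" if "i < ?n" "j < ?n" for i j
      using True that by (simp add: kform_def kpart_def)
    have "kquad xs = (\<Sum>i<?n. \<Sum>j<?n. ?c i * h (?x i) (?x j) * ?c j)"
      using f by (simp add: kquad_def sum_list_sum_nth atLeast0LessThan)
    also have "\<dots> \<ge> 0" using pd less.prems unfolding positive_definite_kernel_def by auto
    finally show ?thesis .
  next
    case False
    then obtain a where "a \<in> set xs" "fst (snd a) \<noteq> []" by blast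
    then obtain c d p x where a: "a = (c, d # p, x)" by (metis neq_Nil_conv prod.collapse)
    obtain ys where ys: "mset xs = mset (a # ys)"
      using \<open>a \<in> set xs\<close> by (metis in_set_conv_decomp mset.simps(2) mset_append union_mset_add_mset_right)
    have seteq: "set xs = set (a # ys)" using ys mset_eq_setD by blast
    have pk: "length p < k" "x \<in> \<Theta>" using less.prems[OF \<open>a \<in> set xs\<close>] a by auto
    have yk: "length (fst (snd y)) \<le> k" "snd (snd y) \<in> \<Theta>" if "y \<in> set ys" for y
      using less.prems[of y] that seteq by auto
    \<comment> \<open>Two functionals with one derivative less, whose sum is the difference quotient
      that tends to the functional \<open>a\<close>.\<close>
    let ?a1 = "\<lambda>t. (c / t, p, x + t *\<^sub>R dir d)" and ?a2 = "\<lambda>t. (- c / t, p, x)"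
    have ev: "\<forall>\<^sub>F t in at_right 0. x + t *\<^sub>R dir d \<in> \<Theta>"
    proof -
      have "((\<lambda>t. x + t *\<^sub>R dir d) \<longlongrightarrow> x + 0 *\<^sub>R dir d) (at_right 0)" by (intro tendsto_intros)
      then show ?thesis using op pk(2) topological_tendstoD[of _ x] by simp
    qed
    have pos: "\<forall>\<^sub>F t in at_right 0. 0 \<le> kquad (?a1 t # ?a2 t # ys)"
      using ev
    proof eventually_elim
      case (elim t)
      have "(\<Sum>a\<leftarrow>xs. 3 ^ length (fst (snd a)) :: nat) = (\<Sum>a\<leftarrow>a # ys. 3 ^ length (fst (snd a)))"
        by (rule sum_list_map_mset[OF ys])
      then show ?case using elim pk yk by (intro less.hyps) (auto simp: a)
    qed
    have s1: "((\<lambda>t. \<Sum>y\<leftarrow>ys. kform (?a1 t) y + kform (?a2 t) y) \<longlongrightarrow> (\<Sum>y\<leftarrow>ys. kform a y)) (at_right 0)"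
      using yk
    proof (induction ys)
      case (Cons y ys)
      have "((\<lambda>t. c * fst y * ((kpart h p (fst (snd y)) (x + t *\<^sub>R dir d) (snd (snd y)) - kpart h p (fst (snd y)) x (snd (snd y))) / t))
         \<longlongrightarrow> c * fst y * kpart h (d # p) (fst (snd y)) x (snd (snd y))) (at_right 0)"
        using Cons.prems pk by (intro tendsto_mult tendsto_const kpart_deriv_left) auto
      then have "((\<lambda>t. kform (?a1 t) y + kform (?a2 t) y) \<longlongrightarrow> kform a y) (at_right 0)"
        by (simp add: kform_def a diff_divide_distrib algebra_simps)
      then show ?case using Cons by (auto intro: tendsto_add)
    qed simp
    have s2: "((\<lambda>t. \<Sum>y\<leftarrow>ys. kform y (?a1 t) + kform y (?a2 t)) \<longlongrightarrow> (\<Sum>y\<leftarrow>ys. kform y a)) (at_right 0)"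
      using yk
    proof (induction ys)
      case (Cons y ys)
      have "((\<lambda>t. c * fst y * ((kpart h (fst (snd y)) p (snd (snd y)) (x + t *\<^sub>R dir d) - kpart h (fst (snd y)) p (snd (snd y)) x) / t))
         \<longlongrightarrow> c * fst y * kpart h (fst (snd y)) (d # p) (snd (snd y)) x) (at_right 0)"
        using Cons.prems pk by (intro tendsto_mult tendsto_const kpart_deriv_right) auto
      then have "((\<lambda>t. kform y (?a1 t) + kform y (?a2 t)) \<longlongrightarrow> kform y a) (at_right 0)"
        by (simp add: kform_def a diff_divide_distrib algebra_simps)
      then show ?case using Cons by (auto intro: tendsto_add)
    qed simp
    \<comment> \<open>The four pairings of the difference quotient with itself add up to a second
      difference divided by the square of \<open>t\<close>.\<close>
    have s3: "((\<lambda>t. kform (?a1 t) (?a1 t) + kform (?a1 t) (?a2 t) + kform (?a2 t) (?a1 t) + kform (?a2 t) (?a2 t))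
       \<longlongrightarrow> kform a a) (at_right 0)"
    proof -
      have "((\<lambda>t. c\<^sup>2 * ((kpart h p p (x + t *\<^sub>R dir d) (x + t *\<^sub>R dir d) - kpart h p p (x + t *\<^sub>R dir d) x
        - kpart h p p x (x + t *\<^sub>R dir d) + kpart h p p x x) / t\<^sup>2)) \<longlongrightarrow> c\<^sup>2 * kpart h (d # p) (d # p) x x) (at_right 0)"
        using pk by (intro tendsto_mult tendsto_const kpart_deriv_both) auto
      then show ?thesis
        by (simp add: kform_def a diff_divide_distrib add_divide_distrib power2_eq_square algebra_simps)
    qed
    have "kquad (?a1 t # ?a2 t # ys) =
      (kform (?a1 t) (?a1 t) + kform (?a1 t) (?a2 t) + kform (?a2 t) (?a1 t) + kform (?a2 t) (?a2 t))
      + (\<Sum>y\<leftarrow>ys. kform (?a1 t) y + kform (?a2 t) y) + (\<Sum>y\<leftarrow>ys. kform y (?a1 t) + kform y (?a2 t)) + kquad ys" for t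
      by (simp add: kquad_Cons sum_list_addf)
    moreover have "kquad xs = kform a a + (\<Sum>y\<leftarrow>ys. kform a y) + (\<Sum>y\<leftarrow>ys. kform y a) + kquad ys"
      unfolding kquad_perm[OF ys] kquad_Cons ..
    ultimately have "((\<lambda>t. kquad (?a1 t # ?a2 t # ys)) \<longlongrightarrow> kquad xs) (at_right 0)"
      using tendsto_add[OF tendsto_add[OF tendsto_add[OF s3 s1] s2] tendsto_const[of "kquad ys"]] by simp
    then show ?thesis by (rule tendsto_lowerbound[OF _ pos]) simp
  qed
qed

definition \<kappa> :: "('n \<Rightarrow> nat) \<Rightarrow> ('n \<Rightarrow> nat) \<Rightarrow> real ^ 'n \<Rightarrow> real ^ 'n \<Rightarrow> real" where
  "\<kappa> \<alpha> \<beta> = mixed_partial \<alpha> \<beta> h"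

definition I :: "('n \<Rightarrow> nat) set" where "I = {\<alpha>. mi_order \<alpha> \<le> k}"

lemma zero_in_I [simp]: "(\<lambda>_. 0) \<in> I" by (simp add: I_def mi_order_def)

lemma \<kappa>_kpart: "\<lbrakk>\<alpha> \<in> I; \<beta> \<in> I; x \<in> \<Theta>; y \<in> \<Theta>\<rbrakk> \<Longrightarrow> \<kappa> \<alpha> \<beta> x y = kpart h (mi_list \<alpha>) (mi_list \<beta>) x y"
  by (simp add: \<kappa>_def I_def mixed_partial_kpart)

lemma \<kappa>_sym: "\<lbrakk>\<alpha> \<in> I; \<beta> \<in> I; x \<in> \<Theta>; y \<in> \<Theta>\<rbrakk> \<Longrightarrow> \<kappa> \<alpha> \<beta> x y = \<kappa> \<beta> \<alpha> y x"
  by (simp add: \<kappa>_kpart) (rule kpart_sym, auto simp: length_mi_list I_def)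

lemma \<kappa>_uc: "\<lbrakk>\<alpha> \<in> I; \<beta> \<in> I\<rbrakk> \<Longrightarrow> uniformly_continuous_on (\<Theta> \<times> \<Theta>) (\<lambda>z. \<kappa> \<alpha> \<beta> (fst z) (snd z))"
proof -
  assume a: "\<alpha> \<in> I" "\<beta> \<in> I"
  have "uniformly_continuous_on (\<Theta> \<times> \<Theta>) (partials kernel_dir (map Inl (mi_list \<alpha>) @ map Inr (mi_list \<beta>)) H)"
    using a by (intro Ckk_uc admissible_kpart) (auto simp: length_mi_list I_def)
  then show ?thesis
    unfolding uniformly_continuous_on_def using a by (auto simp: \<kappa>_kpart kpart_def)
qed

lemma \<kappa>_00: "\<lbrakk>x \<in> \<Theta>; y \<in> \<Theta>\<rbrakk> \<Longrightarrow> \<kappa> (\<lambda>_. 0) (\<lambda>_. 0) x y = h x y"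
  by (simp add: \<kappa>_kpart kpart_def mi_list_0)

lemma \<kappa>_pd:
  assumes "finite A" "A \<subseteq> I \<times> \<Theta>"
  shows "0 \<le> (\<Sum>a\<in>A. \<Sum>b\<in>A. c a * c b * \<kappa> (fst a) (fst b) (snd a) (snd b))"
proof -
  obtain xs where xs: "set xs = A" "distinct xs" using assms(1) finite_distinct_list by blast
  let ?t = "\<lambda>a. (c a, mi_list (fst a), snd a)"
  have "0 \<le> kquad (map ?t xs)"
    by (rule kquad_nonneg) (use assms xs in \<open>auto simp: length_mi_list I_def\<close>)
  also have "kquad (map ?t xs) = (\<Sum>a\<in>A. \<Sum>b\<in>A. kform (?t a) (?t b))"
    by (simp add: kquad_def o_def sum_list_distinct_conv_sum_set[OF xs(2)] xs(1))
  also have "\<dots> = (\<Sum>a\<in>A. \<Sum>b\<in>A. c a * c b * \<kappa> (fst a) (fst b) (snd a) (snd b))"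
    using assms(2) by (intro sum.cong refl) (auto simp: kform_def \<kappa>_kpart subset_iff)
  finally show ?thesis .
qed

end

section \<open>Weak derivatives\<close>

lemma partials_exist_append:
  "partials_exist v S (ds @ es) f \<longleftrightarrow> partials_exist v S es f \<and> partials_exist v S ds (partials v es f)"
  by (induction ds) (auto simp: partials_append)

text \<open>The extension is continuous because \<open>\<Theta>\<close> and \<open>- K\<close> are
  open, cover the space, and each carries a continuous formula for it. It moves integrals over the
  domain to a translation invariant measure on the whole space.\<close>

lemma compact_support_extension:
  fixes g :: "real ^ 'n::finite \<Rightarrow> real"
  assumes op: "open \<Theta>" and g: "continuous_on \<Theta> g" and K: "compact K" "K \<subseteq> \<Theta>"
    and 0: "\<And>x. x \<in> \<Theta> - K \<Longrightarrow> g x = 0"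
  defines "G \<equiv> \<lambda>x. if x \<in> K then g x else 0"
  shows "continuous_on UNIV G" "integrable lborel G" "integrable (lebesgue_on \<Theta>) g"
    "(\<integral>x. g x \<partial>lebesgue_on \<Theta>) = (\<integral>x. G x \<partial>lborel)"
proof -
  have "continuous_on (\<Theta> \<union> - K) G"
  proof (rule continuous_on_open_Un)
    show "continuous_on \<Theta> G" by (rule continuous_on_eq[OF g]) (use 0 in \<open>auto simp: G_def\<close>)
    show "continuous_on (- K) G" by (rule continuous_on_eq[of _ "\<lambda>x. 0"]) (auto simp: G_def)
  qed (use op K compact_imp_closed in auto)
  moreover have "\<Theta> \<union> - K = UNIV" using K by auto
  ultimately show cont: "continuous_on UNIV G" by simp
  have "integrable lborel (\<lambda>x. indicator K x *\<^sub>R g x)"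
    using K g by (intro borel_integrable_compact) (auto intro: continuous_on_subset)
  moreover have "(\<lambda>x. indicator K x *\<^sub>R g x) = G" by (auto simp: G_def)
  ultimately show int: "integrable lborel G" by simp
  have m: "\<Theta> \<in> sets lebesgue" using op by (simp add: borel_open)
  have GG: "(\<lambda>x. if x \<in> \<Theta> then g x else 0) = G" using K 0 by (auto simp: G_def fun_eq_iff)
  have "integrable lebesgue G" using int by (rule integrable_completion[THEN iffD2, rotated]) (use int in auto)
  then show "integrable (lebesgue_on \<Theta>) g" using Lebesgue_Measure.integrable_restrict_UNIV[OF m, of g] by (simp add: GG)
  have "(\<integral>x. g x \<partial>lebesgue_on \<Theta>) = (\<integral>x. G x \<partial>lebesgue)"
    using Lebesgue_Measure.integral_restrict_UNIV[OF m, of g] by (simp add: GG)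
  also have "\<dots> = (\<integral>x. G x \<partial>lborel)" using int by (intro integral_completion) auto
  finally show "(\<integral>x. g x \<partial>lebesgue_on \<Theta>) = (\<integral>x. G x \<partial>lborel)" .
qed

text \<open>By translation invariance the difference quotients of \<open>p\<close> have integral \<open>0\<close>.\<close>

lemma integral_directional_derivative_0:
  fixes p q :: "real ^ 'n::finite \<Rightarrow> real"
  assumes D: "\<And>x. ((\<lambda>t. p (x + t *\<^sub>R u)) has_real_derivative q x) (at 0)"
    and p: "continuous_on UNIV p" and q: "continuous_on UNIV q"
    and K: "compact K" and p0: "\<And>x. x \<notin> K \<Longrightarrow> p x = 0" and q0: "\<And>x. x \<notin> K \<Longrightarrow> q x = 0"
  shows "(\<integral>x. q x \<partial>lborel) = 0"
proof -
  have [measurable]: "p \<in> borel_measurable borel" "q \<in> borel_measurable borel"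
    using p q by (auto intro: borel_measurable_continuous_onI)
  have "compact (q ` K)" using K q by (meson compact_continuous_image continuous_on_subset subset_UNIV)
  then obtain C where C: "C > 0" "\<And>x. x \<in> K \<Longrightarrow> \<bar>q x\<bar> \<le> C"
    using bounded_pos[of "q ` K"] compact_imp_bounded by auto
  have qC: "\<bar>q x\<bar> \<le> C" for x using C q0[of x] by (cases "x \<in> K") auto
  obtain R where R: "\<And>x. x \<in> K \<Longrightarrow> norm x \<le> R"
    using compact_imp_bounded[OF K] unfolding bounded_iff by auto
  have pint: "integrable lborel p"
  proof -
    have "(\<lambda>x. if x \<in> K then p x else 0) = p" using p0 by auto
    then show ?thesis using compact_support_extension(2)[OF open_UNIV p K] p0 by simp
  qed
  define t where "t = (\<lambda>m. inverse (real (Suc m)))"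
  have t: "0 < t m" "t m \<le> 1" for m by (auto simp: t_def inverse_le_1_iff)
  define Dq where "Dq = (\<lambda>m x. (p (x + t m *\<^sub>R u) - p x) / t m)"
  have [measurable]: "Dq m \<in> borel_measurable borel" for m unfolding Dq_def by measurable
  have D': "((\<lambda>t. p (x + t *\<^sub>R u)) has_real_derivative q (x + s *\<^sub>R u)) (at s)" for x s
  proof -
    have "((\<lambda>t. p (x + (t + s) *\<^sub>R u)) has_real_derivative q (x + s *\<^sub>R u)) (at 0)"
      using D[of "x + s *\<^sub>R u"] by (simp add: algebra_simps)
    then show ?thesis using DERIV_shift[of "\<lambda>t. p (x + t *\<^sub>R u)" _ 0 s] by simp
  qed
  \<comment> \<open>Inside the ball the mean value theorem applies. Outside it both \<open>x\<close>
    and the shifted point miss \<open>K\<close>, because \<open>t m\<close> is at most 1.\<close>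
  have bound: "norm (Dq m x) \<le> indicator (cball 0 (R + norm u)) x * C" for m x
  proof (cases "x \<in> cball 0 (R + norm u)")
    case True
    obtain \<xi> where "p (x + t m *\<^sub>R u) - p (x + 0 *\<^sub>R u) = (t m - 0) * q (x + \<xi> *\<^sub>R u)"
      using MVT2[OF t(1)[of m] D'] by blast
    then have "Dq m x = q (x + \<xi> *\<^sub>R u)" using t(1)[of m] by (simp add: Dq_def)
    then show ?thesis using True qC by simp
  next
    case False
    then have n: "norm x > R + norm u" by simp
    have "norm (t m *\<^sub>R u) \<le> norm u" using t[of m] by (simp add: mult_left_le_one_le)
    then have "norm (x + t m *\<^sub>R u) > R" using n norm_triangle_ineq2[of x "- (t m *\<^sub>R u)"] by simp
    then have "p (x + t m *\<^sub>R u) = 0" using R p0 by (meson not_le)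
    moreover have "p x = 0" using R p0 n norm_ge_zero[of u] by (smt (verit))
    ultimately show ?thesis using C(1) by (simp add: Dq_def indicator_def)
  qed
  have "(\<lambda>m. \<integral>x. Dq m x \<partial>lborel) \<longlonglongrightarrow> (\<integral>x. q x \<partial>lborel)"
  proof (rule integral_dominated_convergence[where w = "\<lambda>x. indicator (cball 0 (R + norm u)) x * C"])
    show "integrable lborel (\<lambda>x::real ^ 'n. indicator (cball 0 (R + norm u)) x * C)"
      using emeasure_lborel_cball_finite[of "0 :: real ^ 'n" "R + norm u"]
      by (intro integrable_mult_left) (simp add: integrable_indicator_iff less_top[symmetric])
    have "filterlim t (at 0) sequentially"
      unfolding t_def filterlim_at using LIMSEQ_inverse_real_of_nat by auto
    then have "(\<lambda>m. Dq m x) \<longlonglongrightarrow> q x" for x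
      using filterlim_compose[OF D[of x, unfolded DERIV_def, simplified]] by (simp add: Dq_def)
    then show "AE x in lborel. (\<lambda>m. Dq m x) \<longlonglongrightarrow> q x" by simp
  qed (use bound in auto)
  moreover have "(\<integral>x. Dq m x \<partial>lborel) = 0" for m
  proof -
    have "integrable (distr lborel borel ((+) (t m *\<^sub>R u))) p" unfolding lborel_distr_plus by (rule pint)
    then have i: "integrable lborel (\<lambda>x. p (t m *\<^sub>R u + x))" by (subst (asm) integrable_distr_eq) auto
    have "(\<integral>x. p x \<partial>lborel) = (\<integral>x. p x \<partial>distr lborel borel ((+) (t m *\<^sub>R u)))" by (simp only: lborel_distr_plus)
    also have "\<dots> = (\<integral>x. p (t m *\<^sub>R u + x) \<partial>lborel)" by (rule integral_distr) auto
    finally show ?thesis using i pint by (simp add: Dq_def add.commute)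
  qed
  ultimately show ?thesis by (simp add: LIMSEQ_const_iff)
qed

text \<open>The product of \<open>f\<close> and \<open>\<phi>\<close>, extended by 0, is compactly
  supported, so its directional derivative has integral 0, and the product rule splits this
  integral.\<close>

lemma integration_by_parts_step:
  fixes f \<phi> :: "real ^ 'n::finite \<Rightarrow> real"
  assumes op: "open \<Theta>"
    and f: "\<And>x. x \<in> \<Theta> \<Longrightarrow> (\<lambda>t. f (x + t *\<^sub>R u)) differentiable (at 0)"
      "continuous_on \<Theta> f" "continuous_on \<Theta> (partial u f)"
    and \<phi>: "\<And>x. (\<lambda>t. \<phi> (x + t *\<^sub>R u)) differentiable (at 0)"
      "continuous_on UNIV \<phi>" "continuous_on UNIV (partial u \<phi>)"
    and K: "compact K" "K \<subseteq> \<Theta>" and \<phi>0: "\<And>x. x \<notin> K \<Longrightarrow> \<phi> x = 0"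
  shows "(\<integral>x. f x * partial u \<phi> x \<partial>lebesgue_on \<Theta>) = - (\<integral>x. partial u f x * \<phi> x \<partial>lebesgue_on \<Theta>)"
proof -
  have opK: "open (- K)" using K compact_imp_closed by blast
  have d\<phi>0: "partial u \<phi> x = 0" if "x \<notin> K" for x
    using partial_cong_open(1)[OF opK, of \<phi> "\<lambda>x. 0" x u] \<phi>0 that by (simp add: partial_def)
  have c\<phi>: "continuous_on \<Theta> \<phi>" "continuous_on \<Theta> (partial u \<phi>)"
    using \<phi> by (auto intro: continuous_on_subset)
  let ?g1 = "\<lambda>x. f x * partial u \<phi> x" and ?g2 = "\<lambda>x. partial u f x * \<phi> x"
  let ?q = "\<lambda>x. if x \<in> K then ?g1 x + ?g2 x else 0" and ?p = "\<lambda>x. if x \<in> K then f x * \<phi> x else 0"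
  note E1 = compact_support_extension[OF op _ K, of ?g1]
  note E2 = compact_support_extension[OF op _ K, of ?g2]
  have cq: "continuous_on UNIV ?q"
    by (rule compact_support_extension(1)[OF op _ K]) (use f c\<phi> \<phi>0 d\<phi>0 in \<open>auto intro!: continuous_intros\<close>)
  have cp: "continuous_on UNIV ?p"
    by (rule compact_support_extension(1)[OF op _ K]) (use f c\<phi> \<phi>0 in \<open>auto intro!: continuous_intros\<close>)
  have D: "((\<lambda>t. ?p (x + t *\<^sub>R u)) has_real_derivative ?q x) (at 0)" for x
  proof (cases "x \<in> \<Theta>")
    case True
    note ev = eventually_line_in_open[OF op True, of u]
    have e: "\<forall>\<^sub>F t in nhds 0. f (x + t *\<^sub>R u) * \<phi> (x + t *\<^sub>R u) = ?p (x + t *\<^sub>R u)"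
      using ev by eventually_elim (use \<phi>0 in auto)
    have "((\<lambda>t. f (x + t *\<^sub>R u) * \<phi> (x + t *\<^sub>R u)) has_real_derivative
       partial u f x * \<phi> x + partial u \<phi> x * f x) (at 0)"
      using DERIV_mult[OF DERIV_partial[of f x 0 u] DERIV_partial[of \<phi> x 0 u]] f(1)[OF True] \<phi>(1)[of x] by simp
    moreover have "partial u f x * \<phi> x + partial u \<phi> x * f x = ?q x"
      using \<phi>0[of x] d\<phi>0[of x] by simp
    ultimately show ?thesis using DERIV_cong_ev[OF refl e refl] by simp
  next
    case False
    then have x: "x \<in> - K" using K by auto
    have "\<forall>\<^sub>F t in nhds 0. x + t *\<^sub>R u \<in> - K" by (rule eventually_line_in_open[OF opK x])
    then have e: "\<forall>\<^sub>F t in nhds 0. (\<lambda>t. 0) t = ?p (x + t *\<^sub>R u)" by eventually_elim auto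
    show ?thesis using DERIV_cong_ev[OF refl e refl, of 0] x by simp
  qed
  have "(\<integral>x. ?q x \<partial>lborel) = 0"
    by (rule integral_directional_derivative_0[OF D cp cq K(1)]) auto
  moreover have "(\<integral>x. ?q x \<partial>lborel) = (\<integral>x. ?g1 x + ?g2 x \<partial>lebesgue_on \<Theta>)"
    by (rule compact_support_extension(4)[OF op _ K, symmetric])
       (use f c\<phi> \<phi>0 d\<phi>0 in \<open>auto intro!: continuous_intros\<close>)
  moreover have "integrable (lebesgue_on \<Theta>) ?g1" "integrable (lebesgue_on \<Theta>) ?g2"
    by (rule E1(3) E2(3); use f c\<phi> \<phi>0 d\<phi>0 in \<open>auto intro!: continuous_intros\<close>)+
  ultimately show ?thesis by simp
qed

lemma partials_zero: "partials v ds (\<lambda>x. 0) = (\<lambda>x. 0)"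
  by (induction ds) (auto simp: partial_def)

lemma test_function_partials:
  assumes "test_function \<Theta> \<phi>"
  obtains K where "compact K" "K \<subseteq> \<Theta>" "\<And>ds x. x \<notin> K \<Longrightarrow> partials dir ds \<phi> x = 0"
    "\<And>ds. continuous_on UNIV (partials dir ds \<phi>)" "\<And>ds. partials_exist dir UNIV ds \<phi>"
proof
  let ?K = "closure {x. \<phi> x \<noteq> 0}"
  show "compact ?K" "?K \<subseteq> \<Theta>" using assms by (auto simp: test_function_def)
  have z: "\<phi> y = 0" if "y \<in> - ?K" for y
    using that closure_subset[of "{x. \<phi> x \<noteq> 0}"] by auto
  show "partials dir ds \<phi> x = 0" if "x \<notin> ?K" for ds x
  proof -
    have "partials dir ds \<phi> x = partials dir ds (\<lambda>x. 0) x"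
    proof (rule partials_cong_open)
      show "open (- ?K)" by (rule open_Compl[OF closed_closure])
      show "x \<in> - ?K" using that by blast
    qed (rule z)
    then show ?thesis by (simp add: partials_zero)
  qed
  show "continuous_on UNIV (partials dir ds \<phi>)" "partials_exist dir UNIV ds \<phi>" for ds
    using assms unfolding test_function_def by blast+
qed

text \<open>Each step takes the outermost derivative off \<open>\<phi>\<close> and makes it the
  innermost one on \<open>f\<close>, which reverses the list.\<close>

lemma integration_by_parts:
  fixes f :: "real ^ 'n::finite \<Rightarrow> real"
  assumes op: "open \<Theta>" and \<phi>: "test_function \<Theta> \<phi>"
    and f: "\<And>es. length es \<le> length ds \<Longrightarrow> partials_exist dir \<Theta> es f \<and> continuous_on \<Theta> (partials dir es f)"
  shows "(\<integral>x. f x * partials dir ds \<phi> x \<partial>lebesgue_on \<Theta>) =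
     (- 1) ^ length ds * (\<integral>x. partials dir (rev ds) f x * \<phi> x \<partial>lebesgue_on \<Theta>)"
  using f
proof (induction ds arbitrary: f)
  case (Cons d ds)
  obtain K where K: "compact K" "K \<subseteq> \<Theta>" "\<And>ds x. x \<notin> K \<Longrightarrow> partials dir ds \<phi> x = 0"
    "\<And>ds. continuous_on UNIV (partials dir ds \<phi>)" "\<And>ds. partials_exist dir UNIV ds \<phi>"
    using test_function_partials[OF \<phi>] by metis
  have "(\<integral>x. f x * partial (dir d) (partials dir ds \<phi>) x \<partial>lebesgue_on \<Theta>) =
     - (\<integral>x. partial (dir d) f x * partials dir ds \<phi> x \<partial>lebesgue_on \<Theta>)"
    using Cons.prems[of "[d]"] Cons.prems[of "[]"] K(3)[of _ ds] K(4)[of ds] K(4)[of "d # ds"] K(5)[of "d # ds"]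
    by (intro integration_by_parts_step[OF op _ _ _ _ _ _ K(1,2)]) auto
  also have "(\<integral>x. partial (dir d) f x * partials dir ds \<phi> x \<partial>lebesgue_on \<Theta>) =
     (- 1) ^ length ds * (\<integral>x. partials dir (rev ds) (partial (dir d) f) x * \<phi> x \<partial>lebesgue_on \<Theta>)"
  proof (rule Cons.IH)
    fix es :: "'n list" assume "length es \<le> length ds"
    then show "partials_exist dir \<Theta> es (partial (dir d) f) \<and> continuous_on \<Theta> (partials dir es (partial (dir d) f))"
      using Cons.prems[of "es @ [d]"] by (simp add: partials_exist_append partials_append)
  qed
  finally show ?case by (simp add: partials_append)
qed simp

lemma continuous_imp_locally_integrable:
  fixes f :: "real ^ 'n::finite \<Rightarrow> real"
  assumes "continuous_on \<Theta> f"
  shows "locally_integrable \<Theta> f"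
  unfolding locally_integrable_def
proof (intro allI impI)
  fix K assume K: "compact K \<and> K \<subseteq> \<Theta>"
  then have "integrable lborel (\<lambda>x. indicator K x *\<^sub>R f x)"
    using assms by (intro borel_integrable_compact) (auto intro: continuous_on_subset)
  then have "integrable lebesgue (\<lambda>x. indicator K x *\<^sub>R f x)"
    by (intro integrable_completion[THEN iffD2]) auto
  then show "f absolutely_integrable_on K" by (simp add: set_integrable_def)
qed

section \<open>Weak derivatives of kernel sections\<close>

context Ckk_kernel
begin

lemma partials_kpart: "partials dir p (\<lambda>x. kpart h [] q x y) x = kpart h p q x y"
  by (induction p arbitrary: x) (auto simp: kpart_def partial_def kernel_dir_def)

lemma partials_exist_kpart:
  assumes "length p \<le> k" "length q \<le> k" "y \<in> \<Theta>"
  shows "partials_exist dir \<Theta> p (\<lambda>x. kpart h [] q x y)"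
  using assms(1)
proof (induction p)
  case (Cons d p)
  have "(\<lambda>t. partials dir p (\<lambda>x. kpart h [] q x y) (x + t *\<^sub>R dir d)) differentiable at 0" if "x \<in> \<Theta>" for x
  proof -
    have "partials_exist kernel_dir (\<Theta> \<times> \<Theta>) (map Inl (d # p) @ map Inr q) H"
      using Cons.prems assms by (intro Ckk_exist admissible_kpart) auto
    then have "(\<lambda>t. partials kernel_dir (map Inl p @ map Inr q) H ((x, y) + t *\<^sub>R kernel_dir (Inl d))) differentiable at 0"
      using that assms by simp
    then show ?thesis unfolding partials_kpart by (simp add: kpart_def kernel_dir_def)
  qed
  then show ?case using Cons by simp
qed simp

lemma continuous_kpart:
  assumes "length p \<le> k" "length q \<le> k" "y \<in> \<Theta>"
  shows "continuous_on \<Theta> (\<lambda>x. kpart h p q x y)"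
proof -
  have "continuous_on (\<Theta> \<times> \<Theta>) (partials kernel_dir (map Inl p @ map Inr q) H)"
    using assms by (intro uniformly_continuous_imp_continuous Ckk_uc admissible_kpart)
  then show ?thesis
    unfolding kpart_def by (rule continuous_on_compose2) (use assms in \<open>auto intro!: continuous_intros\<close>)
qed

lemma \<kappa>_continuous_left:
  assumes "\<alpha> \<in> I" "\<beta> \<in> I" "y \<in> \<Theta>"
  shows "continuous_on \<Theta> (\<lambda>x. \<kappa> \<alpha> \<beta> x y)"
  using continuous_kpart[of "mi_list \<alpha>" "mi_list \<beta>" y] assms
  by (auto simp: length_mi_list I_def \<kappa>_kpart cong: continuous_on_cong)

text \<open>Integration by parts in the first variable, with the derivatives in the second variable
  carried along as a parameter; permuting derivatives undoes the reversal of the list.\<close>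

lemma \<kappa>_weak_deriv:
  assumes "\<alpha> \<in> I" "\<beta> \<in> I" "y \<in> \<Theta>"
  shows "has_weak_deriv \<Theta> \<beta> (\<lambda>x. \<kappa> (\<lambda>_. 0) \<alpha> x y) (\<lambda>x. \<kappa> \<beta> \<alpha> x y)"
  unfolding has_weak_deriv_def
proof (intro conjI allI impI)
  show "locally_integrable \<Theta> (\<lambda>x. \<kappa> (\<lambda>_. 0) \<alpha> x y)" "locally_integrable \<Theta> (\<lambda>x. \<kappa> \<beta> \<alpha> x y)"
    using assms by (auto intro!: continuous_imp_locally_integrable \<kappa>_continuous_left)
  fix \<phi> assume \<phi>: "test_function \<Theta> \<phi>"
  let ?p = "mi_list \<beta>" and ?q = "mi_list \<alpha>"
  have lk: "length ?p \<le> k" "length ?q \<le> k" using assms by (auto simp: length_mi_list I_def)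
  have "(\<integral>x. \<kappa> (\<lambda>_. 0) \<alpha> x y * mi_partial dir \<beta> \<phi> x \<partial>lebesgue_on \<Theta>) =
        (\<integral>x. kpart h [] ?q x y * partials dir ?p \<phi> x \<partial>lebesgue_on \<Theta>)"
    using assms by (intro Bochner_Integration.integral_cong) (auto simp: \<kappa>_kpart mi_list_0 mi_partial_eq)
  also have "\<dots> = (- 1) ^ length ?p * (\<integral>x. kpart h (rev ?p) ?q x y * \<phi> x \<partial>lebesgue_on \<Theta>)"
    using integration_by_parts[OF op \<phi>, of ?p "\<lambda>x. kpart h [] ?q x y"] lk assms(3)
      partials_exist_kpart[of _ ?q y] continuous_kpart[of _ ?q y] by (simp add: partials_kpart[abs_def] eta_contract_eq)
  also have "(\<integral>x. kpart h (rev ?p) ?q x y * \<phi> x \<partial>lebesgue_on \<Theta>) = (\<integral>x. \<kappa> \<beta> \<alpha> x y * \<phi> x \<partial>lebesgue_on \<Theta>)"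
  proof (intro Bochner_Integration.integral_cong refl)
    fix x assume "x \<in> space (lebesgue_on \<Theta>)"
    then have "kpart h (rev ?p) ?q x y = kpart h ?p ?q x y"
      unfolding kpart_def using lk assms by (intro Ckk_permute admissible_kpart) auto
    then show "kpart h (rev ?p) ?q x y * \<phi> x = \<kappa> \<beta> \<alpha> x y * \<phi> x"
      using assms \<open>x \<in> space (lebesgue_on \<Theta>)\<close> by (simp add: \<kappa>_kpart)
  qed
  finally show "(\<integral>x. \<kappa> (\<lambda>_. 0) \<alpha> x y * mi_partial dir \<beta> \<phi> x \<partial>lebesgue_on \<Theta>) =
      (- 1) ^ mi_order \<beta> * (\<integral>x. \<kappa> \<beta> \<alpha> x y * \<phi> x \<partial>lebesgue_on \<Theta>)"
    by (simp add: length_mi_list)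
qed

end

section \<open>Uniqueness and linearity of weak derivatives\<close>

lemma integrable_mult_compact_support:
  fixes g \<psi> :: "real ^ 'n::finite \<Rightarrow> real"
  assumes op: "open \<Theta>" and g: "locally_integrable \<Theta> g" and K: "compact K" "K \<subseteq> \<Theta>"
    and \<psi>: "continuous_on UNIV \<psi>" "\<And>x. x \<notin> K \<Longrightarrow> \<psi> x = 0"
  shows "integrable (lebesgue_on \<Theta>) (\<lambda>x. g x * \<psi> x)"
proof -
  have m: "\<Theta> \<in> sets lebesgue" "K \<in> sets lebesgue"
    using op K by (auto simp: borel_open lmeasurable_compact fmeasurableD)
  have gK: "integrable (lebesgue_on K) g"
    using g K absolutely_integrable_on_iff_lebesgue_on[OF m(2), of g] by (simp add: locally_integrable_def)
  have "compact (\<psi> ` K)" using K \<psi> by (meson compact_continuous_image continuous_on_subset subset_UNIV)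
  then obtain C where C: "C > 0" "\<And>x. x \<in> K \<Longrightarrow> \<bar>\<psi> x\<bar> \<le> C"
    using bounded_pos[of "\<psi> ` K"] compact_imp_bounded by auto
  have "\<psi> \<in> borel_measurable borel" by (rule borel_measurable_continuous_onI[OF \<psi>(1)])
  then have [measurable]: "\<psi> \<in> borel_measurable (lebesgue_on K)"
    by (intro measurable_restrict_space1 measurable_completion) simp
  have "integrable (lebesgue_on K) (\<lambda>x. g x * \<psi> x)"
  proof (rule Bochner_Integration.integrable_bound[of _ "\<lambda>x. C * g x"])
    show "AE x in lebesgue_on K. norm (g x * \<psi> x) \<le> norm (C * g x)"
      using C by (intro AE_I2) (auto simp: abs_mult mult.commute intro!: mult_right_mono)
  qed (use gK in auto)
  then have "integrable lebesgue (\<lambda>x. if x \<in> K then g x * \<psi> x else 0)"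
    by (simp add: Lebesgue_Measure.integrable_restrict_UNIV m)
  also have "(\<lambda>x. if x \<in> K then g x * \<psi> x else 0) = (\<lambda>x. if x \<in> \<Theta> then g x * \<psi> x else 0)"
    using K \<psi>(2) by (auto simp: fun_eq_iff)
  finally show ?thesis by (simp add: Lebesgue_Measure.integrable_restrict_UNIV m)
qed

lemma integrable_mult_test_function:
  assumes "open \<Theta>" "locally_integrable \<Theta> g" "test_function \<Theta> \<phi>"
  shows "integrable (lebesgue_on \<Theta>) (\<lambda>x. g x * mi_partial dir \<alpha> \<phi> x)"
    and "integrable (lebesgue_on \<Theta>) (\<lambda>x. g x * \<phi> x)"
proof -
  obtain K where K: "compact K" "K \<subseteq> \<Theta>" "\<And>ds x. x \<notin> K \<Longrightarrow> partials dir ds \<phi> x = 0"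
    "\<And>ds. continuous_on UNIV (partials dir ds \<phi>)" "\<And>ds. partials_exist dir UNIV ds \<phi>"
    using test_function_partials[OF assms(3)] by metis
  have *: "integrable (lebesgue_on \<Theta>) (\<lambda>x. g x * partials dir ds \<phi> x)" for ds
    by (rule integrable_mult_compact_support[OF assms(1,2) K(1,2,4,3)])
  show "integrable (lebesgue_on \<Theta>) (\<lambda>x. g x * mi_partial dir \<alpha> \<phi> x)" using * by (simp add: mi_partial_eq)
  show "integrable (lebesgue_on \<Theta>) (\<lambda>x. g x * \<phi> x)" using *[of "[]"] by simp
qed

lemma locally_integrable_linear:
  assumes "locally_integrable \<Theta> f" "locally_integrable \<Theta> g"
  shows "locally_integrable \<Theta> (\<lambda>x. a * f x + b * g x)"
  using assms unfolding locally_integrable_def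
  by (auto intro!: set_integral_add(1) set_integrable_mult_right)

lemma weak_deriv_unique:
  assumes op: "open \<Theta>" and "has_weak_deriv \<Theta> \<alpha> f g" "has_weak_deriv \<Theta> \<alpha> f g'"
  shows "AE x in lebesgue_on \<Theta>. g x = g' x"
proof -
  have l: "locally_integrable \<Theta> g" "locally_integrable \<Theta> g'" using assms by (auto simp: has_weak_deriv_def)
  have "AE x in lebesgue_on \<Theta>. 1 * g x + (-1) * g' x = 0"
  proof (rule fundamental_lemma[OF op locally_integrable_linear[OF l]])
    fix \<phi> assume \<phi>: "test_function \<Theta> \<phi>"
    have "(- 1) ^ mi_order \<alpha> * (\<integral>x. g x * \<phi> x \<partial>lebesgue_on \<Theta>) = (- 1) ^ mi_order \<alpha> * (\<integral>x. g' x * \<phi> x \<partial>lebesgue_on \<Theta>)"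
      using assms(2,3) \<phi> by (simp add: has_weak_deriv_def)
    then have "(\<integral>x. g x * \<phi> x \<partial>lebesgue_on \<Theta>) = (\<integral>x. g' x * \<phi> x \<partial>lebesgue_on \<Theta>)" by simp
    moreover have "integrable (lebesgue_on \<Theta>) (\<lambda>x. g x * \<phi> x)" "integrable (lebesgue_on \<Theta>) (\<lambda>x. g' x * \<phi> x)"
      using integrable_mult_test_function(2)[OF op _ \<phi>] l by auto
    ultimately show "(\<integral>x. (1 * g x + (-1) * g' x) * \<phi> x \<partial>lebesgue_on \<Theta>) = 0"
      by (simp add: left_diff_distrib)
  qed
  then show ?thesis by eventually_elim simp
qed

lemma has_weak_deriv_linear:
  assumes op: "open \<Theta>" and "has_weak_deriv \<Theta> \<alpha> f g" "has_weak_deriv \<Theta> \<alpha> f' g'"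
  shows "has_weak_deriv \<Theta> \<alpha> (\<lambda>x. a * f x + b * f' x) (\<lambda>x. a * g x + b * g' x)"
proof -
  have l: "locally_integrable \<Theta> g" "locally_integrable \<Theta> g'" "locally_integrable \<Theta> f" "locally_integrable \<Theta> f'"
    using assms by (auto simp: has_weak_deriv_def)
  show ?thesis
    unfolding has_weak_deriv_def
  proof (intro conjI allI impI locally_integrable_linear l)
    fix \<phi> assume \<phi>: "test_function \<Theta> \<phi>"
    note i1 = integrable_mult_test_function(1)[OF op _ \<phi>, of _ \<alpha>] and i2 = integrable_mult_test_function(2)[OF op _ \<phi>]
    have "(\<integral>x. (a * f x + b * f' x) * mi_partial dir \<alpha> \<phi> x \<partial>lebesgue_on \<Theta>) =
       a * (\<integral>x. f x * mi_partial dir \<alpha> \<phi> x \<partial>lebesgue_on \<Theta>) + b * (\<integral>x. f' x * mi_partial dir \<alpha> \<phi> x \<partial>lebesgue_on \<Theta>)"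
      using i1[OF l(3)] i1[OF l(4)] by (simp add: distrib_right mult.assoc)
    moreover have "(\<integral>x. (a * g x + b * g' x) * \<phi> x \<partial>lebesgue_on \<Theta>) =
       a * (\<integral>x. g x * \<phi> x \<partial>lebesgue_on \<Theta>) + b * (\<integral>x. g' x * \<phi> x \<partial>lebesgue_on \<Theta>)"
      using i2[OF l(1)] i2[OF l(2)] by (simp add: distrib_right mult.assoc)
    ultimately show "(\<integral>x. (a * f x + b * f' x) * mi_partial dir \<alpha> \<phi> x \<partial>lebesgue_on \<Theta>) =
       (- 1) ^ mi_order \<alpha> * (\<integral>x. (a * g x + b * g' x) * \<phi> x \<partial>lebesgue_on \<Theta>)"
      using assms(2,3) \<phi> by (simp add: has_weak_deriv_def algebra_simps)
  qed
qed

text \<open>Lebesgue measure is complete, so integrability passes across a change on a null set;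
  where it fails, both integrals have the default value 0.\<close>

lemma integral_cong_AE_lebesgue_on:
  fixes f g :: "real ^ 'n::finite \<Rightarrow> real"
  assumes S: "S \<in> sets lebesgue" and "AE x in lebesgue_on S. f x = g x"
  shows "(\<integral>x. f x \<partial>lebesgue_on S) = (\<integral>x. g x \<partial>lebesgue_on S)"
    and "integrable (lebesgue_on S) f \<longleftrightarrow> integrable (lebesgue_on S) g"
proof -
  have n: "negligible {x \<in> S. f x \<noteq> g x}" using assms(2) unfolding AE_lebesgue_on_iff[OF S] .
  have "f absolutely_integrable_on S \<longleftrightarrow> g absolutely_integrable_on S"
    by (rule absolutely_integrable_spike_eq[OF n]) auto
  then show i: "integrable (lebesgue_on S) f \<longleftrightarrow> integrable (lebesgue_on S) g"
    by (simp only: absolutely_integrable_on_iff_lebesgue_on[OF S])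
  show "(\<integral>x. f x \<partial>lebesgue_on S) = (\<integral>x. g x \<partial>lebesgue_on S)"
  proof (cases "integrable (lebesgue_on S) f")
    case True
    then show ?thesis using i assms by (intro integral_cong_AE) auto
  next
    case False
    then show ?thesis using i by (simp add: not_integrable_integral_eq)
  qed
qed

lemma has_weak_deriv_cong_AE:
  fixes \<Theta> :: "(real ^ 'n::finite) set"
  assumes op: "open \<Theta>" and f: "AE x in lebesgue_on \<Theta>. f x = f' x" and g: "AE x in lebesgue_on \<Theta>. g x = g' x"
  shows "has_weak_deriv \<Theta> \<alpha> f g \<longleftrightarrow> has_weak_deriv \<Theta> \<alpha> f' g'"
proof -
  have m: "\<Theta> \<in> sets lebesgue" using op by (simp add: borel_open)
  have l: "locally_integrable \<Theta> u \<longleftrightarrow> locally_integrable \<Theta> u'" if "AE x in lebesgue_on \<Theta>. u x = u' x" for u u'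
  proof -
    have "negligible {x \<in> \<Theta>. u x \<noteq> u' x}" using that unfolding AE_lebesgue_on_iff[OF m] .
    then have "u absolutely_integrable_on K \<longleftrightarrow> u' absolutely_integrable_on K" if "K \<subseteq> \<Theta>" for K
      by (rule absolutely_integrable_spike_eq) (use that in auto)
    then show ?thesis by (auto simp: locally_integrable_def)
  qed
  have i: "(\<integral>x. u x * \<psi> x \<partial>lebesgue_on \<Theta>) = (\<integral>x. u' x * \<psi> x \<partial>lebesgue_on \<Theta>)"
    if "AE x in lebesgue_on \<Theta>. u x = u' x" for u u' \<psi> :: "real ^ 'n \<Rightarrow> real"
  proof -
    have "AE x in lebesgue_on \<Theta>. u x * \<psi> x = u' x * \<psi> x" using that by eventually_elim simp
    then show ?thesis by (rule integral_cong_AE_lebesgue_on(1)[OF m])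
  qed
  show ?thesis unfolding has_weak_deriv_def l[OF f] l[OF g] i[OF f] i[OF g] ..
qed

text \<open>The equality is literal, because both sides choose from the same predicate.\<close>

lemma weak_deriv_cong_AE:
  assumes "open \<Theta>" "AE x in lebesgue_on \<Theta>. f x = f' x"
  shows "weak_deriv \<Theta> \<alpha> f = weak_deriv \<Theta> \<alpha> f'"
proof -
  have "has_weak_deriv \<Theta> \<alpha> f = has_weak_deriv \<Theta> \<alpha> f'"
    by (intro ext has_weak_deriv_cong_AE[OF assms]) simp
  then show ?thesis by (simp add: weak_deriv_def)
qed

lemma weak_deriv_eq_AE:
  assumes "open \<Theta>" "has_weak_deriv \<Theta> \<alpha> f g"
  shows "AE x in lebesgue_on \<Theta>. weak_deriv \<Theta> \<alpha> f x = g x" "has_weak_deriv \<Theta> \<alpha> f (weak_deriv \<Theta> \<alpha> f)"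
proof -
  show *: "has_weak_deriv \<Theta> \<alpha> f (weak_deriv \<Theta> \<alpha> f)" unfolding weak_deriv_def
    by (rule someI[of "has_weak_deriv \<Theta> \<alpha> f", OF assms(2)])
  show "AE x in lebesgue_on \<Theta>. weak_deriv \<Theta> \<alpha> f x = g x" by (rule weak_deriv_unique[OF assms(1) * assms(2)])
qed

lemma has_weak_deriv_0:
  assumes "locally_integrable \<Theta> f"
  shows "has_weak_deriv \<Theta> (\<lambda>_. 0) f f"
  using assms by (simp add: has_weak_deriv_def mi_partial_eq mi_list_0 mi_order_def)

section \<open>The Sobolev space\<close>

context bounded_open
begin

abbreviation M where "M \<equiv> lebesgue_on \<Theta>"

lemma meas: "\<Theta> \<in> sets lebesgue" using op by (simp add: borel_open)

sublocale finite_measure M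
  using lmeasurable_open[OF bdd op] by (rule finite_measure_lebesgue_on)

lemma L2_mult_integrable:
  assumes "f \<in> L2 \<Theta>" "g \<in> L2 \<Theta>"
  shows "integrable M (\<lambda>x. f x * g x)"
proof (rule Bochner_Integration.integrable_bound[of _ "\<lambda>x. (f x)\<^sup>2 + (g x)\<^sup>2"])
  show "AE x in M. norm (f x * g x) \<le> norm ((f x)\<^sup>2 + (g x)\<^sup>2)"
  proof (rule AE_I2)
    fix x
    show "norm (f x * g x) \<le> norm ((f x)\<^sup>2 + (g x)\<^sup>2)"
      using sum_squares_bound[of "\<bar>f x\<bar>" "\<bar>g x\<bar>"] mult_nonneg_nonneg[of "\<bar>f x\<bar>" "\<bar>g x\<bar>"]
      unfolding real_norm_def abs_mult power2_abs by linarith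
  qed
qed (use assms in \<open>auto simp: L2_def\<close>)

lemma L2_const: "(\<lambda>x. c) \<in> L2 \<Theta>" by (simp add: L2_def)

lemma L2_integrable: "f \<in> L2 \<Theta> \<Longrightarrow> integrable M f"
  using L2_mult_integrable[OF _ L2_const[of 1]] by simp

sublocale L2: function_semi_inner "L2 \<Theta>" "L2_inner \<Theta>"
proof
  fix f g u :: "real ^ 'n \<Rightarrow> real" and c :: real
  show "(\<lambda>x. 0) \<in> L2 \<Theta>" by (rule L2_const)
  assume f: "f \<in> L2 \<Theta>"
  show "(\<lambda>x. c * f x) \<in> L2 \<Theta>" using f by (auto simp: L2_def power_mult_distrib)
  show "0 \<le> L2_inner \<Theta> f f" by (simp add: L2_inner_def)
  assume g: "g \<in> L2 \<Theta>"
  show "(\<lambda>x. f x + g x) \<in> L2 \<Theta>"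
    using f g L2_mult_integrable[OF f g] by (auto simp: L2_def power2_sum mult.assoc)
  show "L2_inner \<Theta> f g = L2_inner \<Theta> g f" by (simp add: L2_inner_def mult.commute)
  show "L2_inner \<Theta> (\<lambda>x. c * f x) g = c * L2_inner \<Theta> f g" by (simp add: L2_inner_def mult.assoc)
  assume u: "u \<in> L2 \<Theta>"
  show "L2_inner \<Theta> (\<lambda>x. f x + g x) u = L2_inner \<Theta> f u + L2_inner \<Theta> g u"
    using L2_mult_integrable[OF f u] L2_mult_integrable[OF g u] by (simp add: L2_inner_def distrib_right)
qed

lemma L2_cong_AE:
  assumes "AE x in M. f x = g x"
  shows "f \<in> L2 \<Theta> \<longleftrightarrow> g \<in> L2 \<Theta>"
proof -
  have *: "g \<in> L2 \<Theta>" if "AE x in M. f x = g x" "f \<in> L2 \<Theta>" for f g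
  proof -
    have "integrable M g" using integral_cong_AE_lebesgue_on(2)[OF meas that(1)] L2_integrable[OF that(2)] by simp
    moreover have "AE x in M. (f x)\<^sup>2 = (g x)\<^sup>2" using that(1) by eventually_elim simp
    ultimately show ?thesis
      using integral_cong_AE_lebesgue_on(2)[OF meas, of "\<lambda>x. (f x)\<^sup>2" "\<lambda>x. (g x)\<^sup>2"] that(2) by (simp add: L2_def)
  qed
  have "AE x in M. g x = f x" using assms by eventually_elim simp
  then show ?thesis using * assms by blast
qed

lemma L2_inner_cong_AE:
  assumes "AE x in M. f x = f' x" "AE x in M. g x = g' x"
  shows "L2_inner \<Theta> f g = L2_inner \<Theta> f' g'"
  unfolding L2_inner_def using assms
  by (intro integral_cong_AE_lebesgue_on(1)[OF meas]) (elim AE_mp, auto)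

lemma L2_bounded:
  assumes "f \<in> borel_measurable M" "\<And>x. x \<in> \<Theta> \<Longrightarrow> \<bar>f x\<bar> \<le> C"
  shows "f \<in> L2 \<Theta>" "L2_inner \<Theta> f f \<le> C\<^sup>2 * measure M \<Theta>"
proof -
  have C: "(f x)\<^sup>2 \<le> C\<^sup>2" if "x \<in> \<Theta>" for x using assms(2)[OF that] by (simp add: abs_le_square_iff[symmetric])
  have "integrable M (\<lambda>x. (f x)\<^sup>2)"
    by (rule Bochner_Integration.integrable_bound[of _ "\<lambda>x. C\<^sup>2"]) (use assms C in auto)
  then show L: "f \<in> L2 \<Theta>" using assms by (simp add: L2_def)
  have "L2_inner \<Theta> f f = (\<integral>x. (f x)\<^sup>2 \<partial>M)" by (simp add: L2_inner_def power2_eq_square)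
  also have "\<dots> \<le> (\<integral>x. C\<^sup>2 \<partial>M)" using C L by (intro integral_mono) (auto simp: L2_def)
  finally show "L2_inner \<Theta> f f \<le> C\<^sup>2 * measure M \<Theta>" by (simp add: mult.commute)
qed

lemma L2_L1:
  assumes "f \<in> L2 \<Theta>"
  shows "(\<integral>x. \<bar>f x\<bar> \<partial>M) \<le> sqrt (measure M \<Theta>) * L2.nrm f"
proof -
  have a: "(\<lambda>x. \<bar>f x\<bar>) \<in> L2 \<Theta>" using assms by (auto simp: L2_def)
  have "(\<integral>x. \<bar>f x\<bar> \<partial>M) = L2_inner \<Theta> (\<lambda>x. \<bar>f x\<bar>) (\<lambda>x. 1)" by (simp add: L2_inner_def)
  also have "\<dots> \<le> L2.nrm (\<lambda>x. \<bar>f x\<bar>) * L2.nrm (\<lambda>x. 1)"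
    using L2.Cauchy_Schwarz[OF a L2_const[of 1]] by simp
  also have "\<dots> = sqrt (measure M \<Theta>) * L2.nrm f" by (simp add: L2.nrm_def L2_inner_def)
  finally show ?thesis .
qed

lemma integrable_locally_integrable: "integrable M f \<Longrightarrow> locally_integrable \<Theta> f"
  unfolding locally_integrable_def absolutely_integrable_on_iff_lebesgue_on[OF meas, symmetric]
  by (auto intro!: set_integrable_subset[of _ \<Theta>] simp: lmeasurable_compact fmeasurableD)

lemma L2_locally_integrable: "f \<in> L2 \<Theta> \<Longrightarrow> locally_integrable \<Theta> f"
  by (intro integrable_locally_integrable L2_integrable)

lemma HkI:
  assumes "f \<in> L2 \<Theta>" "\<And>\<alpha>. mi_order \<alpha> \<le> k \<Longrightarrow> g \<alpha> \<in> L2 \<Theta> \<and> has_weak_deriv \<Theta> \<alpha> f (g \<alpha>)"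
  shows "f \<in> Hk k \<Theta>"
  using assms by (auto simp: Hk_def)

lemma Hk_L2: "f \<in> Hk k \<Theta> \<Longrightarrow> f \<in> L2 \<Theta>" by (simp add: Hk_def)

lemma Hk_weak_deriv:
  assumes "f \<in> Hk k \<Theta>" "mi_order \<alpha> \<le> k"
  shows "has_weak_deriv \<Theta> \<alpha> f (weak_deriv \<Theta> \<alpha> f)" "weak_deriv \<Theta> \<alpha> f \<in> L2 \<Theta>"
proof -
  obtain g where g: "g \<in> L2 \<Theta>" "has_weak_deriv \<Theta> \<alpha> f g" using assms by (auto simp: Hk_def)
  show "has_weak_deriv \<Theta> \<alpha> f (weak_deriv \<Theta> \<alpha> f)" by (rule weak_deriv_eq_AE(2)[OF op g(2)])
  show "weak_deriv \<Theta> \<alpha> f \<in> L2 \<Theta>" using weak_deriv_eq_AE(1)[OF op g(2)] g(1) L2_cong_AE by blast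
qed

lemma weak_deriv_0_AE: "f \<in> L2 \<Theta> \<Longrightarrow> AE x in M. weak_deriv \<Theta> (\<lambda>_. 0) f x = f x"
  by (intro weak_deriv_eq_AE(1)[OF op] has_weak_deriv_0 L2_locally_integrable)

lemma Hk_linear:
  assumes f: "f \<in> Hk k \<Theta>" and g: "g \<in> Hk k \<Theta>"
  shows "(\<lambda>x. a * f x + b * g x) \<in> Hk k \<Theta>"
    and "mi_order \<alpha> \<le> k \<Longrightarrow> AE x in M. weak_deriv \<Theta> \<alpha> (\<lambda>x. a * f x + b * g x) x =
            a * weak_deriv \<Theta> \<alpha> f x + b * weak_deriv \<Theta> \<alpha> g x"
proof -
  have w: "has_weak_deriv \<Theta> \<alpha> (\<lambda>x. a * f x + b * g x) (\<lambda>x. a * weak_deriv \<Theta> \<alpha> f x + b * weak_deriv \<Theta> \<alpha> g x)"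
    if "mi_order \<alpha> \<le> k" for \<alpha>
    by (rule has_weak_deriv_linear[OF op Hk_weak_deriv(1)[OF f that] Hk_weak_deriv(1)[OF g that]])
  then show "mi_order \<alpha> \<le> k \<Longrightarrow> AE x in M. weak_deriv \<Theta> \<alpha> (\<lambda>x. a * f x + b * g x) x =
            a * weak_deriv \<Theta> \<alpha> f x + b * weak_deriv \<Theta> \<alpha> g x"
    by (intro weak_deriv_eq_AE(1)[OF op])
  show "(\<lambda>x. a * f x + b * g x) \<in> Hk k \<Theta>"
    by (rule HkI[where g = "\<lambda>\<alpha> x. a * weak_deriv \<Theta> \<alpha> f x + b * weak_deriv \<Theta> \<alpha> g x"])
      (intro conjI w L2.add_in L2.scale_in Hk_L2[OF f] Hk_L2[OF g] Hk_weak_deriv(2)[OF f] Hk_weak_deriv(2)[OF g]; assumption)+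
qed

text \<open>Frees computations from the chosen derivatives; in what follows the continuous versions
  given by the kernel are inserted.\<close>

lemma Hk_inner_weak:
  assumes "\<And>\<alpha>. mi_order \<alpha> \<le> k \<Longrightarrow> has_weak_deriv \<Theta> \<alpha> f (F \<alpha>)" "\<And>\<alpha>. mi_order \<alpha> \<le> k \<Longrightarrow> has_weak_deriv \<Theta> \<alpha> g (G \<alpha>)"
  shows "Hk_inner k \<Theta> f g = (\<Sum>\<alpha> | mi_order \<alpha> \<le> k. L2_inner \<Theta> (F \<alpha>) (G \<alpha>))"
  unfolding Hk_inner_def using assms
  by (intro sum.cong refl L2_inner_cong_AE weak_deriv_eq_AE(1)[OF op]) auto

sublocale Hk: function_semi_inner "Hk k \<Theta>" "Hk_inner k \<Theta>" for k
proof
  fix f g u :: "real ^ 'n \<Rightarrow> real" and c :: real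
  have z: "has_weak_deriv \<Theta> \<alpha> (\<lambda>x. 0) (\<lambda>x. 0)" for \<alpha>
    by (simp add: has_weak_deriv_def continuous_imp_locally_integrable)
  show "(\<lambda>x. 0) \<in> Hk k \<Theta>" using L2_const[of 0] z by (intro HkI[where g = "\<lambda>_ _. 0"]) auto
  assume f: "f \<in> Hk k \<Theta>"
  show "(\<lambda>x. c * f x) \<in> Hk k \<Theta>" using Hk_linear(1)[OF f f, of c 0] by simp
  show "0 \<le> Hk_inner k \<Theta> f f"
    unfolding Hk_inner_def using f by (intro sum_nonneg L2.nonneg Hk_weak_deriv(2)) auto
  assume g: "g \<in> Hk k \<Theta>"
  show "(\<lambda>x. f x + g x) \<in> Hk k \<Theta>" using Hk_linear(1)[OF f g, of 1 1] by simp
  show "Hk_inner k \<Theta> f g = Hk_inner k \<Theta> g f"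
    unfolding Hk_inner_def using f g by (intro sum.cong refl L2.sym Hk_weak_deriv(2)) auto
  \<comment> \<open>The derivative chosen for a combination equals the combination of the chosen
    derivatives only almost everywhere, which the L^2 inner product does not notice.\<close>
  have lin: "L2_inner \<Theta> (weak_deriv \<Theta> \<alpha> (\<lambda>x. a * f x + b * v x)) (weak_deriv \<Theta> \<alpha> u) =
      a * L2_inner \<Theta> (weak_deriv \<Theta> \<alpha> f) (weak_deriv \<Theta> \<alpha> u) + b * L2_inner \<Theta> (weak_deriv \<Theta> \<alpha> v) (weak_deriv \<Theta> \<alpha> u)"
    if "mi_order \<alpha> \<le> k" "v \<in> Hk k \<Theta>" "u \<in> Hk k \<Theta>" for a b \<alpha> v u
  proof -
    have "L2_inner \<Theta> (weak_deriv \<Theta> \<alpha> (\<lambda>x. a * f x + b * v x)) (weak_deriv \<Theta> \<alpha> u) =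
       L2_inner \<Theta> (\<lambda>x. a * weak_deriv \<Theta> \<alpha> f x + b * weak_deriv \<Theta> \<alpha> v x) (weak_deriv \<Theta> \<alpha> u)"
      using Hk_linear(2)[OF f that(2,1)] by (intro L2_inner_cong_AE) auto
    then show ?thesis
      using Hk_weak_deriv(2)[OF _ that(1)] f that by (simp add: L2.add_left L2.scale_in L2.scale_left)
  qed
  show "Hk_inner k \<Theta> (\<lambda>x. c * f x) g = c * Hk_inner k \<Theta> f g"
    using lin[OF _ f g, of _ c 0] by (simp add: Hk_inner_def sum_distrib_left)
  assume u: "u \<in> Hk k \<Theta>"
  show "Hk_inner k \<Theta> (\<lambda>x. f x + g x) u = Hk_inner k \<Theta> f u + Hk_inner k \<Theta> g u"
    using lin[OF _ g u, of _ 1 1] by (simp add: Hk_inner_def sum.distrib)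
qed

lemma Hk_norm_nrm: "Hk_norm k \<Theta> f = Hk.nrm k f"
  by (simp add: Hk_norm_def Hk.nrm_def)

lemma Hk_cong_AE:
  assumes "AE x in M. f x = f' x"
  shows "f \<in> Hk k \<Theta> \<longleftrightarrow> f' \<in> Hk k \<Theta>" "Hk_inner k \<Theta> f g = Hk_inner k \<Theta> f' g" "Hk_inner k \<Theta> g f = Hk_inner k \<Theta> g f'"
proof -
  have "has_weak_deriv \<Theta> \<alpha> f v \<longleftrightarrow> has_weak_deriv \<Theta> \<alpha> f' v" for \<alpha> v
    by (rule has_weak_deriv_cong_AE[OF op assms]) simp
  then show "f \<in> Hk k \<Theta> \<longleftrightarrow> f' \<in> Hk k \<Theta>" using L2_cong_AE[OF assms] by (simp add: Hk_def)
  show "Hk_inner k \<Theta> f g = Hk_inner k \<Theta> f' g" "Hk_inner k \<Theta> g f = Hk_inner k \<Theta> g f'"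
    using weak_deriv_cong_AE[OF op assms] by (simp_all add: Hk_inner_def)
qed

lemma finite_mi_order_le [simp]: "finite {\<alpha>::'n \<Rightarrow> nat. mi_order \<alpha> \<le> k}"
proof -
  have "\<alpha> i \<le> k" if "mi_order \<alpha> \<le> k" for \<alpha> and i :: 'n
    using that member_le_sum[of i UNIV \<alpha>] by (simp add: mi_order_def)
  then have "{\<alpha>::'n \<Rightarrow> nat. mi_order \<alpha> \<le> k} \<subseteq> (UNIV \<rightarrow>\<^sub>E {..k})" by auto
  then show ?thesis by (rule finite_subset) (auto intro: finite_PiE)
qed

lemma L2_nrm_weak_deriv_le:
  assumes "f \<in> Hk k \<Theta>" "mi_order \<alpha> \<le> k"
  shows "L2.nrm (weak_deriv \<Theta> \<alpha> f) \<le> Hk.nrm k f"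
  unfolding L2.nrm_def Hk.nrm_def Hk_inner_def using assms
  by (intro real_sqrt_le_mono member_le_sum[of \<alpha> _ "\<lambda>\<alpha>. L2_inner \<Theta> (weak_deriv \<Theta> \<alpha> f) (weak_deriv \<Theta> \<alpha> f)"])
    (auto intro: L2.nonneg Hk_weak_deriv(2))

lemma L2_nrm_0_AE:
  assumes "f \<in> L2 \<Theta>" "L2.nrm f = 0"
  shows "AE x in M. f x = 0"
proof -
  have "(\<integral>x. (f x)\<^sup>2 \<partial>M) = 0" using assms(2) by (simp add: L2.nrm_def L2_inner_def power2_eq_square)
  then have "AE x in M. (f x)\<^sup>2 = 0"
    using assms(1) integral_nonneg_eq_0_iff_AE[of M "\<lambda>x. (f x)\<^sup>2"] by (auto simp: L2_def)
  then show ?thesis by eventually_elim simp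
qed

lemma Hk_nrm_0_AE:
  assumes "f \<in> Hk k \<Theta>" "Hk.nrm k f = 0"
  shows "AE x in M. f x = 0"
proof -
  let ?g = "weak_deriv \<Theta> (\<lambda>_. 0) f"
  have o: "mi_order (\<lambda>_::'n. 0) \<le> k" by (simp add: mi_order_def)
  have g: "?g \<in> L2 \<Theta>" by (rule Hk_weak_deriv(2)[OF assms(1) o])
  then have "L2.nrm ?g = 0"
    using L2_nrm_weak_deriv_le[OF assms(1) o] L2.nrm_nonneg[OF g] assms(2) by linarith
  from L2_nrm_0_AE[OF g this] weak_deriv_0_AE[OF Hk_L2[OF assms(1)]] show ?thesis
    by eventually_elim simp
qed

text \<open>On a bounded domain uniform convergence implies L^2 convergence, under which both sides
  of the identity defining weak derivatives pass to the limit. It supplies the Sobolev limits for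
  the compactness of \<open>T\<close> and for the eigenfunction series.\<close>

lemma weak_deriv_uniform_limit:
  fixes f :: "nat \<Rightarrow> real ^ 'n \<Rightarrow> real"
  assumes f: "\<And>n \<alpha>. mi_order \<alpha> \<le> k \<Longrightarrow> has_weak_deriv \<Theta> \<alpha> (f n) (F n \<alpha>)"
    and F: "\<And>n \<alpha>. mi_order \<alpha> \<le> k \<Longrightarrow> F n \<alpha> \<in> L2 \<Theta>"
    and lim: "\<And>\<alpha>. mi_order \<alpha> \<le> k \<Longrightarrow> uniform_limit \<Theta> (\<lambda>n. F n \<alpha>) (G \<alpha>) sequentially"
  shows "\<And>\<alpha>. mi_order \<alpha> \<le> k \<Longrightarrow> G \<alpha> \<in> L2 \<Theta>"
    "\<And>\<alpha>. mi_order \<alpha> \<le> k \<Longrightarrow> has_weak_deriv \<Theta> \<alpha> (G (\<lambda>_. 0)) (G \<alpha>)"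
    "G (\<lambda>_. 0) \<in> Hk k \<Theta>"
    "(\<lambda>n. Hk.nrm k (\<lambda>x. f n x - G (\<lambda>_. 0) x)) \<longlonglongrightarrow> 0"
proof -
  let ?z = "\<lambda>_::'n. 0::nat"
  have z: "mi_order ?z \<le> k" by (simp add: mi_order_def)
  have Gm: "G \<alpha> \<in> borel_measurable M" if a: "mi_order \<alpha> \<le> k" for \<alpha>
  proof (rule borel_measurable_LIMSEQ_real)
    show "(\<lambda>n. F n \<alpha> x) \<longlonglongrightarrow> G \<alpha> x" if "x \<in> space M" for x
      using tendsto_uniform_limitI[OF lim[OF a]] that by simp
  qed (use F[OF a] in \<open>auto simp: L2_def\<close>)
  have dist: "\<forall>\<^sub>F n in sequentially. \<forall>x\<in>\<Theta>. \<bar>F n \<alpha> x - G \<alpha> x\<bar> \<le> e" if "mi_order \<alpha> \<le> k" "e > 0" for \<alpha> e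
    using uniform_limitD[OF lim[OF that(1)] that(2)] by eventually_elim (auto simp: dist_real_def less_imp_le)
  show GL2: "G \<alpha> \<in> L2 \<Theta>" if a: "mi_order \<alpha> \<le> k" for \<alpha>
  proof -
    obtain n where n: "\<And>x. x \<in> \<Theta> \<Longrightarrow> \<bar>F n \<alpha> x - G \<alpha> x\<bar> \<le> 1"
      using dist[OF a, of 1] by (auto simp: eventually_sequentially)
    have "(\<lambda>x. F n \<alpha> x - G \<alpha> x) \<in> L2 \<Theta>"
      using Gm[OF a] F[OF a, of n] n by (intro L2_bounded(1)[of _ 1]) (auto simp: L2_def)
    from L2.diff_in[OF F[OF a, of n] this] show ?thesis by simp
  qed
  \<comment> \<open>\<open>f n\<close> and \<open>F n\<close> of order 0 are both weak derivatives
    of order 0 of \<open>f n\<close>, so they agree almost everywhere.\<close>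
  have ff: "AE x in M. f n x = F n ?z x" for n
  proof -
    have "has_weak_deriv \<Theta> ?z (f n) (f n)" using f[OF z, of n] by (intro has_weak_deriv_0) (simp add: has_weak_deriv_def)
    then show ?thesis using f[OF z] by (rule weak_deriv_unique[OF op])
  qed
  have nrm0: "(\<lambda>n. L2.nrm (\<lambda>x. F n \<alpha> x - G \<alpha> x)) \<longlonglongrightarrow> 0" if a: "mi_order \<alpha> \<le> k" for \<alpha>
    unfolding tendsto_iff
  proof (intro allI impI)
    fix e :: real assume e: "e > 0"
    \<comment> \<open>The summand 1 keeps the denominator positive also for an empty domain.\<close>
    define e' where "e' = e / (2 * (sqrt (measure M \<Theta>) + 1))"
    have s: "sqrt (measure M \<Theta>) + 1 > 0" by (simp add: add_nonneg_pos)
    have e': "e' > 0" using e s by (simp add: e'_def)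
    show "\<forall>\<^sub>F n in sequentially. dist (L2.nrm (\<lambda>x. F n \<alpha> x - G \<alpha> x)) 0 < e"
      using dist[OF a e']
    proof eventually_elim
      case (elim n)
      have "L2_inner \<Theta> (\<lambda>x. F n \<alpha> x - G \<alpha> x) (\<lambda>x. F n \<alpha> x - G \<alpha> x) \<le> e'\<^sup>2 * measure M \<Theta>"
        using Gm[OF a] F[OF a, of n] elim by (intro L2_bounded(2)) (auto simp: L2_def)
      then have "L2.nrm (\<lambda>x. F n \<alpha> x - G \<alpha> x) \<le> sqrt (e'\<^sup>2 * measure M \<Theta>)"
        unfolding L2.nrm_def by (rule real_sqrt_le_mono)
      also have "\<dots> = e' * sqrt (measure M \<Theta>)" using e' by (simp add: real_sqrt_mult)
      also have "\<dots> < e' * (2 * (sqrt (measure M \<Theta>) + 1))"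
        using e' s by (intro mult_strict_left_mono) auto
      also have "\<dots> = e" using s by (simp add: e'_def)
      finally show ?case using L2.nrm_nonneg[OF L2.diff_in[OF F[OF a, of n] GL2[OF a]]] by simp
    qed
  qed
  have conv: "(\<lambda>n. \<integral>x. F n \<alpha> x * \<psi> x \<partial>M) \<longlonglongrightarrow> (\<integral>x. G \<alpha> x * \<psi> x \<partial>M)"
    if a: "mi_order \<alpha> \<le> k" and \<psi>: "\<psi> \<in> L2 \<Theta>" for \<alpha> \<psi>
    using L2.ip_limit_left[OF F[OF a] GL2[OF a] \<psi> nrm0[OF a]] by (simp add: L2_inner_def)
  show weak: "has_weak_deriv \<Theta> \<alpha> (G ?z) (G \<alpha>)" if a: "mi_order \<alpha> \<le> k" for \<alpha>
    unfolding has_weak_deriv_def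
  proof (intro conjI allI impI L2_locally_integrable GL2 z a)
    fix \<phi> assume \<phi>: "test_function \<Theta> \<phi>"
    obtain K where K: "compact K" "K \<subseteq> \<Theta>" "\<And>ds x. x \<notin> K \<Longrightarrow> partials dir ds \<phi> x = 0"
      "\<And>ds. continuous_on UNIV (partials dir ds \<phi>)" "\<And>ds. partials_exist dir UNIV ds \<phi>"
      using test_function_partials[OF \<phi>] by metis
    have pL2: "partials dir ds \<phi> \<in> L2 \<Theta>" for ds
    proof -
      have "compact (partials dir ds \<phi> ` K)" using K by (meson compact_continuous_image continuous_on_subset subset_UNIV)
      then obtain C where C: "C > 0" "\<And>x. x \<in> K \<Longrightarrow> \<bar>partials dir ds \<phi> x\<bar> \<le> C"
        using bounded_pos[of "partials dir ds \<phi> ` K"] compact_imp_bounded by auto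
      have "\<bar>partials dir ds \<phi> x\<bar> \<le> C" for x using C K(3)[of x ds] by (cases "x \<in> K") auto
      moreover have "partials dir ds \<phi> \<in> borel_measurable M"
        using borel_measurable_continuous_onI[OF K(4)]
        by (intro measurable_restrict_space1 measurable_completion) simp
      ultimately show ?thesis by (intro L2_bounded(1))
    qed
    have "(\<lambda>n. \<integral>x. F n ?z x * mi_partial dir \<alpha> \<phi> x \<partial>M) \<longlonglongrightarrow> (\<integral>x. G ?z x * mi_partial dir \<alpha> \<phi> x \<partial>M)"
      using pL2 by (intro conv z) (simp add: mi_partial_eq)
    moreover have "(\<lambda>n. (- 1) ^ mi_order \<alpha> * (\<integral>x. F n \<alpha> x * \<phi> x \<partial>M)) \<longlonglongrightarrow> (- 1) ^ mi_order \<alpha> * (\<integral>x. G \<alpha> x * \<phi> x \<partial>M)"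
      using pL2[of "[]"] by (intro tendsto_mult tendsto_const conv a) simp
    moreover have "(\<integral>x. F n ?z x * mi_partial dir \<alpha> \<phi> x \<partial>M) = (- 1) ^ mi_order \<alpha> * (\<integral>x. F n \<alpha> x * \<phi> x \<partial>M)" for n
    proof -
      have "(\<integral>x. F n ?z x * mi_partial dir \<alpha> \<phi> x \<partial>M) = (\<integral>x. f n x * mi_partial dir \<alpha> \<phi> x \<partial>M)"
        by (rule integral_cong_AE_lebesgue_on(1)[OF meas]) (use ff[of n] in eventually_elim, simp)
      then show ?thesis using f[OF a, of n] \<phi> by (simp add: has_weak_deriv_def)
    qed
    ultimately show "(\<integral>x. G ?z x * mi_partial dir \<alpha> \<phi> x \<partial>M) = (- 1) ^ mi_order \<alpha> * (\<integral>x. G \<alpha> x * \<phi> x \<partial>M)"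
      by (auto intro: LIMSEQ_unique)
  qed
  show "G ?z \<in> Hk k \<Theta>" using GL2 weak z by (intro HkI[where g = G]) auto
  have "(\<lambda>n. sqrt (\<Sum>\<alpha> | mi_order \<alpha> \<le> k. (L2.nrm (\<lambda>x. F n \<alpha> x - G \<alpha> x))\<^sup>2)) \<longlonglongrightarrow> sqrt (\<Sum>\<alpha> | mi_order (\<alpha> :: 'n \<Rightarrow> nat) \<le> k. 0\<^sup>2)"
    by (intro tendsto_real_sqrt tendsto_sum tendsto_power nrm0) simp
  moreover have "Hk.nrm k (\<lambda>x. f n x - G ?z x) = sqrt (\<Sum>\<alpha> | mi_order \<alpha> \<le> k. (L2.nrm (\<lambda>x. F n \<alpha> x - G \<alpha> x))\<^sup>2)" for n
  proof -
    have w: "has_weak_deriv \<Theta> \<alpha> (\<lambda>x. f n x - G ?z x) (\<lambda>x. F n \<alpha> x - G \<alpha> x)" if "mi_order \<alpha> \<le> k" for \<alpha>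
      using has_weak_deriv_linear[OF op f[OF that] weak[OF that], of 1 n "-1"] by simp
    have "Hk_inner k \<Theta> (\<lambda>x. f n x - G ?z x) (\<lambda>x. f n x - G ?z x) =
       (\<Sum>\<alpha> | mi_order \<alpha> \<le> k. L2_inner \<Theta> (\<lambda>x. F n \<alpha> x - G \<alpha> x) (\<lambda>x. F n \<alpha> x - G \<alpha> x))"
      by (rule Hk_inner_weak[OF w w])
    also have "\<dots> = (\<Sum>\<alpha> | mi_order \<alpha> \<le> k. (L2.nrm (\<lambda>x. F n \<alpha> x - G \<alpha> x))\<^sup>2)"
      using F GL2 by (intro sum.cong refl L2.nrm_sq[symmetric] L2.diff_in) auto
    finally show ?thesis by (simp add: Hk.nrm_def)
  qed
  ultimately show "(\<lambda>n. Hk.nrm k (\<lambda>x. f n x - G ?z x)) \<longlonglongrightarrow> 0" by simp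
qed

end

section \<open>Integration against the kernel\<close>

text \<open>The minimum of finitely many positive numbers, for properties inherited by smaller
  numbers; it makes constants uniform in the pairs of multi-indices.\<close>

lemma finite_common_pos:
  assumes "finite A" "\<And>a. a \<in> A \<Longrightarrow> \<exists>d>0::real. P a d" "\<And>a d d'. \<lbrakk>P a d; 0 < d'; d' \<le> d\<rbrakk> \<Longrightarrow> P a d'"
  shows "\<exists>d>0. \<forall>a\<in>A. P a d"
  using assms(1,2)
proof (induction A rule: finite_induct)
  case (insert a A)
  have "\<exists>d>0. \<forall>a\<in>A. P a d" by (rule insert.IH) (use insert.prems in simp)
  moreover have "\<exists>d>0. P a d" using insert.prems by simp
  ultimately obtain d1 d2 where d: "d1 > 0" "P a d1" "d2 > 0" "\<forall>a\<in>A. P a d2" by blast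
  have "\<forall>b\<in>insert a A. P b (min d1 d2)"
    using d assms(3)[of _ d1 "min d1 d2"] assms(3)[of _ d2 "min d1 d2"] by auto
  then show ?case using d by (intro exI[of _ "min d1 d2"]) auto
qed (auto intro: exI[of _ 1])

text \<open>Each new ball overrides the selection made so far, so every level set changes only by a
  ball and stays Borel. The level sets will be the cells of Riemann sums.\<close>

lemma measurable_net_selection:
  fixes Z :: "'a::metric_space set"
  assumes "finite Z"
  shows "\<exists>s. (\<forall>x\<in>(\<Union>z\<in>Z. ball z d). s x \<in> Z \<and> dist x (s x) < d) \<and> (\<forall>w. {x. s x = w} \<in> sets borel)"
  using assms
proof (induction Z rule: finite_induct)
  case empty
  have "{x::'a. undefined = w} \<in> sets borel" for w :: 'a by (cases "w = undefined") auto
  then show ?case by (intro exI[of _ "\<lambda>_. undefined"]) auto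
next
  case (insert z Z)
  then obtain s where s: "\<forall>x\<in>(\<Union>z\<in>Z. ball z d). s x \<in> Z \<and> dist x (s x) < d"
    "\<And>w. {x. s x = w} \<in> sets borel" by blast
  let ?s = "\<lambda>x. if x \<in> ball z d then z else s x"
  have "{x. ?s x = w} = (if w = z then ball z d else {}) \<union> ({x. s x = w} - ball z d)" for w by auto
  then have 1: "{x. ?s x = w} \<in> sets borel" for w using s(2)[of w] by auto
  have 2: "\<forall>x\<in>(\<Union>z\<in>insert z Z. ball z d). ?s x \<in> insert z Z \<and> dist x (?s x) < d"
    using s(1) by (auto simp: dist_commute)
  show ?case by (intro exI[of _ ?s] conjI allI 1 2)
qed

context Ckk_kernel
begin

lemma finite_I [simp]: "finite I" by (simp add: I_def)

abbreviation Der :: "(real ^ 'n \<Rightarrow> real) \<Rightarrow> ('n \<Rightarrow> nat) \<Rightarrow> real ^ 'n \<Rightarrow> real" where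
  "Der f \<equiv> \<lambda>\<alpha>. weak_deriv \<Theta> \<alpha> f"

text \<open>A family \<open>F\<close> of densities stands for the functional \<open>g \<mapsto> \<Sum>\<^sub>\<alpha> \<integral>F\<^sub>\<alpha> \<partial>\<^sup>\<alpha>g\<close>. For \<open>F = Der f\<close>, \<open>TT F \<beta>\<close> is the
  weak derivative of order \<open>\<beta>\<close> of the kernel operator at \<open>f\<close>, and \<open>BB\<close> is its quadratic form on \<open>H\<^sup>k\<close>.\<close>

definition L1fam :: "(('n \<Rightarrow> nat) \<Rightarrow> real ^ 'n \<Rightarrow> real) \<Rightarrow> bool" where
  "L1fam F \<longleftrightarrow> (\<forall>\<alpha>\<in>I. integrable M (F \<alpha>))"

definition TT :: "(('n \<Rightarrow> nat) \<Rightarrow> real ^ 'n \<Rightarrow> real) \<Rightarrow> ('n \<Rightarrow> nat) \<Rightarrow> real ^ 'n \<Rightarrow> real" where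
  "TT F \<beta> y = (\<Sum>\<alpha>\<in>I. \<integral>x. \<kappa> \<alpha> \<beta> x y * F \<alpha> x \<partial>M)"

definition BB :: "(('n \<Rightarrow> nat) \<Rightarrow> real ^ 'n \<Rightarrow> real) \<Rightarrow> (('n \<Rightarrow> nat) \<Rightarrow> real ^ 'n \<Rightarrow> real) \<Rightarrow> real" where
  "BB F G = (\<Sum>\<beta>\<in>I. \<integral>y. TT F \<beta> y * G \<beta> y \<partial>M)"

text \<open>The total L^1 size of a family. Estimates linear in it, with constants independent of
  the densities, make the approximation by finite sums uniform.\<close>

definition NN :: "(('n \<Rightarrow> nat) \<Rightarrow> real ^ 'n \<Rightarrow> real) \<Rightarrow> real" where
  "NN F = (\<Sum>\<alpha>\<in>I. \<integral>x. \<bar>F \<alpha> x\<bar> \<partial>M)"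

lemma NN_nonneg [simp]: "0 \<le> NN F" by (auto simp: NN_def intro!: sum_nonneg)

lemma \<kappa>_bounded: "\<exists>C>0. \<forall>\<alpha>\<in>I. \<forall>\<beta>\<in>I. \<forall>x\<in>\<Theta>. \<forall>y\<in>\<Theta>. \<bar>\<kappa> \<alpha> \<beta> x y\<bar> \<le> C"
proof -
  \<comment> \<open>The bound is written as \<open>1 / d\<close>, so that it weakens as
    \<open>d\<close> shrinks.\<close>
  let ?P = "\<lambda>a d. \<forall>x\<in>\<Theta>. \<forall>y\<in>\<Theta>. \<bar>\<kappa> (fst a) (snd a) x y\<bar> \<le> 1 / d"
  have 1: "\<exists>d>0. ?P a d" if "a \<in> I \<times> I" for a
  proof -
    have "bounded ((\<lambda>z. \<kappa> (fst a) (snd a) (fst z) (snd z)) ` (\<Theta> \<times> \<Theta>))"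
      using that by (intro bounded_uniformly_continuous_image \<kappa>_uc bounded_Times bdd) auto
    then obtain b where "b > 0" "\<forall>x\<in>\<Theta>. \<forall>y\<in>\<Theta>. \<bar>\<kappa> (fst a) (snd a) x y\<bar> \<le> b"
      unfolding bounded_pos by auto
    then show ?thesis by (intro exI[of _ "1 / b"]) auto
  qed
  have 2: "?P a d'" if "?P a d" "0 < d'" "d' \<le> d" for a d d'
  proof -
    have "1 / d \<le> 1 / d'" using that by (intro divide_left_mono) auto
    then show ?thesis using that(1) by (meson order.trans)
  qed
  have "\<exists>d>0. \<forall>a\<in>I \<times> I. ?P a d"
    by (rule finite_common_pos[of "I \<times> I" ?P, OF _ 1 2]) simp_all
  then obtain d where "d > 0" "\<forall>a\<in>I \<times> I. \<forall>x\<in>\<Theta>. \<forall>y\<in>\<Theta>. \<bar>\<kappa> (fst a) (snd a) x y\<bar> \<le> 1 / d" by blast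
  then show ?thesis by (intro exI[of _ "1 / d"]) auto
qed

lemma \<kappa>_modulus:
  assumes "e > 0"
  shows "\<exists>d>0. \<forall>\<alpha>\<in>I. \<forall>\<beta>\<in>I. \<forall>x\<in>\<Theta>. \<forall>x'\<in>\<Theta>. \<forall>y\<in>\<Theta>. \<forall>y'\<in>\<Theta>.
    dist x x' < d \<and> dist y y' < d \<longrightarrow> \<bar>\<kappa> \<alpha> \<beta> x y - \<kappa> \<alpha> \<beta> x' y'\<bar> \<le> e"
proof -
  let ?P = "\<lambda>a d. \<forall>x\<in>\<Theta>. \<forall>x'\<in>\<Theta>. \<forall>y\<in>\<Theta>. \<forall>y'\<in>\<Theta>.
    dist x x' < d \<and> dist y y' < d \<longrightarrow> \<bar>\<kappa> (fst a) (snd a) x y - \<kappa> (fst a) (snd a) x' y'\<bar> \<le> e"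
  have 1: "\<exists>d>0. ?P a d" if "a \<in> I \<times> I" for a
  proof -
    have "uniformly_continuous_on (\<Theta> \<times> \<Theta>) (\<lambda>z. \<kappa> (fst a) (snd a) (fst z) (snd z))"
      using that by (intro \<kappa>_uc) auto
    from this[unfolded uniformly_continuous_on_def, rule_format, OF assms]
    obtain d where d: "d > 0" "\<forall>z\<in>\<Theta> \<times> \<Theta>. \<forall>z'\<in>\<Theta> \<times> \<Theta>. dist z' z < d \<longrightarrow>
      dist (\<kappa> (fst a) (snd a) (fst z') (snd z')) (\<kappa> (fst a) (snd a) (fst z) (snd z)) < e" by (elim exE conjE)
    have "?P a (d / 2)"
    proof (intro ballI impI)
      fix x x' y y' assume xy: "x \<in> \<Theta>" "x' \<in> \<Theta>" "y \<in> \<Theta>" "y' \<in> \<Theta>" "dist x x' < d / 2 \<and> dist y y' < d / 2"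
      have "dist (x, y) (x', y') \<le> dist x x' + dist y y'"
        unfolding dist_Pair_Pair by (rule sqrt_sum_squares_le_sum) auto
      then have "dist (x, y) (x', y') < d" using xy by simp
      then show "\<bar>\<kappa> (fst a) (snd a) x y - \<kappa> (fst a) (snd a) x' y'\<bar> \<le> e"
        using d(2)[rule_format, of "(x', y')" "(x, y)"] xy by (simp add: dist_real_def)
    qed
    then show ?thesis using d(1) by (intro exI[of _ "d / 2"]) auto
  qed
  have 2: "?P a d'" if "?P a d" "0 < d'" "d' \<le> d" for a d d'
    using that by (meson less_le_trans)
  have "\<exists>d>0. \<forall>a\<in>I \<times> I. ?P a d"
    by (rule finite_common_pos[of "I \<times> I" ?P, OF _ 1 2]) simp_all
  then obtain d where d: "d > 0" "\<forall>a\<in>I \<times> I. ?P a d" by blast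
  have "?P (\<alpha>, \<beta>) d" if "\<alpha> \<in> I" "\<beta> \<in> I" for \<alpha> \<beta> by (rule bspec[OF d(2)]) (use that in simp)
  then show ?thesis using d(1) by (intro exI[of _ d] conjI ballI) simp_all
qed

lemma \<kappa>_measurable: "\<lbrakk>\<alpha> \<in> I; \<beta> \<in> I; y \<in> \<Theta>\<rbrakk> \<Longrightarrow> (\<lambda>x. \<kappa> \<alpha> \<beta> x y) \<in> borel_measurable M"
  by (rule continuous_imp_measurable_on_sets_lebesgue[OF \<kappa>_continuous_left meas])

lemma integrable_mult_bounded:
  fixes F g :: "real ^ 'n \<Rightarrow> real"
  assumes "integrable M F" "g \<in> borel_measurable M" "\<And>x. x \<in> \<Theta> \<Longrightarrow> \<bar>g x\<bar> \<le> C"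
  shows "integrable M (\<lambda>x. g x * F x)" "\<bar>\<integral>x. g x * F x \<partial>M\<bar> \<le> C * (\<integral>x. \<bar>F x\<bar> \<partial>M)"
proof -
  have le: "\<bar>g x * F x\<bar> \<le> C * \<bar>F x\<bar>" if "x \<in> \<Theta>" for x
    unfolding abs_mult by (rule mult_right_mono[OF assms(3)[OF that]]) simp
  show i: "integrable M (\<lambda>x. g x * F x)"
  proof (rule Bochner_Integration.integrable_bound[of _ "\<lambda>x. C * \<bar>F x\<bar>"])
    show "AE x in M. norm (g x * F x) \<le> norm (C * \<bar>F x\<bar>)"
      using le by (intro AE_I2) (auto intro: order.trans[OF _ abs_ge_self])
  qed (use assms in auto)
  have "\<bar>\<integral>x. g x * F x \<partial>M\<bar> \<le> (\<integral>x. \<bar>g x * F x\<bar> \<partial>M)" by (rule integral_abs_bound)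
  also have "\<dots> \<le> (\<integral>x. C * \<bar>F x\<bar> \<partial>M)" using i assms(1) le by (intro integral_mono) auto
  finally show "\<bar>\<integral>x. g x * F x \<partial>M\<bar> \<le> C * (\<integral>x. \<bar>F x\<bar> \<partial>M)" by simp
qed

lemma \<kappa>_integrable:
  assumes "L1fam F" "\<alpha> \<in> I" "\<beta> \<in> I" "y \<in> \<Theta>"
  shows "integrable M (\<lambda>x. \<kappa> \<alpha> \<beta> x y * F \<alpha> x)"
proof -
  obtain C where "\<forall>\<alpha>\<in>I. \<forall>\<beta>\<in>I. \<forall>x\<in>\<Theta>. \<forall>y\<in>\<Theta>. \<bar>\<kappa> \<alpha> \<beta> x y\<bar> \<le> C" using \<kappa>_bounded by blast
  then show ?thesis
    using assms by (intro integrable_mult_bounded(1)[of _ _ C] \<kappa>_measurable) (auto simp: L1fam_def)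
qed

lemma TT_bounded: "\<exists>C>0. \<forall>F \<beta> y. L1fam F \<longrightarrow> \<beta> \<in> I \<longrightarrow> y \<in> \<Theta> \<longrightarrow> \<bar>TT F \<beta> y\<bar> \<le> C * NN F"
proof -
  obtain C where C: "C > 0" "\<forall>\<alpha>\<in>I. \<forall>\<beta>\<in>I. \<forall>x\<in>\<Theta>. \<forall>y\<in>\<Theta>. \<bar>\<kappa> \<alpha> \<beta> x y\<bar> \<le> C" using \<kappa>_bounded by blast
  have "\<bar>TT F \<beta> y\<bar> \<le> C * NN F" if "L1fam F" "\<beta> \<in> I" "y \<in> \<Theta>" for F \<beta> y
  proof -
    have "\<bar>TT F \<beta> y\<bar> \<le> (\<Sum>\<alpha>\<in>I. \<bar>\<integral>x. \<kappa> \<alpha> \<beta> x y * F \<alpha> x \<partial>M\<bar>)" unfolding TT_def by (rule sum_abs)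
    also have "\<dots> \<le> (\<Sum>\<alpha>\<in>I. C * (\<integral>x. \<bar>F \<alpha> x\<bar> \<partial>M))"
      using that C by (intro sum_mono integrable_mult_bounded(2) \<kappa>_measurable) (auto simp: L1fam_def)
    finally show ?thesis by (simp add: NN_def sum_distrib_left)
  qed
  then show ?thesis using C by blast
qed

lemma TT_diff_le:
  assumes "L1fam F" "\<beta> \<in> I" "y \<in> \<Theta>" "y' \<in> \<Theta>"
    and e: "\<And>\<alpha> x. \<lbrakk>\<alpha> \<in> I; x \<in> \<Theta>\<rbrakk> \<Longrightarrow> \<bar>\<kappa> \<alpha> \<beta> x y - \<kappa> \<alpha> \<beta> x y'\<bar> \<le> e"
  shows "\<bar>TT F \<beta> y - TT F \<beta> y'\<bar> \<le> e * NN F"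
proof -
  have "TT F \<beta> y - TT F \<beta> y' = (\<Sum>\<alpha>\<in>I. \<integral>x. (\<kappa> \<alpha> \<beta> x y - \<kappa> \<alpha> \<beta> x y') * F \<alpha> x \<partial>M)"
    unfolding TT_def sum_subtractf[symmetric] using assms \<kappa>_integrable
    by (intro sum.cong refl) (simp add: left_diff_distrib)
  also have "\<bar>\<dots>\<bar> \<le> (\<Sum>\<alpha>\<in>I. \<bar>\<integral>x. (\<kappa> \<alpha> \<beta> x y - \<kappa> \<alpha> \<beta> x y') * F \<alpha> x \<partial>M\<bar>)" by (rule sum_abs)
  also have "\<dots> \<le> (\<Sum>\<alpha>\<in>I. e * (\<integral>x. \<bar>F \<alpha> x\<bar> \<partial>M))"
    using assms by (intro sum_mono integrable_mult_bounded(2) borel_measurable_diff \<kappa>_measurable) (auto simp: L1fam_def)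
  finally show ?thesis by (simp add: NN_def sum_distrib_left)
qed

lemma TT_uc:
  assumes F: "L1fam F" and b: "\<beta> \<in> I"
  shows "uniformly_continuous_on \<Theta> (TT F \<beta>)"
  unfolding uniformly_continuous_on_def
proof (intro allI impI)
  fix e :: real assume e: "e > 0"
  define e' where "e' = e / (2 * (NN F + 1))"
  have N: "NN F + 1 > 0" by (simp add: add_nonneg_pos)
  have e': "e' > 0" using e N by (simp add: e'_def)
  obtain d where d: "d > 0" "\<forall>\<alpha>\<in>I. \<forall>\<beta>\<in>I. \<forall>x\<in>\<Theta>. \<forall>x'\<in>\<Theta>. \<forall>y\<in>\<Theta>. \<forall>y'\<in>\<Theta>.
    dist x x' < d \<and> dist y y' < d \<longrightarrow> \<bar>\<kappa> \<alpha> \<beta> x y - \<kappa> \<alpha> \<beta> x' y'\<bar> \<le> e'" using \<kappa>_modulus[OF e'] by blast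
  have "dist (TT F \<beta> y') (TT F \<beta> y) < e" if "y \<in> \<Theta>" "y' \<in> \<Theta>" "dist y' y < d" for y y'
  proof -
    have "\<bar>TT F \<beta> y' - TT F \<beta> y\<bar> \<le> e' * NN F"
      using d that b by (intro TT_diff_le F) (metis dist_self)+
    also have "\<dots> < e' * (2 * (NN F + 1))" using NN_nonneg[of F] by (intro mult_strict_left_mono e') (simp add: add_nonneg_pos)
    also have "\<dots> = e" using N by (simp add: e'_def)
    finally show ?thesis by (simp add: dist_real_def)
  qed
  then show "\<exists>d>0. \<forall>x\<in>\<Theta>. \<forall>x'\<in>\<Theta>. dist x' x < d \<longrightarrow> dist (TT F \<beta> x') (TT F \<beta> x) < e" using d(1) by blast
qed

lemma TT_continuous: "\<lbrakk>L1fam F; \<beta> \<in> I\<rbrakk> \<Longrightarrow> continuous_on \<Theta> (TT F \<beta>)"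
  by (rule uniformly_continuous_imp_continuous[OF TT_uc])

lemma TT_measurable: "\<lbrakk>L1fam F; \<beta> \<in> I\<rbrakk> \<Longrightarrow> TT F \<beta> \<in> borel_measurable M"
  by (rule continuous_imp_measurable_on_sets_lebesgue[OF TT_continuous meas])

lemma TT_L2: "\<lbrakk>L1fam F; \<beta> \<in> I\<rbrakk> \<Longrightarrow> TT F \<beta> \<in> L2 \<Theta>"
  using TT_bounded L2_bounded(1)[OF TT_measurable] by meson

lemma TT_mult_integrable:
  assumes "L1fam F" "L1fam G" "\<beta> \<in> I"
  shows "integrable M (\<lambda>y. TT F \<beta> y * G \<beta> y)"
proof -
  obtain C where "\<forall>F \<beta> y. L1fam F \<longrightarrow> \<beta> \<in> I \<longrightarrow> y \<in> \<Theta> \<longrightarrow> \<bar>TT F \<beta> y\<bar> \<le> C * NN F" using TT_bounded by blast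
  then show ?thesis
    using assms by (intro integrable_mult_bounded(1)[of _ _ "C * NN F"] TT_measurable) (auto simp: L1fam_def)
qed

text \<open>Integrals against the kernel are approximated, uniformly in the densities, by finite sums over
  a net of points; this transfers symmetry and positivity from \<open>\<kappa>\<close> to \<open>BB\<close> without product measures.\<close>

definition SQ :: "(real ^ 'n) set \<Rightarrow> (('n \<Rightarrow> nat) \<times> (real ^ 'n) \<Rightarrow> real) \<Rightarrow> (('n \<Rightarrow> nat) \<times> (real ^ 'n) \<Rightarrow> real) \<Rightarrow> real" where
  "SQ Z c d = (\<Sum>a\<in>I \<times> Z. \<Sum>b\<in>I \<times> Z. c a * d b * \<kappa> (fst a) (fst b) (snd a) (snd b))"

lemma discretize:
  fixes e :: real
  assumes e: "e > 0"
  obtains Z and W :: "(real ^ 'n \<Rightarrow> real) \<Rightarrow> real ^ 'n \<Rightarrow> real" where "finite Z" "Z \<subseteq> \<Theta>"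
    "\<forall>F G. L1fam F \<longrightarrow> L1fam G \<longrightarrow>
       \<bar>BB F G - SQ Z (\<lambda>a. W (F (fst a)) (snd a)) (\<lambda>a. W (G (fst a)) (snd a))\<bar> \<le> e * NN F * NN G"
    "\<forall>F \<beta> y. L1fam F \<longrightarrow> \<beta> \<in> I \<longrightarrow> y \<in> \<Theta> \<longrightarrow>
       \<bar>TT F \<beta> y - (\<Sum>a\<in>I \<times> Z. W (F (fst a)) (snd a) * \<kappa> (fst a) \<beta> (snd a) y)\<bar> \<le> e * NN F"
proof -
  obtain d where d: "d > 0" "\<forall>\<alpha>\<in>I. \<forall>\<beta>\<in>I. \<forall>x\<in>\<Theta>. \<forall>x'\<in>\<Theta>. \<forall>y\<in>\<Theta>. \<forall>y'\<in>\<Theta>.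
    dist x x' < d \<and> dist y y' < d \<longrightarrow> \<bar>\<kappa> \<alpha> \<beta> x y - \<kappa> \<alpha> \<beta> x' y'\<bar> \<le> e" using \<kappa>_modulus[OF e] by blast
  have "compact (closure \<Theta>)" using bdd by simp
  \<comment> \<open>The centres are taken in the domain itself, where positivity of the kernel is
    available; balls around them still cover the closure.\<close>
  moreover have "closure \<Theta> \<subseteq> (\<Union>z\<in>\<Theta>. ball z d)"
    using d(1) by (auto simp: closure_approachable)
  ultimately obtain Z where Z: "Z \<subseteq> \<Theta>" "finite Z" "closure \<Theta> \<subseteq> (\<Union>z\<in>Z. ball z d)"
    using compactE_image[of "closure \<Theta>" \<Theta> "\<lambda>z. ball z d"] by auto
  obtain s where s: "\<forall>x\<in>(\<Union>z\<in>Z. ball z d). s x \<in> Z \<and> dist x (s x) < d" "\<And>w. {x. s x = w} \<in> sets borel"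
    using measurable_net_selection[OF Z(2)] by blast
  have sZ: "s x \<in> Z" "dist x (s x) < d" "s x \<in> \<Theta>" if "x \<in> \<Theta>" for x
    using s(1) Z closure_subset[of \<Theta>] that by blast+
  \<comment> \<open>The weight of the net point \<open>z\<close>: the mass of the density on the
    cell of points sent to \<open>z\<close>.\<close>
  define W where "W = (\<lambda>(F :: real ^ 'n \<Rightarrow> real) z. \<integral>x. indicator {x. s x = z} x * F x \<partial>M)"
  have ind: "indicator {x. s x = w} \<in> borel_measurable M" for w
    using s(2)[of w] by (intro measurable_restrict_space1 borel_measurable_indicator) simp
  have iW: "integrable M (\<lambda>x. indicator {x. s x = w} x * F x)" if "integrable M F" for F :: "real ^ 'n \<Rightarrow> real" and w
    by (rule integrable_mult_bounded(1)[OF that ind, of _ 1]) (simp add: indicator_def)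
  have Wsum: "integrable M (\<lambda>x. g (s x) * F x)" "(\<integral>x. g (s x) * F x \<partial>M) = (\<Sum>z\<in>Z. g z * W F z)"
    if F: "integrable M F" for F g :: "real ^ 'n \<Rightarrow> real"
  proof -
    have eq: "g (s x) * F x = (\<Sum>z\<in>Z. g z * (indicator {x. s x = z} x * F x))" if "x \<in> \<Theta>" for x
    proof -
      have "(\<Sum>z\<in>Z. g z * (indicator {x. s x = z} x * F x)) = (\<Sum>z\<in>Z. if s x = z then g z * F x else 0)"
        by (intro sum.cong) (auto simp: indicator_def)
      then show ?thesis using sZ(1)[OF that] Z(2) by simp
    qed
    have i: "integrable M (\<lambda>x. \<Sum>z\<in>Z. g z * (indicator {x. s x = z} x * F x))" using iW[OF F] by auto
    show "integrable M (\<lambda>x. g (s x) * F x)"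
      using i by (rule Bochner_Integration.integrable_cong[THEN iffD2, rotated -1]) (auto simp: eq)
    have "(\<integral>x. g (s x) * F x \<partial>M) = (\<integral>x. (\<Sum>z\<in>Z. g z * (indicator {x. s x = z} x * F x)) \<partial>M)"
      by (intro Bochner_Integration.integral_cong) (auto simp: eq)
    also have "\<dots> = (\<Sum>z\<in>Z. g z * W F z)" using iW[OF F] by (simp add: W_def)
    finally show "(\<integral>x. g (s x) * F x \<partial>M) = (\<Sum>z\<in>Z. g z * W F z)" .
  qed
  define TS where "TS = (\<lambda>F \<beta> y. \<Sum>a\<in>I \<times> Z. W (F (fst a)) (snd a) * \<kappa> (fst a) \<beta> (snd a) y)"
  have TS: "TS F \<beta> y = (\<Sum>\<alpha>\<in>I. \<integral>x. \<kappa> \<alpha> \<beta> (s x) y * F \<alpha> x \<partial>M)" if "L1fam F" for F \<beta> y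
    unfolding TS_def using that Wsum(2)[of _ "\<lambda>x. \<kappa> _ \<beta> x y"]
    by (simp add: sum.cartesian_product' L1fam_def mult.commute cong: sum.cong)
  \<comment> \<open>The second variable may move as well: \<open>y' = s y\<close> serves the
    estimate of \<open>BB\<close>, and \<open>y' = y\<close> the one of \<open>TT\<close>.\<close>
  have TTS: "\<bar>TT F \<beta> y - TS F \<beta> y'\<bar> \<le> e * NN F"
    if F: "L1fam F" and b: "\<beta> \<in> I" and y: "y \<in> \<Theta>" "y' \<in> \<Theta>" "dist y y' < d" for F \<beta> y y'
  proof -
    have i2: "integrable M (\<lambda>x. \<kappa> \<alpha> \<beta> (s x) y' * F \<alpha> x)" if "\<alpha> \<in> I" for \<alpha>
      using Wsum(1)[of "F \<alpha>" "\<lambda>x. \<kappa> \<alpha> \<beta> x y'"] F that by (simp add: L1fam_def)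
    have "TT F \<beta> y - TS F \<beta> y' = (\<Sum>\<alpha>\<in>I. \<integral>x. \<kappa> \<alpha> \<beta> x y * F \<alpha> x - \<kappa> \<alpha> \<beta> (s x) y' * F \<alpha> x \<partial>M)"
      unfolding TT_def TS[OF F] sum_subtractf[symmetric] using \<kappa>_integrable[OF F _ b y(1)] i2
      by (intro sum.cong refl) simp
    also have "\<bar>\<dots>\<bar> \<le> (\<Sum>\<alpha>\<in>I. \<bar>\<integral>x. \<kappa> \<alpha> \<beta> x y * F \<alpha> x - \<kappa> \<alpha> \<beta> (s x) y' * F \<alpha> x \<partial>M\<bar>)" by (rule sum_abs)
    also have "\<dots> \<le> (\<Sum>\<alpha>\<in>I. e * (\<integral>x. \<bar>F \<alpha> x\<bar> \<partial>M))"
    proof (rule sum_mono)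
      fix \<alpha> assume a: "\<alpha> \<in> I"
      have "\<bar>\<integral>x. \<kappa> \<alpha> \<beta> x y * F \<alpha> x - \<kappa> \<alpha> \<beta> (s x) y' * F \<alpha> x \<partial>M\<bar>
          \<le> (\<integral>x. \<bar>\<kappa> \<alpha> \<beta> x y * F \<alpha> x - \<kappa> \<alpha> \<beta> (s x) y' * F \<alpha> x\<bar> \<partial>M)" by (rule integral_abs_bound)
      also have "\<dots> \<le> (\<integral>x. e * \<bar>F \<alpha> x\<bar> \<partial>M)"
      proof (rule integral_mono)
        fix x assume "x \<in> space M"
        then have "\<bar>\<kappa> \<alpha> \<beta> x y - \<kappa> \<alpha> \<beta> (s x) y'\<bar> \<le> e" using d(2) a b y sZ[of x] by simp
        then show "\<bar>\<kappa> \<alpha> \<beta> x y * F \<alpha> x - \<kappa> \<alpha> \<beta> (s x) y' * F \<alpha> x\<bar> \<le> e * \<bar>F \<alpha> x\<bar>"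
          unfolding left_diff_distrib[symmetric] abs_mult by (rule mult_right_mono) simp
      qed (use \<kappa>_integrable[OF F a b y(1)] i2[OF a] F a in \<open>auto simp: L1fam_def\<close>)
      finally show "\<bar>\<integral>x. \<kappa> \<alpha> \<beta> x y * F \<alpha> x - \<kappa> \<alpha> \<beta> (s x) y' * F \<alpha> x \<partial>M\<bar> \<le> e * (\<integral>x. \<bar>F \<alpha> x\<bar> \<partial>M)" by simp
    qed
    finally show ?thesis by (simp add: NN_def sum_distrib_left)
  qed
  have "\<bar>BB F G - SQ Z (\<lambda>a. W (F (fst a)) (snd a)) (\<lambda>a. W (G (fst a)) (snd a))\<bar> \<le> e * NN F * NN G"
    if F: "L1fam F" and G: "L1fam G" for F G
  proof -
    have "SQ Z (\<lambda>a. W (F (fst a)) (snd a)) (\<lambda>a. W (G (fst a)) (snd a))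
        = (\<Sum>b\<in>I \<times> Z. TS F (fst b) (snd b) * W (G (fst b)) (snd b))"
      unfolding SQ_def TS_def by (subst sum.swap) (simp add: sum_distrib_left sum_distrib_right mult_ac)
    also have "\<dots> = (\<Sum>\<beta>\<in>I. \<integral>y. TS F \<beta> (s y) * G \<beta> y \<partial>M)"
      using G Wsum(2)[of _ "TS F _"] by (simp add: sum.cartesian_product' L1fam_def cong: sum.cong)
    finally have SQ: "SQ Z (\<lambda>a. W (F (fst a)) (snd a)) (\<lambda>a. W (G (fst a)) (snd a)) = \<dots>" .
    have i2: "integrable M (\<lambda>y. TS F \<beta> (s y) * G \<beta> y)" if "\<beta> \<in> I" for \<beta>
      using Wsum(1)[of "G \<beta>" "TS F \<beta>"] G that by (simp add: L1fam_def)
    have "BB F G - SQ Z (\<lambda>a. W (F (fst a)) (snd a)) (\<lambda>a. W (G (fst a)) (snd a))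
       = (\<Sum>\<beta>\<in>I. \<integral>y. TT F \<beta> y * G \<beta> y - TS F \<beta> (s y) * G \<beta> y \<partial>M)"
      unfolding BB_def SQ sum_subtractf[symmetric] using TT_mult_integrable[OF F G] i2
      by (intro sum.cong refl) simp
    also have "\<bar>\<dots>\<bar> \<le> (\<Sum>\<beta>\<in>I. \<bar>\<integral>y. TT F \<beta> y * G \<beta> y - TS F \<beta> (s y) * G \<beta> y \<partial>M\<bar>)" by (rule sum_abs)
    also have "\<dots> \<le> (\<Sum>\<beta>\<in>I. e * NN F * (\<integral>x. \<bar>G \<beta> x\<bar> \<partial>M))"
    proof (rule sum_mono)
      fix \<beta> assume b: "\<beta> \<in> I"
      have "\<bar>\<integral>y. TT F \<beta> y * G \<beta> y - TS F \<beta> (s y) * G \<beta> y \<partial>M\<bar>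
          \<le> (\<integral>y. \<bar>TT F \<beta> y * G \<beta> y - TS F \<beta> (s y) * G \<beta> y\<bar> \<partial>M)" by (rule integral_abs_bound)
      also have "\<dots> \<le> (\<integral>y. e * NN F * \<bar>G \<beta> y\<bar> \<partial>M)"
      proof (rule integral_mono)
        fix y assume "y \<in> space M"
        then have "\<bar>TT F \<beta> y - TS F \<beta> (s y)\<bar> \<le> e * NN F" using sZ[of y] by (intro TTS F b) auto
        then show "\<bar>TT F \<beta> y * G \<beta> y - TS F \<beta> (s y) * G \<beta> y\<bar> \<le> e * NN F * \<bar>G \<beta> y\<bar>"
          unfolding left_diff_distrib[symmetric] abs_mult by (rule mult_right_mono) simp
      qed (use TT_mult_integrable[OF F G b] i2[OF b] G b in \<open>auto simp: L1fam_def\<close>)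
      finally show "\<bar>\<integral>y. TT F \<beta> y * G \<beta> y - TS F \<beta> (s y) * G \<beta> y \<partial>M\<bar> \<le> e * NN F * (\<integral>x. \<bar>G \<beta> x\<bar> \<partial>M)" by simp
    qed
    also have "\<dots> = e * NN F * NN G" unfolding NN_def[of G] sum_distrib_left ..
    finally show ?thesis .
  qed
  moreover have "\<bar>TT F \<beta> y - TS F \<beta> y\<bar> \<le> e * NN F" if "L1fam F" "\<beta> \<in> I" "y \<in> \<Theta>" for F \<beta> y
    using TTS[OF that(1,2,3,3)] d(1) by simp
  ultimately show ?thesis unfolding TS_def by (intro that[of Z W, OF Z(2,1)]) blast+
qed

section \<open>Symmetry, positivity and weak derivatives of integrals against the kernel\<close>

lemma le_epsilon_mult:
  assumes "\<And>e. e > 0 \<Longrightarrow> a \<le> b + e * (c::real)" "c \<ge> 0"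
  shows "a \<le> b"
proof (rule field_le_epsilon)
  fix e :: real assume "e > 0"
  then have "a \<le> b + e / (c + 1) * c" using assms by (intro assms(1)) (simp add: add_nonneg_pos)
  also have "\<dots> \<le> b + e" using assms(2) \<open>e > 0\<close> by (simp add: field_simps)
  finally show "a \<le> b + e" .
qed

lemma SQ_commute: "Z \<subseteq> \<Theta> \<Longrightarrow> SQ Z c d = SQ Z d c"
  unfolding SQ_def
  by (subst sum.swap) (intro sum.cong refl, auto simp: subset_iff \<kappa>_sym[of _ _ _ _] mult.commute)

lemma BB_commute:
  assumes F: "L1fam F" and G: "L1fam G"
  shows "BB F G = BB G F"
proof -
  have le: "BB F G \<le> BB G F" if F: "L1fam F" and G: "L1fam G" for F G
  proof (rule le_epsilon_mult)
    fix e :: real assume "e > 0"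
    obtain Z W where Z: "finite Z" "Z \<subseteq> \<Theta>"
    "\<forall>F G. L1fam F \<longrightarrow> L1fam G \<longrightarrow>
       \<bar>BB F G - SQ Z (\<lambda>a. W (F (fst a)) (snd a)) (\<lambda>a. W (G (fst a)) (snd a))\<bar> \<le> e * NN F * NN G"
    "\<forall>F \<beta> y. L1fam F \<longrightarrow> \<beta> \<in> I \<longrightarrow> y \<in> \<Theta> \<longrightarrow>
       \<bar>TT F \<beta> y - (\<Sum>a\<in>I \<times> Z. W (F (fst a)) (snd a) * \<kappa> (fst a) \<beta> (snd a) y)\<bar> \<le> e * NN F"
      by (rule discretize[OF \<open>e > 0\<close>])
    show "BB F G \<le> BB G F + e * (2 * NN F * NN G)"
      using Z(3)[rule_format, OF F G] Z(3)[rule_format, OF G F] SQ_commute[OF Z(2), of "\<lambda>a. W (F (fst a)) (snd a)" "\<lambda>a. W (G (fst a)) (snd a)"]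
      by (simp add: abs_le_iff algebra_simps)
  qed simp
  show ?thesis using le[OF F G] le[OF G F] by simp
qed

text \<open>Positivity of the kernel at the net functionals minus one evaluation of order
  \<open>\<alpha>\<close> at \<open>x\<close>. As \<open>x\<close> may itself be a net point, the
  coefficients \<open>u\<close> and \<open>\<delta>\<close> live on a common index set and are kept
  apart until the square has been expanded.\<close>

lemma SQ_point:
  assumes "finite Z" "Z \<subseteq> \<Theta>" "\<alpha> \<in> I" "x \<in> \<Theta>"
  shows "0 \<le> SQ Z c c - 2 * (\<Sum>a\<in>I \<times> Z. c a * \<kappa> (fst a) \<alpha> (snd a) x) + \<kappa> \<alpha> \<alpha> x x"
proof -
  let ?A = "I \<times> insert x Z"
  define u where "u = (\<lambda>a. if snd a \<in> Z then c a else 0)"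
  define \<delta> where "\<delta> = (\<lambda>a. if a = (\<alpha>, x) then 1 else 0 :: real)"
  let ?K = "\<lambda>a b. \<kappa> (fst a) (fst b) (snd a) (snd b)"
  have fin: "finite ?A" using assms by simp
  have sub: "(\<Sum>a\<in>?A. u a * f a) = (\<Sum>a\<in>I \<times> Z. c a * f a)" for f
    by (rule sum.mono_neutral_cong_right) (use fin in \<open>auto simp: u_def\<close>)
  have del: "(\<Sum>a\<in>?A. \<delta> a * f a) = f (\<alpha>, x)" for f
  proof -
    have "(\<Sum>a\<in>?A. \<delta> a * f a) = (\<Sum>a\<in>?A. if a = (\<alpha>, x) then f a else 0)" by (intro sum.cong) (auto simp: \<delta>_def)
    then show ?thesis using fin assms by simp
  qed
  have "0 \<le> (\<Sum>a\<in>?A. \<Sum>b\<in>?A. (u a - \<delta> a) * (u b - \<delta> b) * ?K a b)"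
    using assms by (intro \<kappa>_pd) auto
  also have "\<dots> = (\<Sum>a\<in>?A. u a * (\<Sum>b\<in>?A. u b * ?K a b)) - (\<Sum>a\<in>?A. u a * (\<Sum>b\<in>?A. \<delta> b * ?K a b))
      - (\<Sum>a\<in>?A. \<delta> a * (\<Sum>b\<in>?A. u b * ?K a b)) + (\<Sum>a\<in>?A. \<delta> a * (\<Sum>b\<in>?A. \<delta> b * ?K a b))"
  proof -
    have "(u a - \<delta> a) * (u b - \<delta> b) * ?K a b =
       u a * (u b * ?K a b) - u a * (\<delta> b * ?K a b) - \<delta> a * (u b * ?K a b) + \<delta> a * (\<delta> b * ?K a b)" for a b
      by (simp add: algebra_simps)
    then show ?thesis by (simp only: sum.distrib sum_subtractf sum_distrib_left)
  qed
  also have "\<dots> = (\<Sum>a\<in>I \<times> Z. c a * (\<Sum>b\<in>I \<times> Z. c b * ?K a b)) - (\<Sum>a\<in>I \<times> Z. c a * ?K a (\<alpha>, x))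
      - (\<Sum>b\<in>I \<times> Z. c b * ?K (\<alpha>, x) b) + ?K (\<alpha>, x) (\<alpha>, x)"
    unfolding sub del ..
  also have "(\<Sum>b\<in>I \<times> Z. c b * ?K (\<alpha>, x) b) = (\<Sum>a\<in>I \<times> Z. c a * ?K a (\<alpha>, x))"
    using assms by (intro sum.cong refl arg_cong2[where f = "(*)"]) (auto intro!: \<kappa>_sym)
  also have "(\<Sum>a\<in>I \<times> Z. c a * (\<Sum>b\<in>I \<times> Z. c b * ?K a b)) = SQ Z c c"
    by (simp add: SQ_def sum_distrib_left mult.assoc)
  finally show ?thesis by simp
qed

lemma BB_nonneg:
  assumes F: "L1fam F"
  shows "0 \<le> BB F F"
proof (rule le_epsilon_mult)
  fix e :: real assume "e > 0"
  obtain Z W where Z: "finite Z" "Z \<subseteq> \<Theta>"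
    "\<forall>F G. L1fam F \<longrightarrow> L1fam G \<longrightarrow>
       \<bar>BB F G - SQ Z (\<lambda>a. W (F (fst a)) (snd a)) (\<lambda>a. W (G (fst a)) (snd a))\<bar> \<le> e * NN F * NN G"
    "\<forall>F \<beta> y. L1fam F \<longrightarrow> \<beta> \<in> I \<longrightarrow> y \<in> \<Theta> \<longrightarrow>
       \<bar>TT F \<beta> y - (\<Sum>a\<in>I \<times> Z. W (F (fst a)) (snd a) * \<kappa> (fst a) \<beta> (snd a) y)\<bar> \<le> e * NN F"
    by (rule discretize[OF \<open>e > 0\<close>])
  have "0 \<le> SQ Z c c" for c
    unfolding SQ_def using Z by (intro \<kappa>_pd) auto
  from Z(3)[rule_format, OF F F] this[of "\<lambda>a. W (F (fst a)) (snd a)"] show "0 \<le> BB F F + e * (NN F * NN F)"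
    by (simp add: abs_le_iff algebra_simps)
qed simp

text \<open>The continuous counterpart of \<open>SQ_point\<close>: a density combined with an
  evaluation. The error term collects one approximation of \<open>BB F F\<close> and two of the
  value of \<open>TT\<close>.\<close>

lemma BB_point:
  assumes F: "L1fam F" and x: "\<alpha> \<in> I" "x \<in> \<Theta>"
  shows "0 \<le> BB F F - 2 * TT F \<alpha> x + \<kappa> \<alpha> \<alpha> x x"
proof (rule le_epsilon_mult)
  fix e :: real assume "e > 0"
  obtain Z W where Z: "finite Z" "Z \<subseteq> \<Theta>"
    "\<forall>F G. L1fam F \<longrightarrow> L1fam G \<longrightarrow>
       \<bar>BB F G - SQ Z (\<lambda>a. W (F (fst a)) (snd a)) (\<lambda>a. W (G (fst a)) (snd a))\<bar> \<le> e * NN F * NN G"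
    "\<forall>F \<beta> y. L1fam F \<longrightarrow> \<beta> \<in> I \<longrightarrow> y \<in> \<Theta> \<longrightarrow>
       \<bar>TT F \<beta> y - (\<Sum>a\<in>I \<times> Z. W (F (fst a)) (snd a) * \<kappa> (fst a) \<beta> (snd a) y)\<bar> \<le> e * NN F"
    by (rule discretize[OF \<open>e > 0\<close>])
  show "0 \<le> BB F F - 2 * TT F \<alpha> x + \<kappa> \<alpha> \<alpha> x x + e * (NN F * NN F + 2 * NN F)"
    using Z(3)[rule_format, OF F F] Z(4)[rule_format, OF F x] SQ_point[OF Z(1,2) x, of "\<lambda>a. W (F (fst a)) (snd a)"]
    by (simp add: abs_le_iff algebra_simps)
qed simp

lemma TT_linear:
  assumes "L1fam F" "L1fam G" "\<beta> \<in> I" "y \<in> \<Theta>"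
  shows "TT (\<lambda>\<alpha> x. a * F \<alpha> x + b * G \<alpha> x) \<beta> y = a * TT F \<beta> y + b * TT G \<beta> y"
proof -
  have "(\<integral>x. \<kappa> \<alpha> \<beta> x y * (a * F \<alpha> x + b * G \<alpha> x) \<partial>M) =
     a * (\<integral>x. \<kappa> \<alpha> \<beta> x y * F \<alpha> x \<partial>M) + b * (\<integral>x. \<kappa> \<alpha> \<beta> x y * G \<alpha> x \<partial>M)" if "\<alpha> \<in> I" for \<alpha>
    using \<kappa>_integrable[OF assms(1) that assms(3,4)] \<kappa>_integrable[OF assms(2) that assms(3,4)]
    by (simp add: distrib_left mult.left_commute[of _ a] mult.left_commute[of _ b])
  then show ?thesis unfolding TT_def by (simp add: sum.distrib sum_distrib_left)
qed

lemma BB_linear: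
  assumes "L1fam F" "L1fam G" "L1fam U"
  shows "BB (\<lambda>\<alpha> x. a * F \<alpha> x + b * G \<alpha> x) U = a * BB F U + b * BB G U"
proof -
  have "(\<integral>y. TT (\<lambda>\<alpha> x. a * F \<alpha> x + b * G \<alpha> x) \<beta> y * U \<beta> y \<partial>M) =
     a * (\<integral>y. TT F \<beta> y * U \<beta> y \<partial>M) + b * (\<integral>y. TT G \<beta> y * U \<beta> y \<partial>M)" if b: "\<beta> \<in> I" for \<beta>
  proof -
    have "(\<integral>y. TT (\<lambda>\<alpha> x. a * F \<alpha> x + b * G \<alpha> x) \<beta> y * U \<beta> y \<partial>M) =
       (\<integral>y. a * (TT F \<beta> y * U \<beta> y) + b * (TT G \<beta> y * U \<beta> y) \<partial>M)"
      using TT_linear[OF assms(1,2) b] by (intro Bochner_Integration.integral_cong) (auto simp: algebra_simps)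
    then show ?thesis using TT_mult_integrable[OF assms(1,3) b] TT_mult_integrable[OF assms(2,3) b] by simp
  qed
  then show ?thesis unfolding BB_def by (simp add: sum.distrib sum_distrib_left)
qed

lemma TT_cong_AE:
  assumes "\<And>\<alpha>. \<alpha> \<in> I \<Longrightarrow> AE x in M. F \<alpha> x = G \<alpha> x"
  shows "TT F \<beta> y = TT G \<beta> y"
  unfolding TT_def
proof (intro sum.cong refl integral_cong_AE_lebesgue_on(1)[OF meas])
  fix \<alpha> assume "\<alpha> \<in> I"
  then have "AE x in M. F \<alpha> x = G \<alpha> x" by (rule assms)
  then show "AE x in M. \<kappa> \<alpha> \<beta> x y * F \<alpha> x = \<kappa> \<alpha> \<beta> x y * G \<alpha> x" by eventually_elim simp
qed

lemma BB_cong_AE: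
  assumes "\<And>\<alpha>. \<alpha> \<in> I \<Longrightarrow> AE x in M. F \<alpha> x = G \<alpha> x"
  shows "BB F U = BB G U"
  unfolding BB_def using TT_cong_AE[OF assms] by simp

text \<open>Duality takes the place of differentiation under the integral. Pairing with a test
  function is \<open>BB\<close> with a family having a single component; symmetry of
  \<open>BB\<close> moves the test function onto the kernel, whose derivative in that variable is
  known to be weak.\<close>

lemma TT_weak_deriv:
  assumes F: "L1fam F" and b: "\<beta> \<in> I"
  shows "has_weak_deriv \<Theta> \<beta> (TT F (\<lambda>_. 0)) (TT F \<beta>)"
  unfolding has_weak_deriv_def
proof (intro conjI allI impI continuous_imp_locally_integrable TT_continuous F b zero_in_I)
  fix \<phi> assume \<phi>: "test_function \<Theta> \<phi>"
  let ?z = "\<lambda>_::'n. 0::nat"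
  let ?D = "mi_partial dir \<beta> \<phi>"
  define single where "single = (\<lambda>(\<gamma>::'n \<Rightarrow> nat) (f :: real ^ 'n \<Rightarrow> real) \<alpha>. if \<alpha> = \<gamma> then f else (\<lambda>x. 0))"
  have one: "locally_integrable \<Theta> (\<lambda>x. 1)" by (intro continuous_imp_locally_integrable) auto
  have int: "integrable M ?D" "integrable M \<phi>"
    using integrable_mult_test_function[OF op one \<phi>] by auto
  have S: "L1fam (single \<gamma> f)" if "integrable M f" for \<gamma> f using that by (auto simp: L1fam_def single_def)
  have BS: "BB F (single \<gamma> f) = (\<integral>y. TT F \<gamma> y * f y \<partial>M)" if "\<gamma> \<in> I" for \<gamma> f
  proof -
    have "BB F (single \<gamma> f) = (\<Sum>\<alpha>\<in>I. if \<alpha> = \<gamma> then (\<integral>y. TT F \<gamma> y * f y \<partial>M) else 0)"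
      unfolding BB_def by (intro sum.cong) (auto simp: single_def)
    then show ?thesis using that by simp
  qed
  have TS: "TT (single \<gamma> f) \<alpha> y = (\<integral>x. \<kappa> \<gamma> \<alpha> x y * f x \<partial>M)" if "\<gamma> \<in> I" for \<gamma> f \<alpha> y
  proof -
    have "TT (single \<gamma> f) \<alpha> y = (\<Sum>\<alpha>'\<in>I. if \<alpha>' = \<gamma> then (\<integral>x. \<kappa> \<gamma> \<alpha> x y * f x \<partial>M) else 0)"
      unfolding TT_def by (intro sum.cong) (auto simp: single_def)
    then show ?thesis using that by simp
  qed
  have "(\<integral>y. TT F ?z y * ?D y \<partial>M) = BB (single ?z ?D) F"
    using BS[OF zero_in_I, of ?D] BB_commute[OF F S[OF int(1), of ?z]] by simp
  also have "\<dots> = (\<Sum>\<alpha>\<in>I. \<integral>y. (- 1) ^ mi_order \<beta> * (TT (single \<beta> \<phi>) \<alpha> y * F \<alpha> y) \<partial>M)"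
    unfolding BB_def
  proof (intro sum.cong refl Bochner_Integration.integral_cong)
    fix \<alpha> y assume "\<alpha> \<in> I" "y \<in> space M"
    then show "TT (single ?z ?D) \<alpha> y * F \<alpha> y = (- 1) ^ mi_order \<beta> * (TT (single \<beta> \<phi>) \<alpha> y * F \<alpha> y)"
      using \<kappa>_weak_deriv[OF _ b, of \<alpha> y] \<phi> by (simp add: TS b has_weak_deriv_def)
  qed
  also have "\<dots> = (- 1) ^ mi_order \<beta> * BB (single \<beta> \<phi>) F" by (simp add: BB_def sum_distrib_left)
  also have "BB (single \<beta> \<phi>) F = (\<integral>y. TT F \<beta> y * \<phi> y \<partial>M)"
    using BS[OF b, of \<phi>] BB_commute[OF F S[OF int(2), of \<beta>]] by simp
  finally show "(\<integral>y. TT F ?z y * ?D y \<partial>M) = (- 1) ^ mi_order \<beta> * (\<integral>y. TT F \<beta> y * \<phi> y \<partial>M)" .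
qed

end

section \<open>Compactness and the Mercer expansion\<close>

text \<open>Uniformly continuous functions extend to the compact closure, where the common bound and
  the common modulus persist by approximation from inside the domain.\<close>

lemma Arzela_Ascoli_bounded_domain:
  fixes v :: "nat \<Rightarrow> real ^ 'n::finite \<Rightarrow> real"
  assumes bdd: "bounded \<Theta>" and M: "\<And>n x. x \<in> \<Theta> \<Longrightarrow> \<bar>v n x\<bar> \<le> M"
    and eq: "\<And>e. e > 0 \<Longrightarrow> \<exists>d>0. \<forall>n. \<forall>x\<in>\<Theta>. \<forall>y\<in>\<Theta>. dist x y < d \<longrightarrow> \<bar>v n x - v n y\<bar> \<le> e"
  shows "\<exists>(r :: nat \<Rightarrow> nat) g. strict_mono r \<and> uniform_limit \<Theta> (\<lambda>n. v (r n)) g sequentially"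
proof -
  have "uniformly_continuous_on \<Theta> (v n)" for n
    unfolding uniformly_continuous_on_def
  proof (intro allI impI)
    fix e :: real assume "e > 0"
    then obtain d where "d > 0" "\<forall>x\<in>\<Theta>. \<forall>y\<in>\<Theta>. dist x y < d \<longrightarrow> \<bar>v n x - v n y\<bar> \<le> e / 2"
      using eq[of "e / 2"] by auto
    moreover from this have "dist (v n y) (v n x) < e" if "x \<in> \<Theta>" "y \<in> \<Theta>" "dist y x < d" for x y
    proof -
      have "\<bar>v n y - v n x\<bar> \<le> e / 2" using calculation that by blast
      then show ?thesis using \<open>e > 0\<close> by (simp add: dist_real_def)
    qed
    ultimately show "\<exists>d>0. \<forall>x\<in>\<Theta>. \<forall>y\<in>\<Theta>. dist y x < d \<longrightarrow> dist (v n y) (v n x) < e" by blast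
  qed
  then have "\<exists>V. uniformly_continuous_on (closure \<Theta>) V \<and> (\<forall>x\<in>\<Theta>. v n x = V x)" for n
    using uniformly_continuous_on_extension_on_closure[of \<Theta> "v n"] by metis
  then obtain V where V: "\<And>n. uniformly_continuous_on (closure \<Theta>) (V n)" "\<And>n x. x \<in> \<Theta> \<Longrightarrow> v n x = V n x"
    by metis
  have cV: "continuous_on (closure \<Theta>) (V n)" for n by (rule uniformly_continuous_imp_continuous[OF V(1)])
  have approx: "\<exists>xs. (\<forall>i::nat. xs i \<in> \<Theta>) \<and> xs \<longlonglongrightarrow> x \<and> (\<forall>n. (\<lambda>i. v n (xs i)) \<longlonglongrightarrow> V n x)" if x: "x \<in> closure \<Theta>" for x
  proof -
    obtain xs where xs: "\<And>i::nat. xs i \<in> \<Theta>" "xs \<longlonglongrightarrow> x" using x unfolding closure_sequential by blast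
    have "(\<lambda>i. V n (xs i)) \<longlonglongrightarrow> V n x" for n
      using xs(1) closure_subset[of \<Theta>]
      by (intro continuous_on_tendsto_compose[OF cV xs(2) x] always_eventually allI) blast
    then show ?thesis using xs V(2) by (intro exI[of _ xs]) simp
  qed
  have "compact (closure \<Theta>)" using bdd by simp
  then obtain g r where gr: "strict_mono (r :: nat \<Rightarrow> nat)"
    "\<And>e. 0 < e \<Longrightarrow> \<exists>N. \<forall>n x. n \<ge> N \<and> x \<in> closure \<Theta> \<longrightarrow> norm (V (r n) x - g x) < e"
  proof (rule Arzela_Ascoli[of "closure \<Theta>" V M])
    fix n x assume x: "x \<in> closure \<Theta>"
    obtain xs where xs: "\<And>i::nat. xs i \<in> \<Theta>" "\<And>n. (\<lambda>i. v n (xs i)) \<longlonglongrightarrow> V n x" using approx[OF x] by blast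
    show "norm (V n x) \<le> M"
      using M[OF xs(1)] by (intro LIMSEQ_le_const2[OF tendsto_norm[OF xs(2)]]) auto
  next
    fix x e assume x: "x \<in> closure \<Theta>" and e: "(0::real) < e"
    \<comment> \<open>Half of \<open>e\<close>, since the estimate passes to the closure only as a
      weak inequality.\<close>
    obtain d where d: "d > 0" "\<And>n x y. \<lbrakk>x \<in> \<Theta>; y \<in> \<Theta>; dist x y < d\<rbrakk> \<Longrightarrow> \<bar>v n x - v n y\<bar> \<le> e / 2"
      using eq[of "e / 2"] e by auto
    have "norm (V n x - V n y) < e" if y: "y \<in> closure \<Theta>" "norm (x - y) < d" for n y
    proof -
      obtain xs where xs: "\<And>i::nat. xs i \<in> \<Theta>" "xs \<longlonglongrightarrow> x" "\<And>n. (\<lambda>i. v n (xs i)) \<longlonglongrightarrow> V n x" using approx[OF x] by blast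
      obtain ys where ys: "\<And>i::nat. ys i \<in> \<Theta>" "ys \<longlonglongrightarrow> y" "\<And>n. (\<lambda>i. v n (ys i)) \<longlonglongrightarrow> V n y" using approx[OF y(1)] by blast
      have "(\<lambda>i. dist (xs i) (ys i)) \<longlonglongrightarrow> dist x y" by (intro tendsto_dist xs ys)
      then have "\<forall>\<^sub>F i in sequentially. dist (xs i) (ys i) < d"
        using y(2) by (intro order_tendstoD) (auto simp: dist_norm)
      then have ev: "\<forall>\<^sub>F i in sequentially. \<bar>v n (xs i) - v n (ys i)\<bar> \<le> e / 2"
        by eventually_elim (rule d(2)[OF xs(1) ys(1)])
      have "(\<lambda>i. \<bar>v n (xs i) - v n (ys i)\<bar>) \<longlonglongrightarrow> \<bar>V n x - V n y\<bar>"
        by (intro tendsto_rabs tendsto_diff xs ys)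
      then have "\<bar>V n x - V n y\<bar> \<le> e / 2" by (rule tendsto_upperbound[OF _ ev]) simp
      then show ?thesis using e by simp
    qed
    then show "\<exists>d>0. \<forall>n y. y \<in> closure \<Theta> \<and> norm (x - y) < d \<longrightarrow> norm (V n x - V n y) < e"
      using d(1) by blast
  qed auto
  have "uniform_limit \<Theta> (\<lambda>n. v (r n)) g sequentially"
    unfolding uniform_limit_sequentially_iff dist_real_def
    using gr(2) V(2) closure_subset[of \<Theta>] by (simp add: subset_iff) meson
  then show ?thesis using gr(1) by blast
qed

text \<open>The set where a continuous function is nonzero is open in the domain, and a nonempty
  open set is not negligible.\<close>

lemma continuous_AE_zero_imp_zero:
  fixes f :: "real ^ 'n::finite \<Rightarrow> real"
  assumes op: "open \<Theta>" and f: "continuous_on \<Theta> f" and z: "AE x in lebesgue_on \<Theta>. f x = 0" and x: "x \<in> \<Theta>"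
  shows "f x = 0"
proof (rule ccontr)
  assume ne: "f x \<noteq> 0"
  have "open (\<Theta> \<inter> f -` (- {0}))" by (rule continuous_open_preimage[OF f op]) auto
  moreover have "\<Theta> \<inter> f -` (- {0}) = {x \<in> \<Theta>. f x \<noteq> 0}" by auto
  ultimately have "open {x \<in> \<Theta>. f x \<noteq> 0}" by simp
  moreover have "negligible {x \<in> \<Theta>. f x \<noteq> 0}" using z op by (simp add: AE_lebesgue_on_iff borel_open)
  ultimately have "{x \<in> \<Theta>. f x \<noteq> 0} = {}" using open_not_negligible by blast
  then show False using x ne by blast
qed

lemma continuous_rep_eqI:
  fixes \<Theta> :: "(real ^ 'n::finite) set"
  assumes op: "open \<Theta>" and g: "continuous_on \<Theta> g" "\<And>x. x \<notin> \<Theta> \<Longrightarrow> g x = 0" "AE x in lebesgue_on \<Theta>. g x = f x"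
  shows "continuous_rep \<Theta> f = g"
  unfolding continuous_rep_def
proof (rule the_equality)
  fix g' assume g': "continuous_on \<Theta> g' \<and> (\<forall>x. x \<notin> \<Theta> \<longrightarrow> g' x = 0) \<and> (AE x in lebesgue_on \<Theta>. g' x = f x)"
  have "AE x in lebesgue_on \<Theta>. g' x = f x" using g' by blast
  with g(3) have "AE x in lebesgue_on \<Theta>. g' x - g x = 0" by eventually_elim simp
  then have "g' x - g x = 0" if "x \<in> \<Theta>" for x
    using g' g(1) that by (intro continuous_AE_zero_imp_zero[OF op, of "\<lambda>x. g' x - g x"]) (auto intro: continuous_on_diff)
  then show "g' = g" using g' g(2) by (metis eq_iff_diff_eq_0 ext)
qed (use g in auto)

text \<open>Links the unordered sums over \<open>J\<close> with the expansions, whose partial sums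
  run over initial segments of \<open>J\<close>.\<close>

lemma infsum_LIMSEQ_atMost:
  fixes f :: "nat \<Rightarrow> real"
  assumes "f summable_on J"
  shows "(\<lambda>n. \<Sum>j\<in>J \<inter> {..n}. f j) \<longlonglongrightarrow> infsum f J"
proof -
  have "(f has_sum infsum f J) J" using assms by (rule has_sum_infsum)
  then have "((\<lambda>F. \<Sum>j\<in>F. f j) \<longlongrightarrow> infsum f J) (finite_subsets_at_top J)" by (simp add: has_sum_def)
  moreover have "filterlim (\<lambda>n. J \<inter> {..n}) (finite_subsets_at_top J) sequentially"
    unfolding filterlim_finite_subsets_at_top
  proof (intro allI impI)
    fix X assume X: "finite X \<and> X \<subseteq> J"
    then obtain m where "X \<subseteq> {..m}" using finite_nat_iff_bounded_le by blast
    then show "\<forall>\<^sub>F n in sequentially. finite (J \<inter> {..n}) \<and> X \<subseteq> J \<inter> {..n} \<and> J \<inter> {..n} \<subseteq> J"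
      using X by (auto simp: eventually_sequentially intro!: exI[of _ m])
  qed
  ultimately show ?thesis by (rule filterlim_compose)
qed

lemma ell2_tail:
  fixes J :: "nat set"
  assumes "c \<in> ell2 J"
  shows "(\<lambda>n. ell2.nrm (J - {..n}) c) \<longlonglongrightarrow> 0"
proof -
  have s: "(\<lambda>j. (c j)\<^sup>2) summable_on J" using assms by (simp add: ell2_def)
  have "(ell2.nrm (J - {..n}) c)\<^sup>2 = infsum (\<lambda>j. (c j)\<^sup>2) J - (\<Sum>j\<in>J \<inter> {..n}. (c j)\<^sup>2)" for n
  proof -
    have "c \<in> ell2 (J - {..n})" using s by (auto simp: ell2_def intro: summable_on_subset_banach)
    then have "(ell2.nrm (J - {..n}) c)\<^sup>2 = infsum (\<lambda>j. (c j)\<^sup>2) (J - {..n})"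
      by (subst ell2.nrm_sq) (auto simp: power2_eq_square)
    also have "\<dots> = infsum (\<lambda>j. (c j)\<^sup>2) (J - (J \<inter> {..n}))" by (rule arg_cong[of _ _ "infsum _"]) auto
    also have "\<dots> = infsum (\<lambda>j. (c j)\<^sup>2) J - infsum (\<lambda>j. (c j)\<^sup>2) (J \<inter> {..n})"
      by (rule infsum_Diff) (use s in auto)
    finally show ?thesis by simp
  qed
  moreover have "(\<lambda>n. infsum (\<lambda>j. (c j)\<^sup>2) J - (\<Sum>j\<in>J \<inter> {..n}. (c j)\<^sup>2)) \<longlonglongrightarrow> infsum (\<lambda>j. (c j)\<^sup>2) J - infsum (\<lambda>j. (c j)\<^sup>2) J"
    by (intro tendsto_diff tendsto_const infsum_LIMSEQ_atMost s)
  ultimately have "(\<lambda>n. (ell2.nrm (J - {..n}) c)\<^sup>2) \<longlonglongrightarrow> 0" by simp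
  then show ?thesis by simp
qed

section \<open>The kernel operator on the Sobolev space\<close>

context Ckk_kernel
begin

abbreviation T where "T \<equiv> kernel_op k \<Theta> h"
abbreviation ip where "ip \<equiv> Hk_inner k \<Theta>"

lemma I_iff: "\<alpha> \<in> I \<longleftrightarrow> mi_order \<alpha> \<le> k" by (simp add: I_def)

lemma Der_L2: "\<lbrakk>f \<in> Hk k \<Theta>; \<alpha> \<in> I\<rbrakk> \<Longrightarrow> Der f \<alpha> \<in> L2 \<Theta>"
  by (simp add: I_iff Hk_weak_deriv(2))

lemma L1fam_Der: "f \<in> Hk k \<Theta> \<Longrightarrow> L1fam (Der f)"
  by (auto simp: L1fam_def intro: L2_integrable Der_L2)

text \<open>Sum and integral are exchanged, which rests on the bounds for the kernel inside the
  domain; values of \<open>T f\<close> elsewhere are irrelevant to its class.\<close>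

lemma T_eq:
  assumes "f \<in> Hk k \<Theta>" "y \<in> \<Theta>"
  shows "T f y = TT (Der f) (\<lambda>_. 0) y"
  using \<kappa>_integrable[OF L1fam_Der[OF assms(1)] _ zero_in_I assms(2)]
  by (simp add: kernel_op_def TT_def \<kappa>_def I_def)

lemma T_weak_deriv:
  assumes f: "f \<in> Hk k \<Theta>" and b: "\<beta> \<in> I"
  shows "has_weak_deriv \<Theta> \<beta> (T f) (TT (Der f) \<beta>)"
proof -
  have "AE x in M. T f x = TT (Der f) (\<lambda>_. 0) x" using T_eq[OF f] by (intro AE_I2) simp
  then show ?thesis
    using has_weak_deriv_cong_AE[OF op, of "T f" _ "TT (Der f) \<beta>" "TT (Der f) \<beta>" \<beta>] TT_weak_deriv[OF L1fam_Der[OF f] b] by blast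
qed

lemma T_in:
  assumes f: "f \<in> Hk k \<Theta>"
  shows "T f \<in> Hk k \<Theta>"
proof (rule HkI)
  have "AE x in M. T f x = TT (Der f) (\<lambda>_. 0) x" using T_eq[OF f] by (intro AE_I2) simp
  then show "T f \<in> L2 \<Theta>" using L2_cong_AE TT_L2[OF L1fam_Der[OF f] zero_in_I] by blast
qed (use f T_weak_deriv TT_L2 L1fam_Der I_iff in auto)

lemma T_inner:
  assumes "f \<in> Hk k \<Theta>" "g \<in> Hk k \<Theta>"
  shows "ip (T f) g = BB (Der f) (Der g)"
  using Hk_inner_weak[OF T_weak_deriv[OF assms(1)] Hk_weak_deriv(1)[OF assms(2)]]
  by (simp add: BB_def L2_inner_def I_def)

lemma Der_linear:
  assumes "f \<in> Hk k \<Theta>" "g \<in> Hk k \<Theta>" "\<alpha> \<in> I"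
  shows "AE x in M. Der (\<lambda>x. a * f x + b * g x) \<alpha> x = a * Der f \<alpha> x + b * Der g \<alpha> x"
  using assms by (intro Hk_linear(2)) (auto simp: I_iff)

text \<open>Symmetry and positivity are those of \<open>BB\<close>; linearity comes from linearity
  of weak derivatives up to null sets.\<close>

lemma T_form: "function_semi_inner (Hk k \<Theta>) (\<lambda>f g. ip (T f) g)"
proof
  fix f g u :: "real ^ 'n \<Rightarrow> real" and c :: real
  show "(\<lambda>x. 0) \<in> Hk k \<Theta>" by (rule Hk.zero_in)
  assume f: "f \<in> Hk k \<Theta>"
  show "(\<lambda>x. c * f x) \<in> Hk k \<Theta>" by (rule Hk.scale_in[OF f])
  show "0 \<le> ip (T f) f" by (simp add: T_inner f BB_nonneg L1fam_Der)
  assume g: "g \<in> Hk k \<Theta>"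
  show "(\<lambda>x. f x + g x) \<in> Hk k \<Theta>" by (rule Hk.add_in[OF f g])
  show "ip (T f) g = ip (T g) f" using f g by (simp add: T_inner BB_commute L1fam_Der)
  have lin: "ip (T (\<lambda>x. a * f x + b * v x)) u = a * ip (T f) u + b * ip (T v) u"
    if "v \<in> Hk k \<Theta>" "u \<in> Hk k \<Theta>" for a b v u
  proof -
    have "BB (Der (\<lambda>x. a * f x + b * v x)) (Der u) = BB (\<lambda>\<alpha> x. a * Der f \<alpha> x + b * Der v \<alpha> x) (Der u)"
      by (intro BB_cong_AE Der_linear f that)
    also have "\<dots> = a * BB (Der f) (Der u) + b * BB (Der v) (Der u)"
      by (intro BB_linear L1fam_Der f that)
    finally show ?thesis using f that by (simp add: T_inner Hk_linear(1))
  qed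
  show "ip (T (\<lambda>x. c * f x)) g = c * ip (T f) g" using lin[OF f g, of c 0] by simp
  assume u: "u \<in> Hk k \<Theta>"
  show "ip (T (\<lambda>x. f x + g x)) u = ip (T f) u + ip (T g) u" using lin[OF g u, of 1 1] by simp
qed

sublocale B: function_semi_inner "Hk k \<Theta>" "\<lambda>f g. ip (T f) g"
  by (rule T_form)

lemma NN_Der_le:
  assumes f: "f \<in> Hk k \<Theta>"
  shows "NN (Der f) \<le> card I * sqrt (measure M \<Theta>) * Hk.nrm k f"
proof -
  have "(\<integral>x. \<bar>Der f \<alpha> x\<bar> \<partial>M) \<le> sqrt (measure M \<Theta>) * Hk.nrm k f" if "\<alpha> \<in> I" for \<alpha>
  proof -
    have "(\<integral>x. \<bar>Der f \<alpha> x\<bar> \<partial>M) \<le> sqrt (measure M \<Theta>) * L2.nrm (Der f \<alpha>)" by (rule L2_L1[OF Der_L2[OF f that]])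
    also have "\<dots> \<le> sqrt (measure M \<Theta>) * Hk.nrm k f"
      using that f by (intro mult_left_mono L2_nrm_weak_deriv_le) (auto simp: I_iff)
    finally show ?thesis .
  qed
  then have "NN (Der f) \<le> (\<Sum>\<alpha>\<in>I. sqrt (measure M \<Theta>) * Hk.nrm k f)"
    unfolding NN_def by (rule sum_mono)
  then show ?thesis by simp
qed

text \<open>The Sobolev norm controls the L^1 sizes of the derivatives, and these control the
  uniform norms of all derivatives of \<open>T f\<close>. This gain gives boundedness and half of
  what compactness needs.\<close>

lemma TT_Der_bounded: "\<exists>C>0. \<forall>f\<in>Hk k \<Theta>. \<forall>\<beta>\<in>I. \<forall>y\<in>\<Theta>. \<bar>TT (Der f) \<beta> y\<bar> \<le> C * Hk.nrm k f"
proof -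
  obtain C where C: "C > 0" "\<forall>F \<beta> y. L1fam F \<longrightarrow> \<beta> \<in> I \<longrightarrow> y \<in> \<Theta> \<longrightarrow> \<bar>TT F \<beta> y\<bar> \<le> C * NN F"
    using TT_bounded by blast
  define D where "D = C * (card I * sqrt (measure M \<Theta>) + 1)"
  have "\<bar>TT (Der f) \<beta> y\<bar> \<le> D * Hk.nrm k f" if "f \<in> Hk k \<Theta>" "\<beta> \<in> I" "y \<in> \<Theta>" for f \<beta> y
  proof -
    have "\<bar>TT (Der f) \<beta> y\<bar> \<le> C * NN (Der f)" using C that L1fam_Der by blast
    also have "\<dots> \<le> C * (card I * sqrt (measure M \<Theta>) * Hk.nrm k f)"
      using C NN_Der_le[OF that(1)] by (intro mult_left_mono) auto
    also have "\<dots> \<le> D * Hk.nrm k f" using C Hk.nrm_nonneg[OF that(1)] by (simp add: D_def algebra_simps)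
    finally show ?thesis .
  qed
  moreover have "D > 0" using C by (simp add: D_def add_nonneg_pos)
  ultimately show ?thesis by blast
qed

lemma T_bounded: "\<exists>C. \<forall>f\<in>Hk k \<Theta>. Hk.nrm k (T f) \<le> C * Hk.nrm k f"
proof -
  obtain C where C: "C > 0" "\<forall>f\<in>Hk k \<Theta>. \<forall>\<beta>\<in>I. \<forall>y\<in>\<Theta>. \<bar>TT (Der f) \<beta> y\<bar> \<le> C * Hk.nrm k f"
    using TT_Der_bounded by blast
  have "Hk.nrm k (T f) \<le> (sqrt (card I * measure M \<Theta>) * C) * Hk.nrm k f" if f: "f \<in> Hk k \<Theta>" for f
  proof -
    have "ip (T f) (T f) = (\<Sum>\<beta>\<in>I. L2_inner \<Theta> (TT (Der f) \<beta>) (TT (Der f) \<beta>))"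
      using Hk_inner_weak[OF T_weak_deriv[OF f] T_weak_deriv[OF f]] by (simp add: I_def)
    also have "\<dots> \<le> (\<Sum>\<beta>\<in>I. (C * Hk.nrm k f)\<^sup>2 * measure M \<Theta>)"
      using C f by (intro sum_mono L2_bounded(2) TT_measurable L1fam_Der) auto
    also have "\<dots> = (card I * measure M \<Theta>) * (C * Hk.nrm k f)\<^sup>2" by simp
    finally have "Hk.nrm k (T f) \<le> sqrt ((card I * measure M \<Theta>) * (C * Hk.nrm k f)\<^sup>2)"
      unfolding Hk.nrm_def[of k "T f"] by (rule real_sqrt_le_mono)
    also have "\<dots> = (sqrt (card I * measure M \<Theta>) * C) * Hk.nrm k f"
      using C Hk.nrm_nonneg[OF f] by (simp add: real_sqrt_mult)
    finally show ?thesis .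
  qed
  then show ?thesis by blast
qed

text \<open>The modulus of continuity of the kernel makes the derivatives of the images
  equicontinuous, uniformly over the unit ball. Subsequences are extracted for one multi-index after
  another, and uniform convergence of all derivatives gives a Sobolev limit.\<close>

lemma T_compact:
  assumes w: "\<And>n::nat. w n \<in> Hk k \<Theta> \<and> Hk.nrm k (w n) \<le> 1"
  shows "\<exists>r g. strict_mono r \<and> g \<in> Hk k \<Theta> \<and> (\<lambda>n::nat. Hk.nrm k (\<lambda>x. T (w (r n)) x - g x)) \<longlonglongrightarrow> 0"
proof -
  let ?v = "\<lambda>n \<beta>. TT (Der (w n)) \<beta>"
  obtain C where C: "C > 0" "\<forall>f\<in>Hk k \<Theta>. \<forall>\<beta>\<in>I. \<forall>y\<in>\<Theta>. \<bar>TT (Der f) \<beta> y\<bar> \<le> C * Hk.nrm k f"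
    using TT_Der_bounded by blast
  have b: "\<bar>?v n \<beta> y\<bar> \<le> C" if "\<beta> \<in> I" "y \<in> \<Theta>" for n \<beta> y
  proof -
    have "\<bar>?v n \<beta> y\<bar> \<le> C * Hk.nrm k (w n)" using C w that by blast
    also have "\<dots> \<le> C * 1" using C w[of n] by (intro mult_left_mono) auto
    finally show ?thesis by simp
  qed
  define N where "N = card I * sqrt (measure M \<Theta>) + 1"
  have N: "N > 0" by (simp add: N_def add_nonneg_pos)
  have NN: "NN (Der (w n)) \<le> N" for n
  proof -
    have "NN (Der (w n)) \<le> card I * sqrt (measure M \<Theta>) * Hk.nrm k (w n)" by (rule NN_Der_le) (use w in auto)
    also have "\<dots> \<le> card I * sqrt (measure M \<Theta>) * 1" using w[of n] by (intro mult_left_mono) auto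
    finally show ?thesis by (simp add: N_def)
  qed
  have ec: "\<exists>d>0. \<forall>n. \<forall>x\<in>\<Theta>. \<forall>y\<in>\<Theta>. dist x y < d \<longrightarrow> \<bar>?v n \<beta> x - ?v n \<beta> y\<bar> \<le> e"
    if "e > 0" and bI: "\<beta> \<in> I" for e \<beta>
  proof -
    have "e / N > 0" using that N by simp
    then obtain d where d: "d > 0" "\<forall>\<alpha>\<in>I. \<forall>\<beta>\<in>I. \<forall>x\<in>\<Theta>. \<forall>x'\<in>\<Theta>. \<forall>y\<in>\<Theta>. \<forall>y'\<in>\<Theta>.
      dist x x' < d \<and> dist y y' < d \<longrightarrow> \<bar>\<kappa> \<alpha> \<beta> x y - \<kappa> \<alpha> \<beta> x' y'\<bar> \<le> e / N" using \<kappa>_modulus by blast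
    have "\<bar>?v n \<beta> x - ?v n \<beta> y\<bar> \<le> e" if xy: "x \<in> \<Theta>" "y \<in> \<Theta>" "dist x y < d" for n x y
    proof -
      have "\<bar>?v n \<beta> x - ?v n \<beta> y\<bar> \<le> e / N * NN (Der (w n))"
      proof (rule TT_diff_le)
        show "\<bar>\<kappa> \<alpha> \<beta> z x - \<kappa> \<alpha> \<beta> z y\<bar> \<le> e / N" if "\<alpha> \<in> I" "z \<in> \<Theta>" for \<alpha> z
          using d that xy bI by simp
      qed (use w xy bI L1fam_Der in auto)
      also have "\<dots> \<le> e / N * N" using \<open>e / N > 0\<close> NN[of n] by (intro mult_left_mono) auto
      finally show ?thesis using N by simp
    qed
    then show ?thesis using d(1) by blast
  qed
  have "\<exists>(r :: nat \<Rightarrow> nat) g. strict_mono r \<and> (\<forall>\<beta>\<in>A. uniform_limit \<Theta> (\<lambda>n. ?v (r n) \<beta>) (g \<beta>) sequentially)"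
    if "finite A" "A \<subseteq> I" for A
    using that
  proof (induction A rule: finite_induct)
    case empty
    show ?case by (intro exI[of _ "\<lambda>n. n"]) (auto simp: strict_mono_def)
  next
    case (insert \<beta> A)
    then obtain r g where r: "strict_mono (r :: nat \<Rightarrow> nat)"
      "\<And>\<beta>. \<beta> \<in> A \<Longrightarrow> uniform_limit \<Theta> (\<lambda>n. ?v (r n) \<beta>) (g \<beta>) sequentially" by auto
    have bI: "\<beta> \<in> I" using insert by simp
    have "\<exists>(s :: nat \<Rightarrow> nat) g0. strict_mono s \<and> uniform_limit \<Theta> (\<lambda>n. ?v (r (s n)) \<beta>) g0 sequentially"
    proof (rule Arzela_Ascoli_bounded_domain[OF bdd, of "\<lambda>n. ?v (r n) \<beta>" C])
      show "\<bar>?v (r n) \<beta> x\<bar> \<le> C" if "x \<in> \<Theta>" for n x using b[OF bI that] .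
      show "\<exists>d>0. \<forall>n. \<forall>x\<in>\<Theta>. \<forall>y\<in>\<Theta>. dist x y < d \<longrightarrow> \<bar>?v (r n) \<beta> x - ?v (r n) \<beta> y\<bar> \<le> e" if "e > 0" for e
        using ec[OF that bI] by blast
    qed
    then obtain s g0 where s: "strict_mono (s :: nat \<Rightarrow> nat)" "uniform_limit \<Theta> (\<lambda>n. ?v (r (s n)) \<beta>) g0 sequentially"
      by blast
    have "uniform_limit \<Theta> (\<lambda>n. ?v (r (s n)) \<gamma>) (g \<gamma>) sequentially" if "\<gamma> \<in> A" for \<gamma>
      using filterlim_compose[OF r(2)[OF that] filterlim_subseq[OF s(1)]] .
    then have "\<forall>\<gamma>\<in>insert \<beta> A. uniform_limit \<Theta> (\<lambda>n. ?v ((r \<circ> s) n) \<gamma>) ((g(\<beta> := g0)) \<gamma>) sequentially"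
      using s(2) insert(2) by auto
    moreover have "strict_mono (r \<circ> s)" using r(1) s(1) by (rule strict_mono_o)
    ultimately show ?case by blast
  qed
  from this[OF finite_I order_refl] obtain r g where r: "strict_mono (r :: nat \<Rightarrow> nat)"
    and g: "\<And>\<beta>. \<beta> \<in> I \<Longrightarrow> uniform_limit \<Theta> (\<lambda>n. ?v (r n) \<beta>) (g \<beta>) sequentially" by blast
  note L = weak_deriv_uniform_limit[of k "\<lambda>n. T (w (r n))" "\<lambda>n. ?v (r n)" g]
  have "g (\<lambda>_. 0) \<in> Hk k \<Theta>" "(\<lambda>n. Hk.nrm k (\<lambda>x. T (w (r n)) x - g (\<lambda>_. 0) x)) \<longlonglongrightarrow> 0"
    by (rule L(3) L(4); use w T_weak_deriv TT_L2 L1fam_Der g I_iff in blast)+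
  then show ?thesis using r by blast
qed

lemma section_weak_deriv:
  assumes y: "y \<in> \<Theta>" and a: "\<alpha> \<in> I"
  shows "has_weak_deriv \<Theta> \<alpha> (\<lambda>x. h x y) (\<lambda>x. \<kappa> \<alpha> (\<lambda>_. 0) x y)"
proof -
  have "AE x in M. h x y = \<kappa> (\<lambda>_. 0) (\<lambda>_. 0) x y" using y by (intro AE_I2) (simp add: \<kappa>_00)
  then show ?thesis
    using has_weak_deriv_cong_AE[OF op, of "\<lambda>x. h x y" "\<lambda>x. \<kappa> (\<lambda>_. 0) (\<lambda>_. 0) x y"
        "\<lambda>x. \<kappa> \<alpha> (\<lambda>_. 0) x y" "\<lambda>x. \<kappa> \<alpha> (\<lambda>_. 0) x y" \<alpha>]
      \<kappa>_weak_deriv[OF zero_in_I a y] by simp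
qed

lemma \<kappa>_L2: "\<lbrakk>\<alpha> \<in> I; \<beta> \<in> I; y \<in> \<Theta>\<rbrakk> \<Longrightarrow> (\<lambda>x. \<kappa> \<alpha> \<beta> x y) \<in> L2 \<Theta>"
  using \<kappa>_bounded L2_bounded(1)[OF \<kappa>_measurable] by meson

lemma section_Hk: "y \<in> \<Theta> \<Longrightarrow> (\<lambda>x. h x y) \<in> Hk k \<Theta>"
proof (rule HkI)
  assume y: "y \<in> \<Theta>"
  have "AE x in M. h x y = \<kappa> (\<lambda>_. 0) (\<lambda>_. 0) x y" using y by (intro AE_I2) (simp add: \<kappa>_00)
  from iffD2[OF L2_cong_AE[OF this] \<kappa>_L2[OF zero_in_I zero_in_I y]] show "(\<lambda>x. h x y) \<in> L2 \<Theta>" .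
  show "(\<lambda>x. \<kappa> \<alpha> (\<lambda>_. 0) x y) \<in> L2 \<Theta> \<and> has_weak_deriv \<Theta> \<alpha> (\<lambda>x. h x y) (\<lambda>x. \<kappa> \<alpha> (\<lambda>_. 0) x y)"
    if "mi_order \<alpha> \<le> k" for \<alpha>
  proof -
    have "\<alpha> \<in> I" using that by (simp add: I_iff)
    then show ?thesis by (intro conjI \<kappa>_L2 section_weak_deriv y zero_in_I)
  qed
qed

text \<open>The weak derivatives of the section are its classical ones, so the inner product is the
  integral defining the kernel operator, that is, the value of \<open>T f\<close> at
  \<open>y\<close>.\<close>

lemma section_inner:
  assumes y: "y \<in> \<Theta>" and f: "f \<in> Hk k \<Theta>"
  shows "ip (\<lambda>x. h x y) f = TT (Der f) (\<lambda>_. 0) y"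
  using Hk_inner_weak[OF section_weak_deriv[OF y] Hk_weak_deriv(1)[OF f]]
  by (simp add: TT_def L2_inner_def I_def)

lemma Der_0_TT:
  "(\<And>\<alpha>. \<alpha> \<in> I \<Longrightarrow> AE x in M. F \<alpha> x = 0) \<Longrightarrow> TT F \<beta> y = 0"
  using TT_cong_AE[of F "\<lambda>_ _. 0" \<beta> y] by (simp add: TT_def)

lemma TT_Der_sum:
  assumes "finite A" "\<And>j. j \<in> A \<Longrightarrow> f j \<in> Hk k \<Theta>" "\<alpha> \<in> I" "y \<in> \<Theta>"
  shows "TT (Der (\<lambda>x. \<Sum>j\<in>A. t j * f j x)) \<alpha> y = (\<Sum>j\<in>A. t j * TT (Der (f j)) \<alpha> y)"
  using assms(1,2)
proof (induction A rule: finite_induct)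
  case empty
  have "TT (Der (\<lambda>x. 0 * 0 + 0 * 0)) \<alpha> y = 0"
    by (rule Der_0_TT) (use Der_linear[OF Hk.zero_in Hk.zero_in, of _ 0 0] in simp)
  then show ?case by simp
next
  case (insert i A)
  have s: "(\<lambda>x. \<Sum>j\<in>A. t j * f j x) \<in> Hk k \<Theta>" and i: "f i \<in> Hk k \<Theta>"
    using insert.prems by (auto intro: Hk.sum_in)
  have "TT (Der (\<lambda>x. t i * f i x + 1 * (\<Sum>j\<in>A. t j * f j x))) \<alpha> y =
     TT (\<lambda>\<alpha> x. t i * Der (f i) \<alpha> x + 1 * Der (\<lambda>x. \<Sum>j\<in>A. t j * f j x) \<alpha> x) \<alpha> y"
    by (intro TT_cong_AE Der_linear s i)
  also have "\<dots> = t i * TT (Der (f i)) \<alpha> y + 1 * TT (Der (\<lambda>x. \<Sum>j\<in>A. t j * f j x)) \<alpha> y"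
    by (intro TT_linear L1fam_Der s i assms)
  finally show ?case using insert by simp
qed

end

section \<open>Eigenfunction series and the expansion of the kernel\<close>

locale eigen_kernel = Ckk_kernel \<Theta> k h for \<Theta> :: "(real ^ 'n::finite) set" and k h +
  fixes J :: "nat set" and lam :: "nat \<Rightarrow> real" and e :: "nat \<Rightarrow> real ^ 'n \<Rightarrow> real"
  assumes eig: "eigensystem k \<Theta> h J lam e"
begin

lemma e_eigenspace: "j \<in> J \<Longrightarrow> e j \<in> eigenspace k \<Theta> h (lam j)"
  and lam_nz: "j \<in> J \<Longrightarrow> lam j \<noteq> 0"
  and e_orth: "\<lbrakk>i \<in> J; j \<in> J\<rbrakk> \<Longrightarrow> ip (e i) (e j) = (if i = j then 1 else 0)"
  using eig unfolding eigensystem_def by blast+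

lemma e_Hk: "j \<in> J \<Longrightarrow> e j \<in> Hk k \<Theta>"
  and e_AE: "j \<in> J \<Longrightarrow> AE x in M. T (e j) x = lam j * e j x"
  using e_eigenspace[of j] by (simp_all add: eigenspace_def)

text \<open>Here the exhaustiveness of the eigensystem enters. It will be applied to an eigenvector
  orthogonal to all \<open>e j\<close>, which it forces to be null.\<close>

lemma e_span:
  assumes "\<mu> \<noteq> 0" "f \<in> Hk k \<Theta>" "AE x in M. T f x = \<mu> * f x"
  shows "\<exists>F c. finite F \<and> F \<subseteq> J \<and> (AE x in M. f x = (\<Sum>j\<in>F. c j * e j x))"
proof -
  have "f \<in> eigenspace k \<Theta> h \<mu>" using assms by (simp add: eigenspace_def)
  moreover have "\<forall>\<mu> f. \<mu> \<noteq> 0 \<and> f \<in> eigenspace k \<Theta> h \<mu> \<longrightarrow>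
      (\<exists>F c. finite F \<and> F \<subseteq> {j\<in>J. lam j = \<mu>} \<and> (AE x in M. f x = (\<Sum>j\<in>F. c j * e j x)))"
    using eig unfolding eigensystem_def by (elim conjE)
  ultimately have "\<exists>F c. finite F \<and> F \<subseteq> {j\<in>J. lam j = \<mu>} \<and> (AE x in M. f x = (\<Sum>j\<in>F. c j * e j x))"
    using assms(1) by (elim allE impE) (rule conjI)
  then obtain F c where F: "finite F" "F \<subseteq> {j\<in>J. lam j = \<mu>}" "AE x in M. f x = (\<Sum>j\<in>F. c j * e j x)"
    by (elim exE conjE)
  have "F \<subseteq> J" using F(2) by auto
  with F(1,3) show ?thesis by (intro exI[of _ F] exI[of _ c] conjI)
qed

lemma T_e_inner:
  assumes "j \<in> J" "g \<in> Hk k \<Theta>"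
  shows "ip (T (e j)) g = lam j * ip (e j) g"
  using Hk_cong_AE(2)[OF e_AE[OF assms(1)]] Hk.scale_left[OF e_Hk[OF assms(1)] assms(2)] by simp

text \<open>The eigenvalue is the value of the nonnegative form at the unit vector
  \<open>e j\<close>.\<close>

lemma lam_pos: "j \<in> J \<Longrightarrow> lam j > 0"
  using B.nonneg[OF e_Hk, of j] T_e_inner[OF _ e_Hk, of j j] e_orth[of j j] lam_nz[of j] by simp

text \<open>The variational argument with the eigenfunctions as \<open>U\<close>; it plays the part
  of a spectral theorem for \<open>T\<close>.\<close>

lemma T_form_zero:
  assumes w: "w \<in> Hk k \<Theta>" "\<And>j. j \<in> J \<Longrightarrow> ip w (e j) = 0"
  shows "ip (T w) w = 0"
proof (rule ccontr)
  assume ne: "ip (T w) w \<noteq> 0"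
  obtain C where C: "\<forall>f\<in>Hk k \<Theta>. Hk.nrm k (T f) \<le> C * Hk.nrm k f" using T_bounded by blast
  have "\<exists>\<Lambda> w. \<Lambda> > 0 \<and> w \<in> Hk k \<Theta> \<and> (\<forall>u\<in>e ` J. ip w u = 0) \<and> ip w w > 0 \<and>
           ip (\<lambda>x. T w x - \<Lambda> * w x) (\<lambda>x. T w x - \<Lambda> * w x) = 0"
  proof (rule Rayleigh_eigenvector[OF Hk.function_semi_inner_axioms T_form, of C "e ` J" w])
    \<comment> \<open>The annihilator is invariant: symmetry of the form moves \<open>T\<close> to
      the eigenfunction.\<close>
    show "ip (T f) u = 0" if "f \<in> Hk k \<Theta>" "u \<in> e ` J" "\<forall>u\<in>e ` J. ip f u = 0" for f u
    proof -
      obtain j where j: "j \<in> J" "u = e j" using \<open>u \<in> e ` J\<close> by blast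
      have "ip (T f) u = ip (T (e j)) f" using B.sym[OF that(1) e_Hk[OF j(1)]] j by simp
      also have "\<dots> = lam j * ip f (e j)" using T_e_inner[OF j(1) that(1)] Hk.sym[OF that(1) e_Hk[OF j(1)]] by simp
      finally show ?thesis using that(3) j by simp
    qed
  qed (use T_in C T_compact e_Hk w ne in auto)
  then obtain \<Lambda> w where L: "\<Lambda> > 0" "w \<in> Hk k \<Theta>" "\<And>j. j \<in> J \<Longrightarrow> ip w (e j) = 0" "ip w w > 0"
    "ip (\<lambda>x. T w x - \<Lambda> * w x) (\<lambda>x. T w x - \<Lambda> * w x) = 0" by auto
  \<comment> \<open>The eigenvector equation is known in norm; the eigensystem speaks of equality
    almost everywhere.\<close>
  have "AE x in M. T w x - \<Lambda> * w x = 0"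
    by (rule Hk_nrm_0_AE[of _ k]) (use L T_in in \<open>auto simp: Hk.nrm_def intro!: Hk.diff_in Hk.scale_in\<close>)
  then have "AE x in M. T w x = \<Lambda> * w x" by eventually_elim simp
  from e_span[OF _ L(2) this] L(1) have "\<exists>F c. finite F \<and> F \<subseteq> J \<and> (AE x in M. w x = (\<Sum>j\<in>F. c j * e j x))"
    by simp
  then obtain F c where F: "finite F" "F \<subseteq> J" "AE x in M. w x = (\<Sum>j\<in>F. c j * e j x)"
    by (elim exE conjE)
  have "ip w w = ip (\<lambda>x. \<Sum>j\<in>F. c j * e j x) w" by (rule Hk_cong_AE(2)[OF F(3)])
  also have "\<dots> = (\<Sum>j\<in>F. c j * ip (e j) w)" using F(2) e_Hk by (intro Hk.sum_left L(2)) auto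
  also have "\<dots> = 0" using F(2) L(3) Hk.sym[OF L(2) e_Hk] by (intro sum.neutral) auto
  finally show False using L(4) by simp
qed

definition E :: "nat \<Rightarrow> ('n \<Rightarrow> nat) \<Rightarrow> real ^ 'n \<Rightarrow> real" where
  "E j \<alpha> y = TT (Der (e j)) \<alpha> y / lam j"

text \<open>\<open>E j \<alpha>\<close> is the continuous version of the weak derivative of \<open>e j\<close>; the scaled functions \<open>V j\<close> of order
  \<open>0\<close> form an orthonormal basis of the reproducing kernel Hilbert space.\<close>

definition V :: "nat \<Rightarrow> ('n \<Rightarrow> nat) \<Rightarrow> real ^ 'n \<Rightarrow> real" where
  "V j \<alpha> y = sqrt (lam j) * E j \<alpha> y"

lemma E_weak_deriv:
  assumes "j \<in> J" "\<alpha> \<in> I"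
  shows "has_weak_deriv \<Theta> \<alpha> (e j) (E j \<alpha>)"
proof -
  have 1: "has_weak_deriv \<Theta> \<alpha> (\<lambda>x. 1 / lam j * T (e j) x + 0 * T (e j) x)
     (\<lambda>x. 1 / lam j * TT (Der (e j)) \<alpha> x + 0 * TT (Der (e j)) \<alpha> x)"
    using assms by (intro has_weak_deriv_linear[OF op] T_weak_deriv e_Hk)
  have 2: "AE x in M. 1 / lam j * T (e j) x + 0 * T (e j) x = e j x"
    using e_AE[OF assms(1)] by eventually_elim (simp add: lam_nz[OF assms(1)])
  have 3: "AE x in M. 1 / lam j * TT (Der (e j)) \<alpha> x + 0 * TT (Der (e j)) \<alpha> x = E j \<alpha> x"
    by (simp add: E_def)
  show ?thesis by (rule iffD1[OF has_weak_deriv_cong_AE[OF op 2 3] 1])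
qed

lemma E_continuous: "\<lbrakk>j \<in> J; \<alpha> \<in> I\<rbrakk> \<Longrightarrow> continuous_on \<Theta> (E j \<alpha>)"
  unfolding E_def by (intro continuous_on_divide TT_continuous L1fam_Der e_Hk continuous_on_const) (auto simp: lam_nz)

lemma E_L2: "\<lbrakk>j \<in> J; \<alpha> \<in> I\<rbrakk> \<Longrightarrow> E j \<alpha> \<in> L2 \<Theta>"
  using L2.scale_in[OF TT_L2[OF L1fam_Der[OF e_Hk]], of j \<alpha> "1 / lam j"] by (simp add: E_def[abs_def])

lemma T_form_sum:
  assumes "finite A" "A \<subseteq> J"
  shows "ip (T (\<lambda>x. \<Sum>j\<in>A. t j * e j x)) (\<lambda>x. \<Sum>j\<in>A. t j * e j x) = (\<Sum>j\<in>A. lam j * (t j)\<^sup>2)"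
proof -
  have eA: "e j \<in> Hk k \<Theta>" if "j \<in> A" for j using that assms e_Hk by auto
  have s: "(\<lambda>x. \<Sum>j\<in>A. t j * e j x) \<in> Hk k \<Theta>" using eA by (rule Hk.sum_in)
  have "ip (T (\<lambda>x. \<Sum>j\<in>A. t j * e j x)) (\<lambda>x. \<Sum>j\<in>A. t j * e j x)
     = (\<Sum>i\<in>A. t i * ip (T (e i)) (\<lambda>x. \<Sum>j\<in>A. t j * e j x))"
    by (rule B.sum_left[OF eA s])
  also have "\<dots> = (\<Sum>i\<in>A. t i * (\<Sum>j\<in>A. t j * (lam i * (if i = j then 1 else 0))))"
  proof (intro sum.cong refl arg_cong2[where f = "(*)"])
    fix i assume i: "i \<in> A"
    have "ip (T (e i)) (\<lambda>x. \<Sum>j\<in>A. t j * e j x) = (\<Sum>j\<in>A. t j * ip (T (e i)) (e j))"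
      by (rule B.sum_right[OF eA eA[OF i]])
    also have "\<dots> = (\<Sum>j\<in>A. t j * (lam i * (if i = j then 1 else 0)))"
    proof (intro sum.cong refl arg_cong2[where f = "(*)"])
      fix j assume "j \<in> A"
      then show "ip (T (e i)) (e j) = lam i * (if i = j then 1 else 0)"
        using T_e_inner[of i "e j"] e_orth[of i j] eA i assms(2) by (simp add: subset_iff)
    qed
    finally show "ip (T (e i)) (\<lambda>x. \<Sum>j\<in>A. t j * e j x) = \<dots>" .
  qed
  also have "\<dots> = (\<Sum>j\<in>A. lam j * (t j)\<^sup>2)"
    using assms(1) by (intro sum.cong refl) (simp add: if_distrib power2_eq_square cong: if_cong)
  finally show ?thesis .
qed

text \<open>With the values \<open>E j \<alpha> x\<close> as coefficients, the quadratic form at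
  \<open>?w\<close> and the derivative of its image at \<open>x\<close> are both the sum S of the
  squares, so \<open>BB_point\<close> reads 0 \<le> S - 2 S +
  \<open>\<kappa> \<alpha> \<alpha> x x\<close>.\<close>

lemma Bessel:
  assumes A: "finite A" "A \<subseteq> J" and a: "\<alpha> \<in> I" "x \<in> \<Theta>"
  shows "(\<Sum>j\<in>A. (V j \<alpha> x)\<^sup>2) \<le> \<kappa> \<alpha> \<alpha> x x"
proof -
  let ?w = "\<lambda>x'. \<Sum>j\<in>A. E j \<alpha> x * e j x'"
  have eA: "e j \<in> Hk k \<Theta>" if "j \<in> A" for j using that A e_Hk by auto
  have w: "?w \<in> Hk k \<Theta>" using eA by (rule Hk.sum_in)
  have V2: "(V j \<alpha> x)\<^sup>2 = lam j * (E j \<alpha> x)\<^sup>2" if "j \<in> A" for j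
    using lam_pos[of j] A that by (auto simp: V_def power_mult_distrib)
  have "BB (Der ?w) (Der ?w) = (\<Sum>j\<in>A. (V j \<alpha> x)\<^sup>2)"
    using T_form_sum[OF A, of "\<lambda>j. E j \<alpha> x"] T_inner[OF w w] V2 by simp
  moreover have "TT (Der ?w) \<alpha> x = (\<Sum>j\<in>A. (V j \<alpha> x)\<^sup>2)"
  proof -
    have "TT (Der ?w) \<alpha> x = (\<Sum>j\<in>A. E j \<alpha> x * TT (Der (e j)) \<alpha> x)"
      by (rule TT_Der_sum[OF A(1) eA a])
    also have "\<dots> = (\<Sum>j\<in>A. (V j \<alpha> x)\<^sup>2)"
    proof (rule sum.cong)
    fix j assume j: "j \<in> A"
    then show "E j \<alpha> x * TT (Der (e j)) \<alpha> x = (V j \<alpha> x)\<^sup>2"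
      using V2[OF j] lam_nz[of j] A by (auto simp: E_def power2_eq_square)
    qed simp
    finally show ?thesis .
  qed
  ultimately show ?thesis using BB_point[OF L1fam_Der[OF w] a] by simp
qed

lemma V_ell2:
  assumes "\<alpha> \<in> I" "x \<in> \<Theta>"
  shows "(\<lambda>j. V j \<alpha> x) \<in> ell2 J" "J' \<subseteq> J \<Longrightarrow> (ell2.nrm J' (\<lambda>j. V j \<alpha> x))\<^sup>2 \<le> \<kappa> \<alpha> \<alpha> x x"
proof -
  have s: "(\<lambda>j. (V j \<alpha> x)\<^sup>2) summable_on J'" if "J' \<subseteq> J" for J'
    using Bessel[OF _ _ assms] that
    by (intro nonneg_bdd_above_summable_on) (auto intro!: bdd_aboveI[of _ "\<kappa> \<alpha> \<alpha> x x"])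
  then show "(\<lambda>j. V j \<alpha> x) \<in> ell2 J" by (simp add: ell2_def)
  show "(ell2.nrm J' (\<lambda>j. V j \<alpha> x))\<^sup>2 \<le> \<kappa> \<alpha> \<alpha> x x" if J': "J' \<subseteq> J"
  proof -
    have "(\<lambda>j. V j \<alpha> x) \<in> ell2 J'" using s[OF J'] by (simp add: ell2_def)
    then have "(ell2.nrm J' (\<lambda>j. V j \<alpha> x))\<^sup>2 = infsum (\<lambda>j. (V j \<alpha> x)\<^sup>2) J'"
      by (subst ell2.nrm_sq) (auto simp: power2_eq_square)
    also have "\<dots> \<le> \<kappa> \<alpha> \<alpha> x x"
      using Bessel[OF _ _ assms] J' by (intro infsum_le_finite_sums s[OF J']) auto
    finally show ?thesis .
  qed
qed

text \<open>Cauchy-Schwarz on the tail: the factor from \<open>c\<close> tends to 0 and is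
  independent of \<open>y\<close>, while the factor from \<open>V\<close> is at most
  \<open>sqrt C\<close> for every \<open>y\<close>.\<close>

lemma V_uniform_limit:
  assumes c: "c \<in> ell2 J" and a: "\<alpha> \<in> I"
  shows "uniform_limit \<Theta> (\<lambda>n y. \<Sum>j\<in>J \<inter> {..n}. c j * V j \<alpha> y) (\<lambda>y. \<Sum>\<^sub>\<infinity>j\<in>J. c j * V j \<alpha> y) sequentially"
proof -
  obtain C where C: "C > 0" "\<forall>\<alpha>\<in>I. \<forall>\<beta>\<in>I. \<forall>x\<in>\<Theta>. \<forall>y\<in>\<Theta>. \<bar>\<kappa> \<alpha> \<beta> x y\<bar> \<le> C" using \<kappa>_bounded by blast
  have bound: "\<bar>(\<Sum>j\<in>J \<inter> {..n}. c j * V j \<alpha> y) - (\<Sum>\<^sub>\<infinity>j\<in>J. c j * V j \<alpha> y)\<bar> \<le> ell2.nrm (J - {..n}) c * sqrt C"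
    if y: "y \<in> \<Theta>" for n y
  proof -
    let ?J = "J - {..n}" and ?f = "\<lambda>j. c j * V j \<alpha> y"
    have s: "?f summable_on J" by (rule ell2_mult_summable[OF c V_ell2(1)[OF a y]])
    have "infsum ?f (J - (J \<inter> {..n})) = infsum ?f J - infsum ?f (J \<inter> {..n})"
      by (rule infsum_Diff) (use s in auto)
    moreover have "J - (J \<inter> {..n}) = ?J" by auto
    ultimately have "(\<Sum>j\<in>J \<inter> {..n}. ?f j) - infsum ?f J = - infsum ?f ?J" by simp
    then have "\<bar>(\<Sum>j\<in>J \<inter> {..n}. ?f j) - infsum ?f J\<bar> = \<bar>infsum ?f ?J\<bar>" by simp
    also have "\<dots> \<le> ell2.nrm ?J c * ell2.nrm ?J (\<lambda>j. V j \<alpha> y)"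
    proof (rule ell2.Cauchy_Schwarz)
      show "c \<in> ell2 ?J" "(\<lambda>j. V j \<alpha> y) \<in> ell2 ?J"
        using c V_ell2(1)[OF a y] by (auto simp: ell2_def intro: summable_on_subset_banach)
    qed
    also have "\<dots> \<le> ell2.nrm ?J c * sqrt C"
    proof (rule mult_left_mono)
      have "(ell2.nrm ?J (\<lambda>j. V j \<alpha> y))\<^sup>2 \<le> C"
        using V_ell2(2)[OF a y, of ?J] C(2) a y by (meson Diff_subset abs_ge_self order.trans)
      then show "ell2.nrm ?J (\<lambda>j. V j \<alpha> y) \<le> sqrt C" by (rule real_le_rsqrt)
      show "0 \<le> ell2.nrm ?J c" using c by (intro ell2.nrm_nonneg) (auto simp: ell2_def intro: summable_on_subset_banach)
    qed
    finally show ?thesis .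
  qed
  have lim: "(\<lambda>n. ell2.nrm (J - {..n}) c * sqrt C) \<longlonglongrightarrow> 0"
    by (rule tendsto_mult_left_zero[OF ell2_tail[OF c]])
  show ?thesis
  proof (rule uniform_limitI)
    fix \<epsilon> :: real assume "\<epsilon> > 0"
    then have "\<forall>\<^sub>F n in sequentially. ell2.nrm (J - {..n}) c * sqrt C < \<epsilon>"
      using lim by (intro order_tendstoD)
    then show "\<forall>\<^sub>F n in sequentially. \<forall>y\<in>\<Theta>. dist (\<Sum>j\<in>J \<inter> {..n}. c j * V j \<alpha> y) (\<Sum>\<^sub>\<infinity>j\<in>J. c j * V j \<alpha> y) < \<epsilon>"
      by eventually_elim (auto simp: dist_real_def intro: le_less_trans[OF bound])
  qed
qed

text \<open>Partial sums in the given \<open>e j\<close>, which agree with sums of the continuous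
  functions \<open>c j * V j\<close> of order 0 only almost everywhere.\<close>

definition psum :: "(nat \<Rightarrow> real) \<Rightarrow> nat \<Rightarrow> real ^ 'n \<Rightarrow> real" where
  "psum c n x = (\<Sum>j\<in>J \<inter> {..n}. (c j * sqrt (lam j)) * e j x)"

definition u :: "nat \<Rightarrow> real ^ 'n \<Rightarrow> real" where
  "u j x = (if x \<in> \<Theta> then V j (\<lambda>_. 0) x else 0)"

definition \<Phi> :: "(nat \<Rightarrow> real) \<Rightarrow> real ^ 'n \<Rightarrow> real" where
  "\<Phi> c x = (\<Sum>\<^sub>\<infinity>j\<in>J. c j * u j x)"

lemma psum_Hk: "psum c n \<in> Hk k \<Theta>"
  unfolding psum_def[abs_def] by (rule Hk.sum_in) (auto intro: e_Hk)

lemma psum_weak_deriv: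
  assumes "\<alpha> \<in> I"
  shows "has_weak_deriv \<Theta> \<alpha> (psum c n) (\<lambda>y. \<Sum>j\<in>J \<inter> {..n}. c j * V j \<alpha> y)"
proof -
  have "has_weak_deriv \<Theta> \<alpha> (\<lambda>x. \<Sum>j\<in>A. (c j * sqrt (lam j)) * e j x) (\<lambda>y. \<Sum>j\<in>A. (c j * sqrt (lam j)) * E j \<alpha> y)"
    if "finite A" "A \<subseteq> J" for A
    using that
  proof (induction A rule: finite_induct)
    case empty
    then show ?case by (simp add: has_weak_deriv_def continuous_imp_locally_integrable)
  next
    case (insert j A)
    have "has_weak_deriv \<Theta> \<alpha> (\<lambda>x. (c j * sqrt (lam j)) * e j x + 1 * (\<Sum>j\<in>A. (c j * sqrt (lam j)) * e j x))
       (\<lambda>x. (c j * sqrt (lam j)) * E j \<alpha> x + 1 * (\<Sum>j\<in>A. (c j * sqrt (lam j)) * E j \<alpha> x))"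
      using insert assms by (intro has_weak_deriv_linear[OF op] E_weak_deriv) auto
    then show ?case using insert by simp
  qed
  from this[of "J \<inter> {..n}"] show ?thesis by (simp add: psum_def[abs_def] V_def mult.assoc)
qed

lemma \<Phi>_on: "x \<in> \<Theta> \<Longrightarrow> \<Phi> c x = (\<Sum>\<^sub>\<infinity>j\<in>J. c j * V j (\<lambda>_. 0) x)"
  and \<Phi>_off: "x \<notin> \<Theta> \<Longrightarrow> \<Phi> c x = 0"
  by (simp_all add: \<Phi>_def u_def)

lemma u_ell2: "(\<lambda>j. u j x) \<in> ell2 J"
  using V_ell2(1)[OF zero_in_I, of x] ell2.zero_in[of J] by (cases "x \<in> \<Theta>") (simp_all add: u_def)

lemma \<Phi>_continuous:
  assumes c: "c \<in> ell2 J"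
  shows "continuous_on \<Theta> (\<Phi> c)"
proof -
  have "continuous_on \<Theta> (\<lambda>y. \<Sum>\<^sub>\<infinity>j\<in>J. c j * V j (\<lambda>_. 0) y)"
  proof (rule uniform_limit_theorem[OF _ V_uniform_limit[OF c zero_in_I]])
    show "\<forall>\<^sub>F n in sequentially. continuous_on \<Theta> (\<lambda>y. \<Sum>j\<in>J \<inter> {..n}. c j * V j (\<lambda>_. 0) y)"
      unfolding V_def by (intro always_eventually allI continuous_intros E_continuous) auto
  qed simp
  then show ?thesis by (rule continuous_on_eq) (simp add: \<Phi>_on)
qed

text \<open>All derivatives of the partial sums converge uniformly, so the pointwise sum is the
  Sobolev limit as well.\<close>

lemma \<Phi>_Hk_limit:
  assumes c: "c \<in> ell2 J"
  shows "\<Phi> c \<in> Hk k \<Theta>" "(\<lambda>n. Hk.nrm k (\<lambda>x. psum c n x - \<Phi> c x)) \<longlonglongrightarrow> 0"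
proof -
  let ?G = "\<lambda>\<alpha> y. \<Sum>\<^sub>\<infinity>j\<in>J. c j * V j \<alpha> y" and ?F = "\<lambda>n \<alpha> y. \<Sum>j\<in>J \<inter> {..n}. c j * V j \<alpha> y"
  have F: "?F n \<alpha> \<in> L2 \<Theta>" if "mi_order \<alpha> \<le> k" for n \<alpha>
    unfolding V_def using that by (intro L2.sum_in L2.scale_in E_L2) (auto simp: I_iff)
  note W = weak_deriv_uniform_limit[of k "psum c" ?F ?G]
  have p: "\<And>n \<alpha>. mi_order \<alpha> \<le> k \<Longrightarrow> has_weak_deriv \<Theta> \<alpha> (psum c n) (?F n \<alpha>)"
    using psum_weak_deriv by (simp add: I_iff)
  have l: "\<And>\<alpha>. mi_order \<alpha> \<le> k \<Longrightarrow> uniform_limit \<Theta> (\<lambda>n. ?F n \<alpha>) (?G \<alpha>) sequentially"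
    using V_uniform_limit[OF c] by (simp add: I_iff)
  have ae: "AE x in M. ?G (\<lambda>_. 0) x = \<Phi> c x" by (intro AE_I2) (simp add: \<Phi>_on)
  show "\<Phi> c \<in> Hk k \<Theta>" using W(3)[OF p F l] Hk_cong_AE(1)[OF ae] by simp
  have "Hk.nrm k (\<lambda>x. psum c n x - \<Phi> c x) = Hk.nrm k (\<lambda>x. psum c n x - ?G (\<lambda>_. 0) x)" for n
  proof -
    have "AE x in M. psum c n x - \<Phi> c x = psum c n x - ?G (\<lambda>_. 0) x" using ae by eventually_elim simp
    then show ?thesis unfolding Hk.nrm_def using Hk_cong_AE(2,3) by presburger
  qed
  then show "(\<lambda>n. Hk.nrm k (\<lambda>x. psum c n x - \<Phi> c x)) \<longlonglongrightarrow> 0" using W(4)[OF p F l] by simp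
qed

lemma \<Phi>_inner_limit:
  assumes "c \<in> ell2 J" "g \<in> Hk k \<Theta>"
  shows "(\<lambda>n. \<Sum>j\<in>J \<inter> {..n}. (c j * sqrt (lam j)) * ip (e j) g) \<longlonglongrightarrow> ip (\<Phi> c) g"
proof -
  have "(\<lambda>n. ip (psum c n) g) \<longlonglongrightarrow> ip (\<Phi> c) g"
    by (rule Hk.ip_limit_left[OF psum_Hk \<Phi>_Hk_limit(1)[OF assms(1)] assms(2) \<Phi>_Hk_limit(2)[OF assms(1)]])
  moreover have "ip (psum c n) g = (\<Sum>j\<in>J \<inter> {..n}. (c j * sqrt (lam j)) * ip (e j) g)" for n
    unfolding psum_def[abs_def] by (rule Hk.sum_left) (use e_Hk assms in auto)
  ultimately show ?thesis by simp
qed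

text \<open>By orthonormality the pairings of the partial sums with \<open>e j\<close> are constant
  from index \<open>j\<close> on.\<close>

lemma \<Phi>_coefficient:
  assumes c: "c \<in> ell2 J" and j: "j \<in> J"
  shows "ip (\<Phi> c) (e j) = c j * sqrt (lam j)"
proof (rule LIMSEQ_unique[OF \<Phi>_inner_limit[OF c e_Hk[OF j]]])
  have "(\<Sum>i\<in>J \<inter> {..n}. (c i * sqrt (lam i)) * ip (e i) (e j)) = c j * sqrt (lam j)" if "n \<ge> j" for n
  proof -
    have "(\<Sum>i\<in>J \<inter> {..n}. (c i * sqrt (lam i)) * ip (e i) (e j)) = (\<Sum>i\<in>J \<inter> {..n}. if i = j then c j * sqrt (lam j) else 0)"
      using j by (intro sum.cong) (auto simp: e_orth)
    then show ?thesis using j that by simp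
  qed
  then show "(\<lambda>n. \<Sum>i\<in>J \<inter> {..n}. (c i * sqrt (lam i)) * ip (e i) (e j)) \<longlonglongrightarrow> c j * sqrt (lam j)"
    by (intro tendsto_eventually) (auto simp: eventually_sequentially)
qed

text \<open>Mercer's theorem: the remainder \<open>R\<close> of a kernel section is orthogonal to all eigenfunctions,
  hence in the kernel of \<open>T\<close>, and evaluating \<open>T R\<close> at \<open>x\<close> gives the squared norm of \<open>R\<close>.\<close>

lemma Mercer:
  assumes x: "x \<in> \<Theta>" and y: "y \<in> \<Theta>"
  shows "h x y = (\<Sum>\<^sub>\<infinity>j\<in>J. u j x * u j y)"
proof -
  let ?c = "\<lambda>j. u j x"
  define R where "R = (\<lambda>y. h y x - \<Phi> ?c y)"
  note c = u_ell2[of x]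
  have P: "\<Phi> ?c \<in> Hk k \<Theta>" by (rule \<Phi>_Hk_limit(1)[OF c])
  have R: "R \<in> Hk k \<Theta>" unfolding R_def by (rule Hk.diff_in[OF section_Hk[OF x] P])
  have orth: "ip R (e j) = 0" if j: "j \<in> J" for j
  proof -
    \<comment> \<open>The first term is \<open>lam j * E j\<close> of order 0 at \<open>x\<close>,
      the value of \<open>T (e j)\<close> there. The second is the same number: \<open>u\<close>
      contributes one factor \<open>sqrt (lam j)\<close> and the coefficient of the series the
      other.\<close>
    have "ip R (e j) = TT (Der (e j)) (\<lambda>_. 0) x - u j x * sqrt (lam j)"
      unfolding R_def Hk.diff_left[OF section_Hk[OF x] P e_Hk[OF j]] section_inner[OF x e_Hk[OF j]] \<Phi>_coefficient[OF c j] ..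
    also have "u j x * sqrt (lam j) = (sqrt (lam j) * sqrt (lam j)) * E j (\<lambda>_. 0) x"
      using x by (simp only: u_def V_def if_True mult_ac)
    also have "\<dots> = TT (Der (e j)) (\<lambda>_. 0) x" using lam_pos[OF j] by (simp add: E_def)
    finally show ?thesis by simp
  qed
  have "ip (T R) R = 0" by (rule T_form_zero[OF R orth])
  \<comment> \<open>Cauchy-Schwarz for the form: its vanishing at \<open>R\<close> makes
    \<open>T R\<close> orthogonal to everything, itself included.\<close>
  then have "ip (T R) (T R) = 0" using B.nrm_eq_0D[OF R T_in[OF R]] by simp
  then have "AE z in M. T R z = 0" using Hk_nrm_0_AE[OF T_in[OF R]] by (simp add: Hk.nrm_def)
  moreover have "AE z in M. T R z = TT (Der R) (\<lambda>_. 0) z" by (intro AE_I2) (simp add: T_eq[OF R])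
  ultimately have "AE z in M. TT (Der R) (\<lambda>_. 0) z = 0" by eventually_elim simp
  \<comment> \<open>Continuity turns almost everywhere into everywhere, so the value at the
    particular point \<open>x\<close> is available; by \<open>section_inner\<close> it is an inner
    product with the section itself.\<close>
  then have "TT (Der R) (\<lambda>_. 0) x = 0"
    by (rule continuous_AE_zero_imp_zero[OF op TT_continuous[OF L1fam_Der[OF R] zero_in_I] _ x])
  then have 1: "ip (\<lambda>y. h y x) R = 0" using section_inner[OF x R] by simp
  have "ip (e j) R = 0" if "j \<in> J" for j using orth[OF that] Hk.sym[OF R e_Hk[OF that]] by simp
  then have "(\<lambda>n. 0) \<longlonglongrightarrow> ip (\<Phi> ?c) R" using \<Phi>_inner_limit[OF c R] by simp
  then have 2: "ip (\<Phi> ?c) R = 0" by (simp add: LIMSEQ_const_iff)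
  have "ip R R = ip (\<lambda>y. h y x) R - ip (\<Phi> ?c) R"
    using Hk.diff_left[OF section_Hk[OF x] P R] by (simp add: R_def)
  then have "AE z in M. R z = 0" using 1 2 by (intro Hk_nrm_0_AE[OF R]) (simp add: Hk.nrm_def)
  moreover have "continuous_on \<Theta> R"
  proof -
    have "continuous_on \<Theta> (\<lambda>y. h y x)"
      by (rule continuous_on_eq[OF \<kappa>_continuous_left[OF zero_in_I zero_in_I x]]) (use x in \<open>simp add: \<kappa>_00\<close>)
    then show ?thesis unfolding R_def by (intro continuous_on_diff \<Phi>_continuous c)
  qed
  ultimately have "R y = 0" using continuous_AE_zero_imp_zero[OF op _ _ y] by blast
  then show ?thesis using h_sym[OF x y] by (simp add: R_def \<Phi>_def)
qed

section \<open>The spectral space as an image of l^2\<close>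

lemma continuous_rep_\<Phi>:
  assumes "c \<in> ell2 J" "AE x in M. \<Phi> c x = f x"
  shows "continuous_rep \<Theta> f = \<Phi> c"
  using assms by (intro continuous_rep_eqI op \<Phi>_continuous \<Phi>_off)

text \<open>Coefficients correspond by \<open>a j = c j * sqrt (lam j)\<close>. A function of the
  spectral class and the series \<open>\<Phi> c\<close> are Sobolev limits of the same partial sums,
  hence agree almost everywhere, and the series is the continuous one.\<close>

lemma spectral_class_image: "continuous_rep \<Theta> ` spectral_class k \<Theta> J lam e = \<Phi> ` ell2 J"
proof (intro equalityI subsetI)
  fix F assume "F \<in> continuous_rep \<Theta> ` spectral_class k \<Theta> J lam e"
  then obtain f a where f: "f \<in> Hk k \<Theta>" "has_expansion k \<Theta> J e f a"
    "(\<lambda>j. (a j / sqrt (lam j))\<^sup>2) summable_on J" "F = continuous_rep \<Theta> f"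
    by (auto simp: spectral_class_def)
  define c where "c = (\<lambda>j. a j / sqrt (lam j))"
  have c: "c \<in> ell2 J" using f(3) by (simp add: ell2_def c_def)
  have p: "psum c n = (\<lambda>x. \<Sum>j\<in>J \<inter> {..n}. a j * e j x)" for n
    by (auto simp: psum_def c_def fun_eq_iff lam_nz intro!: sum.cong)
  have "(\<lambda>n. Hk.nrm k (\<lambda>x. psum c n x - f x)) \<longlonglongrightarrow> 0"
    unfolding Hk.nrm_diff_commute[OF psum_Hk f(1)] unfolding p using f(2) by (simp add: has_expansion_def Hk_norm_nrm)
  from Hk.nrm_diff_le_limit[OF psum_Hk \<Phi>_Hk_limit(1)[OF c] f(1) \<Phi>_Hk_limit(2)[OF c] this]
  have "AE x in M. \<Phi> c x - f x = 0" by (rule Hk_nrm_0_AE[OF Hk.diff_in[OF \<Phi>_Hk_limit(1)[OF c] f(1)]])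
  then have "AE x in M. \<Phi> c x = f x" by eventually_elim simp
  then show "F \<in> \<Phi> ` ell2 J" using continuous_rep_\<Phi>[OF c] c f(4) by blast
next
  fix F assume "F \<in> \<Phi> ` ell2 J"
  then obtain c where c: "c \<in> ell2 J" "F = \<Phi> c" by blast
  let ?a = "\<lambda>j. c j * sqrt (lam j)"
  have "has_expansion k \<Theta> J e (\<Phi> c) ?a"
    unfolding has_expansion_def Hk_norm_nrm
    using \<Phi>_Hk_limit[OF c(1)] Hk.nrm_diff_commute[OF psum_Hk \<Phi>_Hk_limit(1)[OF c(1)]] by (simp add: psum_def[abs_def])
  moreover have "(\<lambda>j. (?a j / sqrt (lam j))\<^sup>2) summable_on J \<longleftrightarrow> (\<lambda>j. (c j)\<^sup>2) summable_on J"
    using lam_nz by (intro summable_on_cong) simp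
  ultimately have "\<Phi> c \<in> spectral_class k \<Theta> J lam e"
    using c(1) \<Phi>_Hk_limit(1)[OF c(1)] unfolding spectral_class_def ell2_def by blast
  moreover have "continuous_rep \<Theta> (\<Phi> c) = \<Phi> c" by (rule continuous_rep_\<Phi>[OF c(1)]) simp
  ultimately show "F \<in> continuous_rep \<Theta> ` spectral_class k \<Theta> J lam e" using c(2) by (metis image_eqI)
qed

text \<open>The Sobolev coefficients of the two series carry a factor \<open>sqrt (lam j)\<close>
  each, which the division by \<open>lam j\<close> removes.\<close>

lemma spectral_inner_\<Phi>:
  assumes "c \<in> ell2 J" "d \<in> ell2 J"
  shows "spectral_inner k \<Theta> J lam e (\<Phi> c) (\<Phi> d) = (\<Sum>\<^sub>\<infinity>j\<in>J. c j * d j)"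
  unfolding spectral_inner_def
proof (rule infsum_cong)
  fix j assume j: "j \<in> J"
  then show "ip (\<Phi> c) (e j) * ip (\<Phi> d) (e j) / lam j = c j * d j"
  proof -
    have "ip (\<Phi> c) (e j) * ip (\<Phi> d) (e j) = (sqrt (lam j) * sqrt (lam j)) * (c j * d j)"
      unfolding \<Phi>_coefficient[OF assms(1) j] \<Phi>_coefficient[OF assms(2) j] by (simp only: mult_ac)
    then show ?thesis using lam_pos[OF j] by simp
  qed
qed

lemma spectral_space_eq_RKHS: "spectral_space k \<Theta> J lam e = RKHS \<Theta> h"
proof -
  let ?H = "\<Phi> ` ell2 J"
  let ?ip = "\<lambda>f g. if f \<in> ?H \<and> g \<in> ?H then spectral_inner k \<Theta> J lam e f g else 0"
  have "RKHS \<Theta> h = (?H, ?ip)"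
  proof (rule RKHS_feature_map[of \<Theta> u J])
    show "?H = (\<lambda>c x. \<Sum>\<^sub>\<infinity>j\<in>J. c j * u j x) ` ell2 J" by (simp add: \<Phi>_def[abs_def])
    show "?ip (\<lambda>x. \<Sum>\<^sub>\<infinity>j\<in>J. c j * u j x) (\<lambda>x. \<Sum>\<^sub>\<infinity>j\<in>J. d j * u j x) = (\<Sum>\<^sub>\<infinity>j\<in>J. c j * d j)"
      if "c \<in> ell2 J" "d \<in> ell2 J" for c d
    proof -
      have "(\<lambda>x. \<Sum>\<^sub>\<infinity>j\<in>J. c j * u j x) = \<Phi> c" for c by (simp add: \<Phi>_def fun_eq_iff)
      then show ?thesis using spectral_inner_\<Phi>[OF that] that by simp
    qed
    show "u j x = 0" if "x \<notin> \<Theta>" for j x using that by (simp add: u_def)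
    show "(\<lambda>j. u j x) \<in> ell2 J" for x by (rule u_ell2)
    show "?ip f g = 0" if "f \<notin> ?H \<or> g \<notin> ?H" for f g using that by auto
    show "h x y = (\<Sum>\<^sub>\<infinity>j\<in>J. u j x * u j y)" if "x \<in> \<Theta>" "y \<in> \<Theta>" for x y using that by (rule Mercer)
  qed
  then show ?thesis by (simp add: spectral_space_def Let_def spectral_class_image)
qed

end

theorem theorem3p12:
  fixes \<Theta> :: "(real ^ 'n::finite) set"
    and k :: nat
    and h :: "real ^ 'n \<Rightarrow> real ^ 'n \<Rightarrow> real"
    and J :: "nat set"
    and lam :: "nat \<Rightarrow> real"
    and e :: "nat \<Rightarrow> real ^ 'n \<Rightarrow> real"
  assumes "open \<Theta>" and "bounded \<Theta>"
    and "h \<in> C_kk k \<Theta>"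
    and "positive_definite_kernel \<Theta> h"
    and "eigensystem k \<Theta> h J lam e"
  shows "spectral_space k \<Theta> J lam e = RKHS \<Theta> h"
proof -
  interpret eigen_kernel \<Theta> k h J lam e by unfold_locales (fact assms)+
  show ?thesis by (rule spectral_space_eq_RKHS)
qed

end
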